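(* Let $(\mathcal W\cup\mathcal W',\mathcal Y\cup\mathcal Y')$ be an $m$-triangular labyrinth patterns system such that there is a unique $\pi\in\mathcal P=\{\{1,2\},\{1,3\},\{2,3\}\}$ for which the system is $\pi$-blocked. Then both for $L^{w}_\infty$ and for $L^{y}_\infty$ the following hold: (a) Every non-trivial arc in the fractal has finite length. (b) All non-trivial arcs of the fractal have Hausdorff dimension one. (c) For any non-trivial arc in the fractal there exists the tangent to the arc at almost all (with respect to Lebesgue measure) points of the arc.
   Context: **Triangles.** Let $H=\{(\alpha_1,\alpha_2,\alpha_3)\in[0,1]^3:\alpha_1+\alpha_2+\alpha_3=1\}$, $\mathbb N=\{0,1,2,\dots\}$, $\mathbf P_1=(0,0)$, $\mathbf P_2=(1,0)$, $\mathbf P_3=(1/2,\sqrt3/2)$. $\Delta(\mathbf A_1,\mathbf A_2,\mathbf A_3)$ denotes the full closed triangle with (ordered) vertices $\mathbf A_1,\mathbf A_2,\mathbf A_3$, and $T_1=\Delta(\mathbf P_1,\mathbf P_2,\mathbf P_3)$. For $\Delta=\Delta(\mathbf A_1,\mathbf A_2,\mathbf A_3)\subset T_1$ let $P_\Delta:T_1\to T_1$, $\sum\alpha_i\mathbf P_i\mapsto\sum\alpha_i\mathbf A_i$ for $(\alpha_1,\alpha_2,\alpha_3)\in H$. For $m\ge2$ and $(k_1,k_2,k_3)\in\mathbb Z^3$, $T_m(k_1,k_2,k_3)$ is the triangle with ordered vertices $\mathbf A_i=\frac1m\big(k_1\mathbf P_1+k_2\mathbf P_2+k_3\mathbf P_3+\mathbf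 P_i\big)$ and $T'_m(k_1,k_2,k_3)$ is the triangle with ordered vertices $\mathbf A_i=\frac1m\big(k_1\mathbf P_1+k_2\mathbf P_2+k_3\mathbf P_3+\mathbf P_1+\mathbf P_2+\mathbf P_3-\mathbf P_i\big)$, $i=1,2,3$. Put $\mathcal T_m=\{T_m(k_1,k_2,k_3):k_i\in\mathbb N,\ k_1+k_2+k_3=m-1\}$ and $\mathcal T'_m=\{T'_m(k_1,k_2,k_3):k_i\in\mathbb N,\ k_1+k_2+k_3=m-2\}$. $T_m(k_1,k_2,k_3)$ and $T'_m(k'_1,k'_2,k'_3)$ are $j$-neighbours if $k_j=k'_j+1$ and $k_i=k'_i$ for $i\ne j$ (they then share a side). For $i\in\{1,2,3\}$ and $K\in\{0,\dots,m-1\}$, the set of all $T_m(k_1,k_2,k_3)\in\mathcal T_m$ and $T'_m(k_1,k_2,k_3)\in\mathcal T'_m$ with $k_i=K$ is called a strip of type $i$. **Patterns systems.** An $m$-triangular patterns system is a pair $(\mathcal W\cup\mathcal W',\mathcal Y\cup\mathcal Y')$ with $\mathcal W,\mathcal Y\subset\mathcal T_m$ and $\mathcal W',\mathcal Y'\subset\mathcal T'_m$. Put $\mathcal W_1=\mathcal W$, $\mathcal W'_1=\mathcal W'$, $\mathcal Y_1=\mathcal Y$, $\mathcal Y'_1=\mathcal Y'$, and for $n\ge2$ $\mathcal W_n=\{P_{U}(V):U\in\mathcal W_{n-1},V\in\mathcal W_1\}\cup\{P_{U}(V):U\in\mathcal W'_{n-1},V\in\mathcal Y'_1\}$, $\mathcal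 W'_n=\{P_{U}(V):U\in\mathcal W_{n-1},V\in\mathcal W'_1\}\cup\{P_{U}(V):U\in\mathcal W'_{n-1},V\in\mathcal Y_1\}$, $\mathcal Y_n=\{P_{U}(V):U\in\mathcal Y_{n-1},V\in\mathcal Y_1\}\cup\{P_{U}(V):U\in\mathcal Y'_{n-1},V\in\mathcal W'_1\}$, $\mathcal Y'_n=\{P_{U}(V):U\in\mathcal Y_{n-1},V\in\mathcal Y'_1\}\cup\{P_{U}(V):U\in\mathcal Y'_{n-1},V\in\mathcal W_1\}$. $\mathcal G(\mathcal W\cup\mathcal W')$ is the undirected graph with vertex set $\mathcal W\cup\mathcal W'$ in which two vertices are joined by an edge labelled $j$ iff they are $j$-neighbours; $\mathcal G(\mathcal Y\cup\mathcal Y')$ is defined analogously. **Labyrinth patterns systems.** The system is an $m$-triangular labyrinth patterns system if: (1) (tree property) $\mathcal G(\mathcal W\cup\mathcal W')$ and $\mathcal G(\mathcal Y\cup\mathcal Y')$ are trees; (2) (exits property) there is exactly one triple $(k_1,k_2,k_3)$ of integers in $\{0,\dots,m-1\}$ with $T_m(0,k_1,m-1-k_1)\in\mathcal W$, $T_m(0,m-1-k_1,k_1)\in\mathcal Y$, $T_m(k_2,0,m-1-k_2)\in\mathcal W$, $T_m(m-1-k_2,0,k_2)\in\mathcal Y$, $T_m(k_3,m-1-k_3,0)\in\mathcal W$, $T_m(m-1-k_3,k_3,0)\in\mathcal Y$; (3) (corners property) the sets $\mathcal C(\mathcal W)$, $\mathcal C(\mathcal Y)$ of elements of $\mathcal W$,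 resp. $\mathcal Y$, that contain one of $\mathbf P_1,\mathbf P_2,\mathbf P_3$ are disjoint and each has at most one element. The exits of the patterns are $e^w_1=T_m(0,k_1,m-1-k_1)$, $e^w_2=T_m(k_2,0,m-1-k_2)$, $e^w_3=T_m(k_3,m-1-k_3,0)$ and $e^y_1=T_m(0,m-1-k_1,k_1)$, $e^y_2=T_m(m-1-k_2,0,k_2)$, $e^y_3=T_m(m-1-k_3,k_3,0)$. **Fractals.** $L^{w}_n$ (resp. $L^{y}_n$) is the union of all triangles in $\mathcal W_n\cup\mathcal W'_n$ (resp. $\mathcal Y_n\cup\mathcal Y'_n$). The white and yellow triangular labyrinth fractals are $L^{w}_\infty=\bigcap_{n\ge1}L^{w}_n$ and $L^{y}_\infty=\bigcap_{n\ge1}L^{y}_n$. They are dendrites; a non-trivial arc is an arc in the fractal connecting two distinct points of it. **Blocked.** For $\{i,j\}\in\mathcal P$ the white (yellow) path of type $\{i,j\}$ is the unique path in the tree $\mathcal G(\mathcal W\cup\mathcal W')$ (resp. $\mathcal G(\mathcal Y\cup\mathcal Y')$) from $e^w_i$ to $e^w_j$ (resp. $e^y_i$ to $e^y_j$). With $\{k\}=\{1,2,3\}\setminus\{i,j\}$, this path is blocked if it contains two triangles that are not contained in the same strip of type $k$. The system is $\pi$-blocked ($\pi\in\mathcal P$) if the white or the yellow path of type $\pi$ is blocked. **Length and tangents.** The length of an arc is its one-dimensional (Lebesgue) measure, which is also the measure meant in (c). There exists a tangent $\tau$ (a straight line) at a point $\mathbf X_0$ to an arc $a$ if for every angle $\phi>0$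 there is $\varepsilon>0$ such that for all $\mathbf X\in a$ with $\mathbf X\neq\mathbf X_0$, $|\mathbf X_0-\mathbf X|<\varepsilon$, the angle between $\tau$ and the straight line through $\mathbf X$ and $\mathbf X_0$ is not greater than $\phi$. *)

theory Defs
  imports "HOL-Analysis.Analysis"
begin

section \<open>Triangles\<close>

text \<open>
  Triangles are ordered triples of vertices; \<open>full\<close> is the closed triangle as a point set.
  The numeral type \<open>3\<close> serves as the index set \<open>{1, 2, 3}\<close> (note that \<open>3 = 0\<close> in it).
\<close>

type_synonym point = "real^2"
type_synonym triangle = "point^3"

definition PP :: triangle where
  "PP = vector [vector [0, 0], vector [1, 0], vector [1/2, sqrt 3 / 2]]"

definition full :: "triangle \<Rightarrow> point set" where
  "full A = convex hull (range (\<lambda>i. A $ i))"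

definition HH :: "(real^3) set" where
  "HH = {\<alpha>. (\<forall>i. \<alpha> $ i \<in> {0..1}) \<and> (\<Sum>i\<in>UNIV. \<alpha> $ i) = 1}"

text \<open>Only meaningful for points of \<open>full PP\<close>, where the coordinates exist and are unique.\<close>

definition bary :: "point \<Rightarrow> real^3" where
  "bary x = (THE \<alpha>. \<alpha> \<in> HH \<and> (\<Sum>i\<in>UNIV. \<alpha> $ i *\<^sub>R PP $ i) = x)"

definition tri_map :: "triangle \<Rightarrow> point \<Rightarrow> point" where
  "tri_map A x = (\<Sum>i\<in>UNIV. bary x $ i *\<^sub>R A $ i)"

definition tri_image :: "triangle \<Rightarrow> triangle \<Rightarrow> triangle" where
  "tri_image U V = (\<chi> i. tri_map U (V $ i))"

definition T :: "nat \<Rightarrow> int^3 \<Rightarrow> triangle" where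
  "T m k = (\<chi> i. (1 / real m) *\<^sub>R ((\<Sum>j\<in>UNIV. of_int (k $ j) *\<^sub>R PP $ j) + PP $ i))"

definition T' :: "nat \<Rightarrow> int^3 \<Rightarrow> triangle" where
  "T' m k = (\<chi> i. (1 / real m) *\<^sub>R
     ((\<Sum>j\<in>UNIV. of_int (k $ j) *\<^sub>R PP $ j) + (\<Sum>j\<in>UNIV. PP $ j) - PP $ i))"

text \<open>
  Since \<open>PP $ 1 = 0\<close>, the triple \<open>k\<close> is determined by \<open>T m k\<close> (or \<open>T' m k\<close>) only once the
  coordinate sum of \<open>k\<close> is fixed. Whenever a triple is read off from a triangle below,
  it is therefore taken from \<open>idx\<close>.
\<close>

definition idx :: "int \<Rightarrow> (int^3) set" where
  "idx s = {k. (\<forall>i. 0 \<le> k $ i) \<and> (\<Sum>i\<in>UNIV. k $ i) = s}"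

definition TT :: "nat \<Rightarrow> triangle set" where
  "TT m = {T m k |k. k \<in> idx (int m - 1)}"

definition TT' :: "nat \<Rightarrow> triangle set" where
  "TT' m = {T' m k |k. k \<in> idx (int m - 2)}"

definition neighbours :: "nat \<Rightarrow> 3 \<Rightarrow> triangle \<Rightarrow> triangle \<Rightarrow> bool" where
  "neighbours m j U V \<longleftrightarrow>
     (\<exists>k\<in>idx (int m - 1). \<exists>k'\<in>idx (int m - 2).
        U = T m k \<and> V = T' m k' \<and> k $ j = k' $ j + 1 \<and> (\<forall>i. i \<noteq> j \<longrightarrow> k $ i = k' $ i))"

definition strip :: "nat \<Rightarrow> 3 \<Rightarrow> int \<Rightarrow> triangle set" where
  "strip m i K = {T m k |k. k \<in> idx (int m - 1) \<and> k $ i = K} \<union>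
                 {T' m k |k. k \<in> idx (int m - 2) \<and> k $ i = K}"

definition strips :: "nat \<Rightarrow> 3 \<Rightarrow> triangle set set" where
  "strips m i = {strip m i K |K. 0 \<le> K \<and> K \<le> int m - 1}"

section \<open>Undirected graphs\<close>

text \<open>A simple graph is given by a vertex set \<open>V\<close> and a symmetric irreflexive adjacency \<open>E\<close>.\<close>

definition graph_path :: "('a \<Rightarrow> 'a \<Rightarrow> bool) \<Rightarrow> 'a set \<Rightarrow> 'a \<Rightarrow> 'a \<Rightarrow> 'a list \<Rightarrow> bool" where
  "graph_path E V u v p \<longleftrightarrow>
     p \<noteq> [] \<and> hd p = u \<and> last p = v \<and> set p \<subseteq> V \<and> distinct p \<and> successively E p"

definition graph_cycle :: "('a \<Rightarrow> 'a \<Rightarrow> bool) \<Rightarrow> 'a set \<Rightarrow> 'a list \<Rightarrow> bool" where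
  "graph_cycle E V p \<longleftrightarrow>
     length p \<ge> 3 \<and> set p \<subseteq> V \<and> distinct p \<and> successively E p \<and> E (last p) (hd p)"

definition graph_tree :: "('a \<Rightarrow> 'a \<Rightarrow> bool) \<Rightarrow> 'a set \<Rightarrow> bool" where
  "graph_tree E V \<longleftrightarrow>
     V \<noteq> {} \<and> (\<forall>u\<in>V. \<forall>v\<in>V. \<exists>p. graph_path E V u v p) \<and> (\<nexists>p. graph_cycle E V p)"

text \<open>Adjacency in the graph \<open>\<G>\<close> of a pattern, with the edge labels \<open>j\<close> forgotten.\<close>

definition adj :: "nat \<Rightarrow> triangle \<Rightarrow> triangle \<Rightarrow> bool" where
  "adj m U V \<longleftrightarrow> (\<exists>j. neighbours m j U V \<or> neighbours m j V U)"

section \<open>Patterns systems\<close>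

text \<open>The fields are \<open>\<W>\<close>, \<open>\<W>'\<close>, \<open>\<Y>\<close>, \<open>\<Y>'\<close>, in this order.\<close>

record patterns =
  white_up :: "triangle set"
  white_down :: "triangle set"
  yellow_up :: "triangle set"
  yellow_down :: "triangle set"

definition patterns_system :: "nat \<Rightarrow> patterns \<Rightarrow> bool" where
  "patterns_system m S \<longleftrightarrow> m \<ge> 2 \<and>
     white_up S \<subseteq> TT m \<and> white_down S \<subseteq> TT' m \<and> yellow_up S \<subseteq> TT m \<and> yellow_down S \<subseteq> TT' m"

definition images :: "triangle set \<Rightarrow> triangle set \<Rightarrow> triangle set" where
  "images \<U> \<V> = {tri_image U V |U V. U \<in> \<U> \<and> V \<in> \<V>}"

text \<open>The sets \<open>\<W>\<^sub>n\<close>, \<open>\<W>'\<^sub>n\<close>, \<open>\<Y>\<^sub>n\<close>, \<open>\<Y>'\<^sub>n\<close> for \<open>n \<ge> 1\<close>; the value at \<open>0\<close> is never used.\<close>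

fun WW :: "patterns \<Rightarrow> nat \<Rightarrow> triangle set"
  and WW' :: "patterns \<Rightarrow> nat \<Rightarrow> triangle set"
  and YY :: "patterns \<Rightarrow> nat \<Rightarrow> triangle set"
  and YY' :: "patterns \<Rightarrow> nat \<Rightarrow> triangle set" where
  "WW S 0 = {}"
| "WW S (Suc 0) = white_up S"
| "WW S (Suc (Suc n)) =
     images (WW S (Suc n)) (white_up S) \<union> images (WW' S (Suc n)) (yellow_down S)"
| "WW' S 0 = {}"
| "WW' S (Suc 0) = white_down S"
| "WW' S (Suc (Suc n)) =
     images (WW S (Suc n)) (white_down S) \<union> images (WW' S (Suc n)) (yellow_up S)"
| "YY S 0 = {}"
| "YY S (Suc 0) = yellow_up S"
| "YY S (Suc (Suc n)) =
     images (YY S (Suc n)) (yellow_up S) \<union> images (YY' S (Suc n)) (white_down S)"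
| "YY' S 0 = {}"
| "YY' S (Suc 0) = yellow_down S"
| "YY' S (Suc (Suc n)) =
     images (YY S (Suc n)) (yellow_down S) \<union> images (YY' S (Suc n)) (white_up S)"

definition white_fractal :: "patterns \<Rightarrow> point set" where
  "white_fractal S = (\<Inter>n\<in>{1..}. \<Union>U\<in>WW S n \<union> WW' S n. full U)"

definition yellow_fractal :: "patterns \<Rightarrow> point set" where
  "yellow_fractal S = (\<Inter>n\<in>{1..}. \<Union>U\<in>YY S n \<union> YY' S n. full U)"

section \<open>Labyrinth patterns systems\<close>

definition white_exit_at :: "nat \<Rightarrow> int^3 \<Rightarrow> 3 \<Rightarrow> triangle" where
  "white_exit_at m k i = T m
     (if i = 1 then vector [0, k $ 1, int m - 1 - k $ 1]
      else if i = 2 then vector [k $ 2, 0, int m - 1 - k $ 2]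
      else vector [k $ 3, int m - 1 - k $ 3, 0])"

definition yellow_exit_at :: "nat \<Rightarrow> int^3 \<Rightarrow> 3 \<Rightarrow> triangle" where
  "yellow_exit_at m k i = T m
     (if i = 1 then vector [0, int m - 1 - k $ 1, k $ 1]
      else if i = 2 then vector [int m - 1 - k $ 2, 0, k $ 2]
      else vector [int m - 1 - k $ 3, k $ 3, 0])"

definition exit_triple :: "nat \<Rightarrow> patterns \<Rightarrow> int^3 \<Rightarrow> bool" where
  "exit_triple m S k \<longleftrightarrow> (\<forall>i. 0 \<le> k $ i \<and> k $ i \<le> int m - 1) \<and>
     (\<forall>i. white_exit_at m k i \<in> white_up S \<and> yellow_exit_at m k i \<in> yellow_up S)"

definition corners :: "triangle set \<Rightarrow> triangle set" where
  "corners \<U> = {U \<in> \<U>. \<exists>i. PP $ i \<in> full U}"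

definition tree_property :: "nat \<Rightarrow> patterns \<Rightarrow> bool" where
  "tree_property m S \<longleftrightarrow>
     graph_tree (adj m) (white_up S \<union> white_down S) \<and>
     graph_tree (adj m) (yellow_up S \<union> yellow_down S)"

definition exits_property :: "nat \<Rightarrow> patterns \<Rightarrow> bool" where
  "exits_property m S \<longleftrightarrow> (\<exists>!k. exit_triple m S k)"

definition corners_property :: "patterns \<Rightarrow> bool" where
  "corners_property S \<longleftrightarrow>
     corners (white_up S) \<inter> corners (yellow_up S) = {} \<and>
     (\<forall>U\<in>corners (white_up S). \<forall>V\<in>corners (white_up S). U = V) \<and>
     (\<forall>U\<in>corners (yellow_up S). \<forall>V\<in>corners (yellow_up S). U = V)"

definition labyrinth_patterns_system :: "nat \<Rightarrow> patterns \<Rightarrow> bool" where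
  "labyrinth_patterns_system m S \<longleftrightarrow>
     patterns_system m S \<and> tree_property m S \<and> exits_property m S \<and> corners_property S"

definition white_exit :: "nat \<Rightarrow> patterns \<Rightarrow> 3 \<Rightarrow> triangle" where
  "white_exit m S i = white_exit_at m (THE k. exit_triple m S k) i"

definition yellow_exit :: "nat \<Rightarrow> patterns \<Rightarrow> 3 \<Rightarrow> triangle" where
  "yellow_exit m S i = yellow_exit_at m (THE k. exit_triple m S k) i"

section \<open>Blocked systems\<close>

definition white_path :: "nat \<Rightarrow> patterns \<Rightarrow> 3 \<Rightarrow> 3 \<Rightarrow> triangle list" where
  "white_path m S i j = (THE p. graph_path (adj m) (white_up S \<union> white_down S)
                                  (white_exit m S i) (white_exit m S j) p)"

definition yellow_path :: "nat \<Rightarrow> patterns \<Rightarrow> 3 \<Rightarrow> 3 \<Rightarrow> triangle list" where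
  "yellow_path m S i j = (THE p. graph_path (adj m) (yellow_up S \<union> yellow_down S)
                                   (yellow_exit m S i) (yellow_exit m S j) p)"

definition blocked_path :: "nat \<Rightarrow> 3 \<Rightarrow> triangle list \<Rightarrow> bool" where
  "blocked_path m k p \<longleftrightarrow>
     (\<exists>U\<in>set p. \<exists>V\<in>set p. \<not> (\<exists>Z\<in>strips m k. U \<in> Z \<and> V \<in> Z))"

definition PI :: "3 set set" where
  "PI = {{1, 2}, {1, 3}, {2, 3}}"

text \<open>The choice of the order of \<open>i\<close> and \<open>j\<close> only reverses the path.\<close>

definition pi_blocked :: "nat \<Rightarrow> patterns \<Rightarrow> 3 set \<Rightarrow> bool" where
  "pi_blocked m S \<pi> \<longleftrightarrow>
     (\<exists>i j k. \<pi> = {i, j} \<and> {k} = {1, 2, 3} - {i, j} \<and>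
        (blocked_path m k (white_path m S i j) \<or> blocked_path m k (yellow_path m S i j)))"

section \<open>Hausdorff measure and dimension\<close>

text \<open>
  In the summands \<open>0\<^sup>0\<close> is read as 1 for nonempty sets, so that the measure of
  dimension 0 is the counting measure (whereas \<open>0 powr 0 = 0\<close>). Boundedness is required because
  \<open>diameter\<close> is unspecified for unbounded sets.
\<close>

definition hausdorff_term :: "real \<Rightarrow> 'a::metric_space set \<Rightarrow> ennreal" where
  "hausdorff_term s U =
     (if U = {} then 0 else if s = 0 then 1 else ennreal (diameter U powr s))"

definition hausdorff_premeasure :: "real \<Rightarrow> real \<Rightarrow> 'a::metric_space set \<Rightarrow> ennreal" where
  "hausdorff_premeasure s \<delta> A =
     (INF U \<in> {U :: nat \<Rightarrow> 'a set. A \<subseteq> (\<Union>n. U n) \<and> (\<forall>n. bounded (U n) \<and> diameter (U n) \<le> \<delta>)}.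
        (\<Sum>n. hausdorff_term s (U n)))"

definition hausdorff_measure :: "real \<Rightarrow> 'a::metric_space set \<Rightarrow> ennreal" where
  "hausdorff_measure s A = (SUP \<delta>\<in>{0<..}. hausdorff_premeasure s \<delta> A)"

definition hausdorff_dim :: "'a::metric_space set \<Rightarrow> ennreal" where
  "hausdorff_dim A = Inf {ennreal s |s. 0 \<le> s \<and> hausdorff_measure s A = 0}"

section \<open>Arcs, length and tangents\<close>

text \<open>The end points of an \<open>arc\<close> are distinct by injectivity, so every \<open>arc\<close> is non-trivial.\<close>

definition nontrivial_arcs :: "'a::topological_space set \<Rightarrow> 'a set set" where
  "nontrivial_arcs L = {path_image g |g. arc g \<and> path_image g \<subseteq> L}"

text \<open>One-dimensional Hausdorff measure is the one-dimensional Lebesgue measure along an arc.\<close>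

definition arc_length :: "'a::metric_space set \<Rightarrow> ennreal" where
  "arc_length a = hausdorff_measure 1 a"

definition straight_line :: "'a::real_vector \<Rightarrow> 'a \<Rightarrow> 'a set" where
  "straight_line x v = range (\<lambda>t. x + t *\<^sub>R v)"

text \<open>The angle, in \<open>[0, \<pi>/2]\<close>, between straight lines with directions \<open>u, v \<noteq> 0\<close>.\<close>

definition line_angle :: "'a::real_inner \<Rightarrow> 'a \<Rightarrow> real" where
  "line_angle u v = arccos (\<bar>u \<bullet> v\<bar> / (norm u * norm v))"

definition is_tangent :: "'a::real_inner set \<Rightarrow> 'a \<Rightarrow> 'a set \<Rightarrow> bool" where
  "is_tangent a x\<^sub>0 \<tau> \<longleftrightarrow> (\<exists>v. v \<noteq> 0 \<and> \<tau> = straight_line x\<^sub>0 v \<and>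
     (\<forall>\<phi>>0. \<exists>\<epsilon>>0. \<forall>x\<in>a. x \<noteq> x\<^sub>0 \<and> dist x\<^sub>0 x < \<epsilon> \<longrightarrow> line_angle v (x - x\<^sub>0) \<le> \<phi>))"

end

(*
  Let {a,b} be the blocked type and c the third index. Since {a,c} and {b,c} are not blocked, the
  paths from the exits at a and at b to the exit at c each stay in one strip, so in the limit they
  become straight segments that meet in the exit point at c. If a point p of a triangle U of the
  n-th level lies on neither of the two corresponding lines in U, then a branch of the fractal
  containing p hangs on the rest, including all exit points of U, in a single point; hence an arc
  with end points outside U avoids p. So an arc meets every triangle without its end points in
  a subset of two segments. Only boundedly many triangles per level are needed to exhaust the arc up
  to its end points, which bounds the length by a geometric series; and off the countably many exit
  points of the triangles the arc is locally contained in one straight line.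
  The branches are found by induction on the level, from the tree property and from the fact that
  distinct triangles of one level have no points of the fractal in common but exit points.
*)
theory Submission
  imports Defs
begin

section \<open>Acyclic graphs\<close>

text \<open>Inside a triangle that lies on only one of the two paths only one of the two lines
  continues, so the induction must also treat points that avoid just one line. Their branch may
  swallow the exit point on one side; this is harmless, since no triangle of the paths is attached
  across that side. The parameter \<tau> of \<open>cut\<close> records the exit points that stay
  with the rest. The corners property forbids contacts at vertices. Hence triangles touch only
  across a common side, where the white and the yellow pattern face each other, and the uniqueness
  of the exits pins the contact down, level by level, to the exit point. In barycentric coordinates
  all this is integer arithmetic: a child acts as \<alpha> \<mapsto> (k + \<alpha>)/m or \<alpha>
  \<mapsto> (k + 1 - \<alpha>)/m. Entering a child in the strip multiplies the distance to the line
  by m, so the inductions run over n with 1/m^n below this distance. Exit points must lie strictly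
  inside the sides. This follows from the two unblocked types together with the corners
  property.\<close>

definition restricted :: "('a \<Rightarrow> 'a \<Rightarrow> bool) \<Rightarrow> 'a set \<Rightarrow> 'a \<Rightarrow> 'a \<Rightarrow> bool" where
  "restricted E X x y \<longleftrightarrow> E x y \<and> x \<in> X \<and> y \<in> X"

lemma graph_path_extend:
  assumes "graph_path E X u v p" "E v w" "w \<in> X"
  shows "\<exists>q. graph_path E X u w q"
proof (cases "w \<in> set p")
  case True
  then obtain xs ys where "p = xs @ w # ys" by (auto dest: split_list)
  then have p: "p = (xs @ [w]) @ ys" by simp
  have "successively E (xs @ [w])"
    using assms(1) unfolding graph_path_def p by (simp only: successively_append_iff)
  then have "graph_path E X u w (xs @ [w])"
    using assms(1) unfolding graph_path_def p by (cases xs) auto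
  then show ?thesis by blast
next
  case False
  have "graph_path E X u w (p @ [w])"
    using assms False unfolding graph_path_def by (auto simp: successively_append_iff)
  then show ?thesis by blast
qed

lemma rtranclp_imp_graph_path:
  assumes "(restricted E X)\<^sup>*\<^sup>* u v" "u \<in> X"
  shows "\<exists>p. graph_path E X u v p"
  using assms(1)
proof (induction rule: rtranclp_induct)
  case base
  have "graph_path E X u u [u]" using assms(2) by (simp add: graph_path_def)
  then show ?case by blast
next
  case (step y z)
  then show ?case using graph_path_extend unfolding restricted_def by metis
qed

lemma successively_imp_rtranclp:
  assumes "successively E p" "set p \<subseteq> X" "p \<noteq> []"
  shows "(restricted E X)\<^sup>*\<^sup>* (hd p) (last p)"
  using assms
proof (induction p rule: induct_list012)
  case (3 x y zs)
  then have "restricted E X x y" by (auto simp: restricted_def)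
  moreover have "(restricted E X)\<^sup>*\<^sup>* y (last (y # zs))" using 3 by auto
  ultimately show ?case by (simp add: converse_rtranclp_into_rtranclp)
qed auto

lemma graph_path_imp_rtranclp:
  "graph_path E X u v p \<Longrightarrow> (restricted E X)\<^sup>*\<^sup>* u v"
  using successively_imp_rtranclp unfolding graph_path_def by metis

lemma restricted_rtranclp_sym:
  assumes "symp E" "(restricted E X)\<^sup>*\<^sup>* u v"
  shows "(restricted E X)\<^sup>*\<^sup>* v u"
proof -
  have "symp (restricted E X)" using assms(1) by (auto simp: restricted_def symp_def)
  then show ?thesis using assms(2) by (blast dest: sympD[OF symp_rtranclp])
qed

lemma restricted_rtranclp_mono:
  assumes "(restricted E X)\<^sup>*\<^sup>* u v" "X \<subseteq> Y"
  shows "(restricted E Y)\<^sup>*\<^sup>* u v"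
  using assms(1) by (rule rtranclp_mono[THEN predicate2D, rotated]) (use assms(2) in \<open>auto simp: restricted_def\<close>)

text \<open>If the second vertices of the two paths differ, the remainders of both paths connect
  them inside \<open>V - {u}\<close>, and u closes a cycle. If they agree, the induction hypothesis
  applies to the remainders.\<close>

lemma graph_path_unique:
  assumes "symp E" and acyclic: "\<nexists>p. graph_cycle E V p"
    and "graph_path E V u v p" "graph_path E V u v q"
  shows "p = q"
  using assms(3,4)
proof (induction p arbitrary: u q)
  case Nil
  then show ?case by (simp add: graph_path_def)
next
  case (Cons x p)
  then obtain q' where q: "q = u # q'" and x: "x = u"
    unfolding graph_path_def by (cases q) auto
  show ?case
  proof (cases "p = []")
    case True
    then have "v = u" using Cons.prems x by (simp add: graph_path_def)
    then have "q' = []" using Cons.prems(2) q unfolding graph_path_def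
      by (metis distinct.simps(2) last.simps last_in_set list.sel(1))
    then show ?thesis using True q x by simp
  next
    case p: False
    then have "v \<noteq> u" using Cons.prems(1) x unfolding graph_path_def
      by (metis distinct.simps(2) last.simps last_in_set)
    then have q': "q' \<noteq> []" using Cons.prems(2) q unfolding graph_path_def by auto
    have gp: "graph_path E (V - {u}) (hd p) v p" "graph_path E (V - {u}) (hd q') v q'"
      using Cons.prems p q' q x unfolding graph_path_def by (auto simp: successively_Cons)
    have adj: "E u (hd p)" "E u (hd q')" "u \<in> V"
      using Cons.prems p q' q x unfolding graph_path_def by (auto simp: successively_Cons)
    have "hd p = hd q'"
    proof (rule ccontr)
      assume ne: "hd p \<noteq> hd q'"
      have "(restricted E (V - {u}))\<^sup>*\<^sup>* (hd p) (hd q')"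
        by (rule rtranclp_trans[OF graph_path_imp_rtranclp[OF gp(1)]
            restricted_rtranclp_sym[OF assms(1) graph_path_imp_rtranclp[OF gp(2)]]])
      moreover have "hd p \<in> V - {u}" using gp(1) p hd_in_set unfolding graph_path_def by fast
      ultimately obtain r where r: "graph_path E (V - {u}) (hd p) (hd q') r"
        using rtranclp_imp_graph_path by metis
      have len: "length r \<ge> 2"
        using r ne unfolding graph_path_def by (cases r; cases "tl r") (auto simp: Suc_le_eq)
      have "graph_cycle E V (u # r)"
        using r adj len assms(1) unfolding graph_cycle_def graph_path_def
        by (auto simp: successively_Cons symp_def)
      then show False using acyclic by blast
    qed
    moreover have "graph_path E V (hd p) v p" "graph_path E V (hd q') v q'"
      using gp unfolding graph_path_def by auto
    ultimately have "p = q'" using Cons.IH by metis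
    then show ?thesis using q x by simp
  qed
qed

text \<open>Two different edges between C and H close a cycle: through C from one edge to the other,
  across, and back through H. Consequently a component of the nodes outside a connected set hangs on
  that set by a single edge.\<close>

lemma acyclic_edge_between_unique:
  assumes "symp E" and acyclic: "\<nexists>p. graph_cycle E V p"
    and "C \<subseteq> V" "H \<subseteq> V" "C \<inter> H = {}"
    and mem: "c\<^sub>1 \<in> C" "s\<^sub>2 \<in> H"
    and conn: "(restricted E C)\<^sup>*\<^sup>* c\<^sub>1 c\<^sub>2" "(restricted E H)\<^sup>*\<^sup>* s\<^sub>2 s\<^sub>1"
    and edges: "E c\<^sub>1 s\<^sub>1" "E c\<^sub>2 s\<^sub>2"
  shows "c\<^sub>1 = c\<^sub>2 \<and> s\<^sub>1 = s\<^sub>2"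
proof (rule ccontr)
  assume ne: "\<not> (c\<^sub>1 = c\<^sub>2 \<and> s\<^sub>1 = s\<^sub>2)"
  obtain p where p: "graph_path E C c\<^sub>1 c\<^sub>2 p"
    using rtranclp_imp_graph_path[OF conn(1) mem(1)] by blast
  obtain q where q: "graph_path E H s\<^sub>2 s\<^sub>1 q"
    using rtranclp_imp_graph_path[OF conn(2) mem(2)] by blast
  have p': "p \<noteq> []" "hd p = c\<^sub>1" "last p = c\<^sub>2" "set p \<subseteq> C" "distinct p" "successively E p"
    using p unfolding graph_path_def by auto
  have q': "q \<noteq> []" "hd q = s\<^sub>2" "last q = s\<^sub>1" "set q \<subseteq> H" "distinct q" "successively E q"
    using q unfolding graph_path_def by auto
  \<comment> \<open>Different edges differ in an end point on at least one side, so one of the two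
    paths has at least two vertices and the closed walk at least three.\<close>
  have "length p \<noteq> 1 \<or> length q \<noteq> 1"
    using p'(2,3) q'(2,3) ne by (auto simp: length_Suc_conv)
  moreover have "length p \<noteq> 0" "length q \<noteq> 0" using p'(1) q'(1) by auto
  ultimately have "length (p @ q) \<ge> 3" unfolding length_append by linarith
  moreover have "E s\<^sub>1 c\<^sub>1" using edges(1) assms(1) by (auto dest: sympD)
  moreover have "distinct (p @ q)" "set (p @ q) \<subseteq> V" using p' q' assms(3-5) by auto
  moreover have "successively E (p @ q)"
    using p' q' edges(2) by (simp add: successively_append_iff)
  ultimately have "graph_cycle E V (p @ q)"
    using p'(1-3) q'(1-3) unfolding graph_cycle_def by simp
  then show False using acyclic by blast
qed

section \<open>Hausdorff measure\<close>

lemma hausdorff_premeasure_le: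
  assumes "A \<subseteq> (\<Union>n. U n)" "\<And>n::nat. bounded (U n) \<and> diameter (U n) \<le> \<delta>"
  shows "hausdorff_premeasure s \<delta> A \<le> (\<Sum>n. hausdorff_term s (U n))"
  unfolding hausdorff_premeasure_def by (rule INF_lower) (use assms in auto)

lemma hausdorff_premeasure_mono:
  assumes "A \<subseteq> B"
  shows "hausdorff_premeasure s \<delta> A \<le> hausdorff_premeasure s \<delta> B"
  unfolding hausdorff_premeasure_def by (rule INF_superset_mono) (use assms in auto)

lemma hausdorff_premeasure_le_measure:
  "\<delta> > 0 \<Longrightarrow> hausdorff_premeasure s \<delta> A \<le> hausdorff_measure s A"
  unfolding hausdorff_measure_def by (rule SUP_upper) auto

text \<open>The finite family is padded with empty sets, whose \<open>hausdorff_term\<close> is 0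
  even for s = 0.\<close>

lemma hausdorff_premeasure_finite_cover:
  assumes "finite I" "A \<subseteq> (\<Union>i\<in>I. U i)" "\<And>i. i \<in> I \<Longrightarrow> bounded (U i) \<and> diameter (U i) \<le> \<delta>"
    and "\<delta> \<ge> 0"
  shows "hausdorff_premeasure s \<delta> A \<le> (\<Sum>i\<in>I. hausdorff_term s (U i))"
proof -
  obtain h where h: "bij_betw h {..<card I} I"
    using ex_bij_betw_nat_finite[OF assms(1)] by (auto simp: atLeast0LessThan)
  define V where "V n = (if n < card I then U (h n) else {})" for n
  have hI: "h n \<in> I" if "n < card I" for n using h that by (auto simp: bij_betw_def)
  have "A \<subseteq> (\<Union>n. V n)"
  proof
    fix x assume "x \<in> A"
    then obtain i where "i \<in> I" "x \<in> U i" using assms(2) by blast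
    then obtain n where "n < card I" "h n = i" using h unfolding bij_betw_def by (metis imageE lessThan_iff)
    then show "x \<in> (\<Union>n. V n)" using \<open>x \<in> U i\<close> by (auto simp: V_def)
  qed
  then have "hausdorff_premeasure s \<delta> A \<le> (\<Sum>n. hausdorff_term s (V n))"
    by (rule hausdorff_premeasure_le) (use assms(3,4) hI in \<open>auto simp: V_def\<close>)
  also have "\<dots> = (\<Sum>n<card I. hausdorff_term s (V n))"
    by (rule suminf_finite) (auto simp: V_def hausdorff_term_def)
  also have "\<dots> = (\<Sum>n<card I. hausdorff_term s (U (h n)))"
    by (rule sum.cong) (auto simp: V_def)
  also have "\<dots> = (\<Sum>i\<in>I. hausdorff_term s (U i))"
    by (rule sum.reindex_bij_betw[OF h])
  finally show ?thesis .
qed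

lemma hausdorff_premeasure_empty [simp]: "\<delta> \<ge> 0 \<Longrightarrow> hausdorff_premeasure s \<delta> {} = 0"
  using hausdorff_premeasure_finite_cover[of "{}" "{}" undefined \<delta> s] by auto

lemma hausdorff_premeasure_Un:
  "hausdorff_premeasure s \<delta> (A \<union> B) \<le> hausdorff_premeasure s \<delta> A + hausdorff_premeasure s \<delta> B"
proof (cases "hausdorff_premeasure s \<delta> A = \<infinity> \<or> hausdorff_premeasure s \<delta> B = \<infinity>")
  case True
  then show ?thesis by auto
next
  case False
  show ?thesis
  proof (rule ennreal_le_epsilon)
    fix e :: real assume e: "0 < e"
    have ex: "\<exists>U. A \<subseteq> (\<Union>n. U n) \<and> (\<forall>n. bounded (U n) \<and> diameter (U n) \<le> \<delta>) \<and>
      (\<Sum>n. hausdorff_term s (U n)) < hausdorff_premeasure s \<delta> A + ennreal (e / 2)"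
      if fin: "hausdorff_premeasure s \<delta> A \<noteq> \<infinity>" for A :: "'a set"
    proof -
      have "hausdorff_premeasure s \<delta> A < hausdorff_premeasure s \<delta> A + ennreal (e / 2)"
        using fin e by (simp add: ennreal_zero_less_divide less_top)
      then show ?thesis unfolding hausdorff_premeasure_def INF_less_iff by auto
    qed
    obtain U where U: "A \<subseteq> (\<Union>n. U n)" "\<And>n. bounded (U n) \<and> diameter (U n) \<le> \<delta>"
      "(\<Sum>n. hausdorff_term s (U n)) < hausdorff_premeasure s \<delta> A + ennreal (e / 2)"
      using ex[of A] False by auto
    obtain V where V: "B \<subseteq> (\<Union>n. V n)" "\<And>n. bounded (V n) \<and> diameter (V n) \<le> \<delta>"
      "(\<Sum>n. hausdorff_term s (V n)) < hausdorff_premeasure s \<delta> B + ennreal (e / 2)"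
      using ex[of B] False by auto
    define Z where "Z n = (if even n then U (n div 2) else V (n div 2))" for n
    have Z: "Z (2 * n) = U n" "Z (Suc (2 * n)) = V n" for n by (auto simp: Z_def)
    have "A \<union> B \<subseteq> (\<Union>n. Z n)" 
    proof
      fix x assume "x \<in> A \<union> B"
      then obtain n where "x \<in> U n \<or> x \<in> V n" using U(1) V(1) by blast
      then show "x \<in> (\<Union>n. Z n)" using Z by (metis UN_I UNIV_I)
    qed
    then have "hausdorff_premeasure s \<delta> (A \<union> B) \<le> (\<Sum>n. hausdorff_term s (Z n))"
      by (rule hausdorff_premeasure_le) (use U(2) V(2) in \<open>auto simp: Z_def\<close>)
    also have "\<dots> = (\<Sum>n. \<Sum>i\<in>{n * 2..<n * 2 + 2}. hausdorff_term s (Z i))"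
      using sums_group[OF summable_sums, of "\<lambda>n. hausdorff_term s (Z n)" 2]
      by (simp add: sums_iff)
    also have "\<dots> = (\<Sum>n. hausdorff_term s (U n) + hausdorff_term s (V n))"
      using Z by (simp add: numeral_2_eq_2 mult.commute[of _ "Suc (Suc 0)"])
    also have "\<dots> = (\<Sum>n. hausdorff_term s (U n)) + (\<Sum>n. hausdorff_term s (V n))"
      by (rule suminf_add[symmetric]) (rule summableI)+
    also have "\<dots> \<le> (hausdorff_premeasure s \<delta> A + ennreal (e / 2)) + (hausdorff_premeasure s \<delta> B + ennreal (e / 2))"
      using U(3) V(3) by (intro add_mono) auto
    also have "\<dots> = hausdorff_premeasure s \<delta> A + hausdorff_premeasure s \<delta> B + ennreal e"
      using e ennreal_plus[of "e / 2" "e / 2"]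
      by (metis (no_types, lifting) add.assoc add.left_commute field_sum_of_halves half_gt_zero_iff less_eq_real_def)
    finally show "hausdorff_premeasure s \<delta> (A \<union> B) \<le> hausdorff_premeasure s \<delta> A + hausdorff_premeasure s \<delta> B + ennreal e" .
  qed
qed

lemma hausdorff_premeasure_UN:
  assumes "finite I" "\<delta> \<ge> 0"
  shows "hausdorff_premeasure s \<delta> (\<Union>i\<in>I. A i) \<le> (\<Sum>i\<in>I. hausdorff_premeasure s \<delta> (A i))"
  using assms(1)
proof (induction rule: finite_induct)
  case (insert x F)
  then show ?case using hausdorff_premeasure_Un[of s \<delta> "A x" "\<Union>i\<in>F. A i"]
    by (auto intro: order_trans add_left_mono)
qed (use assms in auto)

lemma hausdorff_premeasure_le_diameter:
  assumes "bounded A" "diameter A \<le> \<delta>" "\<delta> \<ge> 0"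
  shows "hausdorff_premeasure 1 \<delta> A \<le> ennreal (diameter A)"
proof -
  have "hausdorff_premeasure 1 \<delta> A \<le> hausdorff_term 1 A"
    using hausdorff_premeasure_finite_cover[of "{()}" A "\<lambda>_. A" \<delta> 1] assms by simp
  also have "\<dots> \<le> ennreal (diameter A)"
    using diameter_ge_0[OF assms(1)] by (simp add: hausdorff_term_def)
  finally show ?thesis .
qed

lemma hausdorff_premeasure_segment:
  fixes z u :: "'a::real_normed_vector"
  assumes "\<delta> > 0"
  shows "hausdorff_premeasure 1 \<delta> ((\<lambda>t. z + t *\<^sub>R u) ` {-1..1}) \<le> ennreal (4 * norm u)"
proof -
  obtain N :: nat where N: "N > 0" "2 * norm u / N \<le> \<delta>"
  proof -
    obtain N :: nat where "2 * norm u / \<delta> < N" using reals_Archimedean2 by blast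
    then have "2 * norm u / (Suc N) \<le> \<delta>" using assms by (simp add: field_simps)
    then show ?thesis using that[of "Suc N"] by blast
  qed
  define I where "I i = {-1 + 2 * real i / N .. -1 + 2 * (real i + 1) / N}" for i
  define U where "U i = (\<lambda>t. z + t *\<^sub>R u) ` I i" for i
  have dist: "dist (z + s *\<^sub>R u) (z + t *\<^sub>R u) = \<bar>s - t\<bar> * norm u" for s t
    by (simp add: dist_norm flip: scaleR_diff_left)
  have dU: "diameter (U i) \<le> 2 * norm u / N" "bounded (U i)" for i
  proof -
    have le: "dist x y \<le> 2 * norm u / N" if "x \<in> U i" "y \<in> U i" for x y
    proof -
      obtain s t where st: "s \<in> I i" "t \<in> I i" "x = z + s *\<^sub>R u" "y = z + t *\<^sub>R u"
        using \<open>x \<in> U i\<close> \<open>y \<in> U i\<close> unfolding U_def by blast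
      then have "\<bar>s - t\<bar> \<le> 2 / N" using N(1) by (auto simp: I_def field_simps abs_le_iff)
      then have "\<bar>s - t\<bar> * norm u \<le> 2 / N * norm u" by (rule mult_right_mono) simp
      then show ?thesis using st(3,4) dist by simp
    qed
    show "diameter (U i) \<le> 2 * norm u / N"
      by (rule diameter_le) (use le N in \<open>auto simp: dist_norm\<close>)
    show "bounded (U i)" using le unfolding bounded_two_points by blast
  qed
  have "(\<lambda>t. z + t *\<^sub>R u) ` {-1..1} \<subseteq> (\<Union>i\<in>{..N}. U i)"
  proof
    fix x assume "x \<in> (\<lambda>t. z + t *\<^sub>R u) ` {-1..1}"
    then obtain t where t: "-1 \<le> t" "t \<le> 1" "x = z + t *\<^sub>R u" by auto
    define i where "i = nat \<lfloor>(t + 1) * N / 2\<rfloor>"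
    have nn: "(t + 1) * N / 2 \<ge> 0" using t by simp
    have i: "real i \<le> (t + 1) * N / 2" "(t + 1) * N / 2 < real i + 1"
      unfolding i_def using nn by linarith+
    have "(t + 1) * N / 2 \<le> N" using t N by (simp add: field_simps)
    then have "i \<le> N" using i(1) by linarith
    moreover have "t \<in> I i" using i N(1) by (auto simp: I_def field_simps)
    ultimately show "x \<in> (\<Union>i\<in>{..N}. U i)" using t(3) by (auto simp: U_def)
  qed
  then have "hausdorff_premeasure 1 \<delta> ((\<lambda>t. z + t *\<^sub>R u) ` {-1..1}) \<le> (\<Sum>i\<in>{..N}. hausdorff_term 1 (U i))"
    by (rule hausdorff_premeasure_finite_cover[rotated]) (use dU N assms in \<open>auto intro: order_trans\<close>)
  also have "\<dots> \<le> (\<Sum>i\<in>{..N}. ennreal (2 * norm u / N))"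
    by (rule sum_mono) (use dU diameter_ge_0[OF dU(2)] in \<open>auto simp: hausdorff_term_def intro!: ennreal_leI\<close>)
  also have "\<dots> = ennreal ((real N + 1) * (2 * norm u / N))"
    by (subst sum_ennreal) auto
  also have "\<dots> \<le> ennreal (4 * norm u)"
  proof (rule ennreal_leI)
    have "(real N + 1) * (2 * norm u) \<le> (2 * real N) * (2 * norm u)"
      by (rule mult_right_mono) (use N in auto)
    then show "(real N + 1) * (2 * norm u / N) \<le> 4 * norm u"
      using N(1) by (simp add: field_simps)
  qed
  finally show ?thesis .
qed

lemma hausdorff_measure_countable:
  assumes "countable A" "s > 0"
  shows "hausdorff_measure s A = 0"
proof (cases "A = {}")
  case True
  then show ?thesis by (simp add: hausdorff_measure_def)
next
  case False
  have A: "A \<subseteq> (\<Union>n. {from_nat_into A n})"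
    using range_from_nat_into[OF False assms(1)] by auto
  have "hausdorff_premeasure s \<delta> A \<le> 0" if "\<delta> > 0" for \<delta>
  proof -
    have "hausdorff_premeasure s \<delta> A \<le> (\<Sum>n. hausdorff_term s {from_nat_into A n})"
      by (rule hausdorff_premeasure_le[OF A]) (use that in auto)
    also have "\<dots> = 0" using assms by (simp add: hausdorff_term_def)
    finally show ?thesis .
  qed
  then show ?thesis unfolding hausdorff_measure_def by (auto intro!: SUP_eqI)
qed

section \<open>Hausdorff dimension of connected sets of finite length\<close>

lemma hausdorff_premeasure_antimono:
  assumes "\<delta>' \<le> \<delta>"
  shows "hausdorff_premeasure s \<delta> A \<le> hausdorff_premeasure s \<delta>' A"
  unfolding hausdorff_premeasure_def
  by (rule INF_superset_mono) (use assms in \<open>auto intro: order_trans\<close>)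

text \<open>A set of diameter d \<le> \<delta> satisfies
  \<open>d powr s \<le> \<delta> powr (s - t) * d powr t\<close>, so the finite measure of dimension
  t is multiplied by a factor that tends to 0. A fixed scale \<delta> is handled by passing to
  smaller scales \<eta>, which can only enlarge the premeasure.\<close>

lemma hausdorff_measure_eq_0_above:
  assumes fin: "hausdorff_measure t A < \<infinity>" and st: "0 < t" "t < s"
  shows "hausdorff_measure s A = 0"
proof -
  obtain K where K: "0 \<le> K" "hausdorff_measure t A < ennreal K"
  proof -
    obtain K where K: "0 \<le> K" "hausdorff_measure t A = ennreal K"
      using fin by (cases "hausdorff_measure t A") auto
    then show ?thesis using that[of "K + 1"] by (simp add: ennreal_lessI)
  qed
  have small: "hausdorff_premeasure s \<delta> A \<le> ennreal (\<delta> powr (s - t) * K)" if "\<delta> > 0" for \<delta>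
  proof -
    have "hausdorff_premeasure t \<delta> A < ennreal K"
      using hausdorff_premeasure_le_measure[OF that] K(2) by (rule le_less_trans)
    then obtain U where U: "A \<subseteq> (\<Union>n. U n)" "\<And>n::nat. bounded (U n) \<and> diameter (U n) \<le> \<delta>"
      "(\<Sum>n. hausdorff_term t (U n)) < ennreal K"
      unfolding hausdorff_premeasure_def INF_less_iff by auto
    have "hausdorff_term s (U n) \<le> ennreal (\<delta> powr (s - t)) * hausdorff_term t (U n)" for n
    proof -
      have d: "0 \<le> diameter (U n)" "diameter (U n) \<le> \<delta>" using U(2) diameter_ge_0 by auto
      have "diameter (U n) powr s = diameter (U n) powr (s - t) * diameter (U n) powr t"
        by (simp flip: powr_add)
      also have "\<dots> \<le> \<delta> powr (s - t) * diameter (U n) powr t"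
        by (intro mult_right_mono powr_mono2) (use d st in auto)
      finally show ?thesis using st by (simp add: hausdorff_term_def ennreal_leI flip: ennreal_mult)
    qed
    then have "(\<Sum>n. hausdorff_term s (U n)) \<le> (\<Sum>n. ennreal (\<delta> powr (s - t)) * hausdorff_term t (U n))"
      by (intro suminf_le) (auto intro: summableI)
    also have "\<dots> = ennreal (\<delta> powr (s - t)) * (\<Sum>n. hausdorff_term t (U n))" by simp
    also have "\<dots> \<le> ennreal (\<delta> powr (s - t)) * ennreal K"
      using U(3) by (intro mult_left_mono) auto
    also have "\<dots> = ennreal (\<delta> powr (s - t) * K)" using K by (simp add: ennreal_mult)
    finally show ?thesis using hausdorff_premeasure_le[OF U(1,2), of s] by (rule order_trans[rotated])
  qed
  have "hausdorff_premeasure s \<delta> A = 0" if d: "\<delta> > 0" for \<delta>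
  proof -
    have "((\<lambda>\<eta>. \<eta> powr (s - t)) \<longlongrightarrow> 0) (at_right 0)"
      by (rule tendsto_zero_powrI[of _ _ _ "s - t"]) (use st in \<open>auto simp: eventually_at_filter tendsto_ident_at\<close>)
    then have "((\<lambda>\<eta>. \<eta> powr (s - t) * K) \<longlongrightarrow> 0 * K) (at_right 0)"
      by (intro tendsto_mult) auto
    then have lim: "((\<lambda>\<eta>. ennreal (\<eta> powr (s - t) * K)) \<longlongrightarrow> ennreal 0) (at_right 0)"
      by (intro tendsto_ennrealI) simp
    have "\<forall>\<^sub>F \<eta> in at_right 0. \<eta> \<in> {0<..<\<delta>}"
      using d by (rule eventually_at_right_real)
    then have "\<forall>\<^sub>F \<eta> in at_right 0. hausdorff_premeasure s \<delta> A \<le> ennreal (\<eta> powr (s - t) * K)"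
    proof eventually_elim
      case (elim \<eta>)
      then show ?case
        using order_trans[OF hausdorff_premeasure_antimono[of \<eta> \<delta>] small[of \<eta>]] by simp
    qed
    then have "hausdorff_premeasure s \<delta> A \<le> ennreal 0"
      using tendsto_lowerbound[OF lim] by simp
    then show ?thesis by simp
  qed
  then show ?thesis unfolding hausdorff_measure_def by (auto intro!: SUP_eqI)
qed

text \<open>The map \<open>dist x\<close> is 1-Lipschitz, and the image of A contains the interval
  \<open>{0..dist x y}\<close>. Each covering set is replaced by the interval between the infimum
  and the supremum of its image, whose length is at most the diameter, and Lebesgue measure on the
  line does the rest.\<close>

lemma connected_dist_le_hausdorff_premeasure:
  fixes A :: "'a::metric_space set"
  assumes "connected A" "x \<in> A" "y \<in> A"
  shows "ennreal (dist x y) \<le> hausdorff_premeasure 1 \<delta> A"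
  unfolding hausdorff_premeasure_def
proof (rule INF_greatest)
  fix U :: "nat \<Rightarrow> 'a set"
  assume "U \<in> {U. A \<subseteq> (\<Union>n. U n) \<and> (\<forall>n. bounded (U n) \<and> diameter (U n) \<le> \<delta>)}"
  then have U: "A \<subseteq> (\<Union>n. U n)" "\<And>n. bounded (U n)" by auto
  define I where "I n = (if U n = {} then {} else {Inf (dist x ` U n)..Sup (dist x ` U n)})" for n
  have bd: "bdd_above (dist x ` U n)" "bdd_below (dist x ` U n)" for n
    using U(2)[of n] bounded_any_center[of "U n" x]
    by (auto simp: bdd_above_def intro!: bdd_belowI2[of _ 0])
  have "connected (dist x ` A)"
    using assms(1) by (intro connected_continuous_image continuous_intros)
  then have "{0..dist x y} \<subseteq> dist x ` A"
    using assms(2,3) by (intro connected_contains_Icc) force+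
  also have "\<dots> \<subseteq> (\<Union>n. I n)"
  proof
    fix r assume "r \<in> dist x ` A"
    then obtain z n where "z \<in> U n" "r = dist x z" using U(1) by auto
    then have "r \<in> I n" using bd by (auto simp: I_def intro!: cInf_lower cSup_upper)
    then show "r \<in> (\<Union>n. I n)" by blast
  qed
  finally have sub: "{0..dist x y} \<subseteq> (\<Union>n. I n)" .
  have "ennreal (dist x y) = emeasure lborel {0..dist x y}" by simp
  also have "\<dots> \<le> emeasure lborel (\<Union>n. I n)"
    using sub by (intro emeasure_mono) (auto simp: I_def)
  also have "\<dots> \<le> (\<Sum>n. emeasure lborel (I n))"
    by (rule emeasure_subadditive_countably) (auto simp: I_def)
  also have "\<dots> \<le> (\<Sum>n. hausdorff_term 1 (U n))"
  proof (rule suminf_le)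
    fix n
    show "emeasure lborel (I n) \<le> hausdorff_term 1 (U n)"
    proof (cases "U n = {}")
      case False
      have le: "dist x u - diameter (U n) \<le> dist x v" if "u \<in> U n" "v \<in> U n" for u v
      proof -
        have "dist v u \<le> diameter (U n)" using diameter_bounded_bound[OF U(2)] that by blast
        then show ?thesis using dist_triangle[of x u v] by linarith
      qed
      then have "dist x u - diameter (U n) \<le> Inf (dist x ` U n)" if "u \<in> U n" for u
        using that False by (intro cInf_greatest) auto
      then have "Sup (dist x ` U n) \<le> Inf (dist x ` U n) + diameter (U n)"
        using False by (intro cSup_least) (auto simp: algebra_simps)
      moreover have "Inf (dist x ` U n) \<le> Sup (dist x ` U n)"
        using bd False by (intro cInf_le_cSup) auto
      ultimately show ?thesis using False diameter_ge_0[OF U(2)[of n]]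
        by (auto simp: I_def hausdorff_term_def intro!: ennreal_leI)
    qed (simp add: I_def)
  qed auto
  finally show "ennreal (dist x y) \<le> (\<Sum>n. hausdorff_term 1 (U n))" .
qed

text \<open>At scale 1 all diameters are at most 1, so powers decrease in the exponent. For s = 0
  every nonempty set counts 1, which still dominates.\<close>

lemma hausdorff_premeasure_exponent_antimono:
  assumes "0 \<le> s" "s \<le> t" "t > 0"
  shows "hausdorff_premeasure t 1 A \<le> hausdorff_premeasure s 1 A"
  unfolding hausdorff_premeasure_def
proof (rule INF_mono, rule bexI[rotated], assumption)
  fix U :: "nat \<Rightarrow> 'a set"
  assume "U \<in> {U. A \<subseteq> (\<Union>n. U n) \<and> (\<forall>n. bounded (U n) \<and> diameter (U n) \<le> 1)}"
  then have U: "\<And>n. 0 \<le> diameter (U n) \<and> diameter (U n) \<le> 1" by (auto simp: diameter_ge_0)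
  have "hausdorff_term t (U n) \<le> hausdorff_term s (U n)" for n
  proof (cases "diameter (U n) = 0")
    case False
    then have "diameter (U n) powr t \<le> diameter (U n) powr s"
      using U[of n] assms by (intro powr_mono') auto
    moreover have "diameter (U n) powr t \<le> 1" using U[of n] assms by (intro powr_le1) auto
    ultimately show ?thesis using assms by (auto simp: hausdorff_term_def intro: ennreal_leI)
  qed (use assms in \<open>auto simp: hausdorff_term_def\<close>)
  then show "(\<Sum>n. hausdorff_term t (U n)) \<le> (\<Sum>n. hausdorff_term s (U n))"
    by (intro suminf_le) (auto intro: summableI)
qed

text \<open>For s < 1 the measure of dimension s dominates its premeasure at scale 1, hence the
  premeasure of dimension 1 at that scale, hence the distance of two points of A, and so cannot
  vanish.\<close>

lemma hausdorff_dim_eq_1: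
  assumes "connected A" "x \<in> A" "y \<in> A" "x \<noteq> y" and fin: "hausdorff_measure 1 A < \<infinity>"
  shows "hausdorff_dim A = 1"
proof (rule antisym)
  show "hausdorff_dim A \<le> 1"
  proof (rule ennreal_le_epsilon)
    fix e :: real assume "0 < e"
    then have "hausdorff_measure (1 + e) A = 0"
      using fin by (intro hausdorff_measure_eq_0_above[of 1]) auto
    then have "hausdorff_dim A \<le> ennreal (1 + e)"
      unfolding hausdorff_dim_def using \<open>0 < e\<close>
      by (intro Inf_lower CollectI exI[of _ "1 + e"]) auto
    also have "\<dots> = 1 + ennreal e" using \<open>0 < e\<close> by simp
    finally show "hausdorff_dim A \<le> 1 + ennreal e" .
  qed
  show "1 \<le> hausdorff_dim A"
    unfolding hausdorff_dim_def
  proof (rule Inf_greatest, clarify)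
    fix s :: real assume s: "0 \<le> s" "hausdorff_measure s A = 0"
    show "1 \<le> ennreal s"
    proof (rule ccontr)
      assume "\<not> 1 \<le> ennreal s"
      then have "s < 1" by (metis ennreal_1 ennreal_leI linorder_le_less_linear)
      have "0 < ennreal (dist x y)" using assms(4) by simp
      also have "\<dots> \<le> hausdorff_premeasure 1 1 A"
        using connected_dist_le_hausdorff_premeasure assms by blast
      also have "\<dots> \<le> hausdorff_premeasure s 1 A"
        using s \<open>s < 1\<close> by (intro hausdorff_premeasure_exponent_antimono) auto
      also have "\<dots> \<le> hausdorff_measure s A" by (rule hausdorff_premeasure_le_measure) simp
      finally show False using s by simp
    qed
  qed
qed

section \<open>Barycentric coordinates and substitution systems\<close>

lemma HH_iff: "\<alpha> \<in> HH \<longleftrightarrow> (\<forall>i. 0 \<le> \<alpha> $ i) \<and> \<alpha> $ 1 + \<alpha> $ 2 + \<alpha> $ 3 = 1"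
proof -
  have "\<alpha> $ i \<le> 1" if "\<forall>i. 0 \<le> \<alpha> $ i" "\<alpha> $ 1 + \<alpha> $ 2 + \<alpha> $ 3 = 1" for i
    using that(1)[rule_format, of 1] that(1)[rule_format, of 2] that(1)[rule_format, of 3] that(2)
      exhaust_3[of i] by auto
  then show ?thesis by (auto simp: HH_def sum_3)
qed

lemma HH_bounds: "\<alpha> \<in> HH \<Longrightarrow> 0 \<le> \<alpha> $ i \<and> \<alpha> $ i \<le> 1"
  by (simp add: HH_def)

lemma idx_iff: "k \<in> idx s \<longleftrightarrow> (\<forall>i. 0 \<le> k $ i) \<and> k $ 1 + k $ 2 + k $ 3 = s"
  by (simp add: idx_def sum_3)

lemma finite_idx: "finite (idx s)"
proof (rule finite_subset)
  show "idx s \<subseteq> (\<lambda>(x, y, z). vector [x, y, z]) ` ({0..s} \<times> {0..s} \<times> {0..s})"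
  proof
    fix k assume k: "k \<in> idx s"
    then have "0 \<le> k $ 1" "0 \<le> k $ 2" "0 \<le> k $ 3" "k $ 1 + k $ 2 + k $ 3 = s"
      by (auto simp: idx_iff)
    moreover have "k = vector [k $ 1, k $ 2, k $ 3]"
      by (simp add: vec_eq_iff forall_3)
    ultimately show "k \<in> (\<lambda>(x, y, z). vector [x, y, z]) ` ({0..s} \<times> {0..s} \<times> {0..s})"
      by (intro image_eqI[of _ _ "(k $ 1, k $ 2, k $ 3)"]) auto
  qed
qed simp

lemma compact_HH: "compact HH"
proof -
  have "closed HH"
    unfolding HH_def atLeastAtMost_iff by (intro closed_Collect_conj closed_Collect_all closed_Collect_le closed_Collect_eq continuous_intros)
  moreover have "HH \<subseteq> cbox 0 1" by (auto simp: HH_def mem_box_cart)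
  ultimately show ?thesis using bounded_subset[OF bounded_cbox] compact_eq_bounded_closed by blast
qed

text \<open>A node \<open>(d, k)\<close> stands for \<open>T m k\<close> if \<open>d\<close> holds, and for \<open>T' m k\<close> otherwise.\<close>

type_synonym node = "bool \<times> (int^3)"

text \<open>This is the map of the triangle of the node, written in barycentric coordinates. In a
  down triangle the vertex P_i is replaced by P_1 + P_2 + P_3 - P_i, which turns \<alpha> into 1 -
  \<alpha>.\<close>

definition node_map :: "nat \<Rightarrow> node \<Rightarrow> real^3 \<Rightarrow> real^3" where
  "node_map m v \<alpha> =
     (\<chi> i. (of_int (snd v $ i) + (if fst v then \<alpha> $ i else 1 - \<alpha> $ i)) / real m)"

definition linked :: "3 \<Rightarrow> node \<Rightarrow> node \<Rightarrow> bool" where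
  "linked j u v \<longleftrightarrow> fst u \<and> \<not> fst v \<and> (\<forall>i. snd u $ i = snd v $ i + (if i = j then 1 else 0))"

definition sym_linked :: "3 \<Rightarrow> node \<Rightarrow> node \<Rightarrow> bool" where
  "sym_linked j u v \<longleftrightarrow> linked j u v \<or> linked j v u"

definition node_adj :: "node \<Rightarrow> node \<Rightarrow> bool" where
  "node_adj u v \<longleftrightarrow> (\<exists>j. sym_linked j u v)"

lemma sym_linked_sym: "sym_linked j u v \<longleftrightarrow> sym_linked j v u"
  by (auto simp: sym_linked_def)

lemma symp_node_adj: "symp node_adj"
  by (auto simp: symp_def node_adj_def sym_linked_def)

lemma sym_linked_unique:
  assumes "sym_linked i u v" "sym_linked j u v"
  shows "i = j"
proof (rule ccontr)
  assume ne: "i \<noteq> j"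
  have "snd u $ i = snd v $ i \<longleftrightarrow> False" using assms(1) by (auto simp: sym_linked_def linked_def)
  moreover have "snd u $ i = snd v $ i" using assms(2) ne by (auto simp: sym_linked_def linked_def)
  ultimately show False by simp
qed

text \<open>
  The state \<open>\<sigma>\<close> of a triangle tells whether it carries the white (\<open>True\<close>) or the yellow
  pattern. The state is kept in up children and flipped in down children, hence the new state
  \<open>\<sigma> = fst v\<close> in the child \<open>v\<close>.
\<close>

fun approximant :: "nat \<Rightarrow> (bool \<Rightarrow> node set) \<Rightarrow> bool \<Rightarrow> nat \<Rightarrow> (real^3) set" where
  "approximant m N \<sigma> 0 = HH"
| "approximant m N \<sigma> (Suc n) = (\<Union>v\<in>N \<sigma>. node_map m v ` approximant m N (\<sigma> = fst v) n)"

text \<open>The recursion adds the innermost map, like the given sets of triangles of level n,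
  whereas \<open>approximant\<close> peels off the outermost one; \<open>app_cells\<close>
  reconciles the two. Each map is paired with its state, which selects the pattern that refines the
  cell.\<close>

fun cells :: "nat \<Rightarrow> (bool \<Rightarrow> node set) \<Rightarrow> bool \<Rightarrow> nat \<Rightarrow> ((real^3 \<Rightarrow> real^3) \<times> bool) set" where
  "cells m N \<sigma> 0 = {(id, \<sigma>)}"
| "cells m N \<sigma> (Suc n) = {(F \<circ> node_map m v, s = fst v) |F s v. (F, s) \<in> cells m N \<sigma> n \<and> v \<in> N s}"

text \<open>\<open>exit_unique\<close> is the exits property at a single side: an up triangle of one
  pattern and an up triangle of the other in mirrored positions on side j can only be the exits.
  \<open>exit_pos\<close> keeps the exit triangles away from the corners.\<close>

locale tri_system =
  fixes m :: nat and N :: "bool \<Rightarrow> node set" and ex :: "bool \<Rightarrow> 3 \<Rightarrow> int^3"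
  assumes m_ge_2: "m \<ge> 2"
    and nodes: "v \<in> N \<sigma> \<Longrightarrow> snd v \<in> idx (if fst v then int m - 1 else int m - 2)"
    and corner_unique:
      "(True, axis i (int m - 1)) \<in> N \<sigma> \<Longrightarrow> (True, axis j (int m - 1)) \<in> N \<sigma> \<Longrightarrow> i = j"
    and corner_disjoint:
      "(True, axis i (int m - 1)) \<in> N True \<Longrightarrow> (True, axis i (int m - 1)) \<in> N False \<Longrightarrow> False"
    and exit_unique:
      "(True, k) \<in> N \<sigma> \<Longrightarrow> (True, l) \<in> N (\<not> \<sigma>) \<Longrightarrow> k $ j = 0 \<Longrightarrow> l $ j = 0 \<Longrightarrow>
        (\<And>i. i \<noteq> j \<Longrightarrow> k $ i + l $ i = int m - 1) \<Longrightarrow> k = ex \<sigma> j"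
    and exit_idx: "ex \<sigma> j \<in> idx (int m - 1)"
    and exit_zero: "ex \<sigma> j $ j = 0"
    and exit_pos: "i \<noteq> j \<Longrightarrow> 0 < ex \<sigma> j $ i"
    and exit_opposite: "i \<noteq> j \<Longrightarrow> ex \<sigma> j $ i + ex (\<not> \<sigma>) j $ i = int m - 1"
    and acyclic: "\<nexists>p. graph_cycle node_adj (N \<sigma>) p"
begin

abbreviation "nm \<equiv> node_map m"
abbreviation "app \<equiv> approximant m N"
abbreviation "cel \<equiv> cells m N"

definition fractal :: "bool \<Rightarrow> (real^3) set" where
  "fractal \<sigma> = (\<Inter>n. app \<sigma> n)"

text \<open>The solution of (k + \<alpha>) / m = \<alpha> for the exit index k: the point of side j
  that is reached by entering the exit child again and again.\<close>

definition exit_point :: "bool \<Rightarrow> 3 \<Rightarrow> real^3" where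
  "exit_point \<sigma> j = (\<chi> i. of_int (ex \<sigma> j $ i) / (real m - 1))"

lemma finite_nodes: "finite (N \<sigma>)"
proof (rule finite_subset)
  show "N \<sigma> \<subseteq> ({True} \<times> idx (int m - 1)) \<union> ({False} \<times> idx (int m - 2))"
  proof
    fix v assume "v \<in> N \<sigma>"
    then show "v \<in> ({True} \<times> idx (int m - 1)) \<union> ({False} \<times> idx (int m - 2))"
      using nodes[of v \<sigma>] by (cases v; cases "fst v") auto
  qed
  show "finite (({True} \<times> idx (int m - 1)) \<union> ({False} \<times> idx (int m - 2)))"
    by (simp add: finite_idx)
qed

lemma nodes_sum:
  assumes "v \<in> N \<sigma>"
  shows "0 \<le> snd v $ i" "snd v $ 1 + snd v $ 2 + snd v $ 3 = (if fst v then int m - 1 else int m - 2)"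
  using nodes[OF assms] by (auto simp: idx_iff)

lemma nm_nth: "real m * nm v \<alpha> $ i = of_int (snd v $ i) + (if fst v then \<alpha> $ i else 1 - \<alpha> $ i)"
  using m_ge_2 by (simp add: node_map_def)

lemma nm_inj: "nm v x = nm v y \<Longrightarrow> x = y"
  using m_ge_2 by (auto simp: node_map_def vec_eq_iff split: if_splits)

lemma nm_HH:
  assumes "v \<in> N \<sigma>" "x \<in> HH"
  shows "nm v x \<in> HH"
proof -
  have x: "x $ 1 + x $ 2 + x $ 3 = 1" "\<And>i. 0 \<le> x $ i \<and> x $ i \<le> 1"
    using assms(2) HH_bounds by (auto simp: HH_iff)
  have "0 \<le> nm v x $ i" for i
    using x(2)[of i] nodes_sum(1)[OF assms(1), of i] by (simp add: node_map_def)
  moreover have "real m * (nm v x $ 1 + nm v x $ 2 + nm v x $ 3) = real m * 1"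
  proof -
    have "real_of_int (snd v $ 1 + snd v $ 2 + snd v $ 3) = (if fst v then real m - 1 else real m - 2)"
      using nodes_sum(2)[OF assms(1)] by simp
    then show ?thesis using x(1) unfolding distrib_left nm_nth by auto
  qed
  ultimately show ?thesis using m_ge_2 unfolding HH_iff mult_cancel_left by auto
qed

lemma app_antimono: "app \<sigma> (Suc n) \<subseteq> app \<sigma> n"
proof (induction n arbitrary: \<sigma>)
  case 0
  then show ?case using nm_HH by auto
next
  case (Suc n)
  show ?case
    unfolding approximant.simps(2)[of m N \<sigma> "Suc n"] approximant.simps(2)[of m N \<sigma> n]
    using Suc by (intro UN_mono image_mono) auto
qed

lemma app_antimono': "n \<le> n' \<Longrightarrow> app \<sigma> n' \<subseteq> app \<sigma> n"
  using app_antimono by (rule lift_Suc_antimono_le)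

lemma fractal_HH: "fractal \<sigma> \<subseteq> HH"
  unfolding fractal_def by (metis INF_lower UNIV_I approximant.simps(1))

lemma continuous_on_nm: "continuous_on A (nm v)"
  unfolding node_map_def using m_ge_2
  by (cases "fst v") (auto intro!: continuous_intros)

lemma compact_app: "compact (app \<sigma> n)"
proof (induction n arbitrary: \<sigma>)
  case (Suc n)
  then show ?case
    by (auto intro!: compact_UN finite_nodes compact_continuous_image continuous_on_nm)
qed (simp add: compact_HH)

lemma compact_fractal: "compact (fractal \<sigma>)"
proof -
  have "closed (fractal \<sigma>)"
    unfolding fractal_def using compact_app compact_imp_closed by blast
  then show ?thesis using fractal_HH compact_HH by (metis closed_Int_compact inf.absorb1)
qed

definition piece :: "bool \<Rightarrow> node \<Rightarrow> (real^3) set" where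
  "piece \<sigma> v = nm v ` fractal (\<sigma> = fst v)"

text \<open>For the inclusion from left to right, p lies at every level in the approximant of some
  child. Among finitely many children one occurs infinitely often; its preimage of p is the same
  each time by injectivity and lies in all approximants because they decrease.\<close>

lemma fractal_unfold: "fractal \<sigma> = (\<Union>v\<in>N \<sigma>. piece \<sigma> v)"
proof
  show "fractal \<sigma> \<subseteq> (\<Union>v\<in>N \<sigma>. piece \<sigma> v)"
  proof
    fix p assume p: "p \<in> fractal \<sigma>"
    have "\<exists>v. v \<in> N \<sigma> \<and> p \<in> nm v ` app (\<sigma> = fst v) n" for n
    proof -
      have "p \<in> app \<sigma> (Suc n)" using p unfolding fractal_def by blast
      then show ?thesis unfolding approximant.simps by blast
    qed
    then obtain f where f: "\<And>n. f n \<in> N \<sigma> \<and> p \<in> nm (f n) ` app (\<sigma> = fst (f n)) n" by metis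
    have "finite (range f)" using f finite_nodes finite_subset by (metis image_subsetI)
    then obtain n0 where n0: "infinite {n. f n = f n0}"
      using pigeonhole_infinite[of UNIV f] by auto
    define v where "v = f n0"
    have inf: "infinite {n. f n = v}" using n0 by (simp add: v_def)
    have v: "v = f n0" by (simp add: v_def)
    obtain x where x: "p = nm v x" using f[of n0] v by blast
    have "x \<in> app (\<sigma> = fst v) n" for n
    proof -
      obtain n' where n': "n' > n" "f n' = v" using inf unfolding infinite_nat_iff_unbounded by auto
      then obtain y where y: "p = nm v y" "y \<in> app (\<sigma> = fst v) n'" using f by blast
      then have "y = x" using x nm_inj by metis
      then show ?thesis using y(2) app_antimono'[of n n'] n'(1) by auto
    qed
    then have "x \<in> fractal (\<sigma> = fst v)" by (simp add: fractal_def)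
    then show "p \<in> (\<Union>v\<in>N \<sigma>. piece \<sigma> v)" using x f v unfolding piece_def by blast
  qed
  show "(\<Union>v\<in>N \<sigma>. piece \<sigma> v) \<subseteq> fractal \<sigma>"
  proof
    fix p assume "p \<in> (\<Union>v\<in>N \<sigma>. piece \<sigma> v)"
    then obtain v x where v: "v \<in> N \<sigma>" "x \<in> fractal (\<sigma> = fst v)" "p = nm v x" by (auto simp: piece_def)
    have "p \<in> app \<sigma> (Suc n)" for n using v by (auto simp: fractal_def)
    then show "p \<in> fractal \<sigma>" unfolding fractal_def using app_antimono by blast
  qed
qed

lemma closed_UN_piece: "closed (\<Union>v\<in>C. piece \<sigma> v)" if "C \<subseteq> N \<sigma>"
proof -
  have "compact (piece \<sigma> v)" for v
    unfolding piece_def by (intro compact_continuous_image continuous_on_nm compact_fractal)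
  moreover have "finite C" using that finite_nodes finite_subset by blast
  ultimately show ?thesis by (intro closed_UN) (auto intro: compact_imp_closed)
qed

section \<open>Corners and exit points of the fractal\<close>

lemma corner_node:
  assumes "x \<in> fractal \<sigma>" "x $ i = 1"
  shows "(True, axis i (int m - 1)) \<in> N \<sigma>"
proof -
  obtain v y where v: "v \<in> N \<sigma>" "y \<in> fractal (\<sigma> = fst v)" "x = nm v y"
    using assms(1) unfolding fractal_unfold[of \<sigma>] piece_def by blast
  have y: "0 \<le> y $ i \<and> y $ i \<le> 1" using v(2) fractal_HH HH_bounds by blast
  have "real m = of_int (snd v $ i) + (if fst v then y $ i else 1 - y $ i)"
    using nm_nth[of v y i] v(3) assms(2) by simp
  then have le: "int m - 1 \<le> snd v $ i" using y by (auto split: if_splits)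
  have s: "snd v $ 1 + snd v $ 2 + snd v $ 3 = (if fst v then int m - 1 else int m - 2)"
    "0 \<le> snd v $ 1" "0 \<le> snd v $ 2" "0 \<le> snd v $ 3"
    using nodes_sum[OF v(1)] by auto
  have "fst v" using le s exhaust_3[of i] by (auto split: if_splits)
  moreover have "snd v = axis i (int m - 1)"
    using le s exhaust_3[of i] by (auto simp: vec_eq_iff forall_3 axis_def split: if_splits)
  ultimately show ?thesis using v(1) by (metis prod.collapse)
qed

lemma no_two_corners:
  assumes "x \<in> fractal \<sigma>" "y \<in> fractal \<sigma>" "x $ i = 1" "y $ j = 1"
  shows "i = j"
  using corner_node[OF assms(1,3)] corner_node[OF assms(2,4)] corner_unique by blast

lemma no_common_corner:
  assumes "x \<in> fractal \<sigma>" "y \<in> fractal (\<not> \<sigma>)" "x $ i = 1" "y $ i = 1"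
  shows False
  using corner_node[OF assms(1,3)] corner_node[OF assms(2,4)] corner_disjoint by (cases \<sigma>) auto

lemma exit_point_nth: "real m * exit_point \<sigma> j $ i = of_int (ex \<sigma> j $ i) + exit_point \<sigma> j $ i"
  using m_ge_2 by (simp add: exit_point_def field_simps)

lemma exit_point_fix: "nm (True, ex \<sigma> j) (exit_point \<sigma> j) = exit_point \<sigma> j"
proof -
  have "real m * nm (True, ex \<sigma> j) (exit_point \<sigma> j) $ i = real m * exit_point \<sigma> j $ i" for i
    by (simp add: nm_nth exit_point_nth)
  then show ?thesis using m_ge_2 by (simp add: vec_eq_iff)
qed

lemma exit_point_HH: "exit_point \<sigma> j \<in> HH"
proof -
  have "real_of_int (ex \<sigma> j $ 1 + ex \<sigma> j $ 2 + ex \<sigma> j $ 3) = real m - 1"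
    using exit_idx[of \<sigma> j] by (simp add: idx_iff)
  then show ?thesis using exit_idx[of \<sigma> j] m_ge_2
    by (auto simp: HH_iff exit_point_def idx_iff simp flip: add_divide_distrib)
qed

lemma exit_point_zero: "exit_point \<sigma> j $ j = 0" by (simp add: exit_point_def exit_zero)

lemma exit_point_opposite: "i \<noteq> j \<Longrightarrow> exit_point \<sigma> j $ i + exit_point (\<not> \<sigma>) j $ i = 1"
proof -
  assume "i \<noteq> j"
  then have "real_of_int (ex \<sigma> j $ i + ex (\<not> \<sigma>) j $ i) = real m - 1" using exit_opposite by simp
  then show ?thesis using m_ge_2 by (simp add: exit_point_def flip: add_divide_distrib)
qed

lemma exit_point_pos: "i \<noteq> j \<Longrightarrow> 0 < exit_point \<sigma> j $ i"
  using exit_pos m_ge_2 by (simp add: exit_point_def)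

lemma exit_point_less_1: "i \<noteq> j \<Longrightarrow> exit_point \<sigma> j $ i < 1"
  using exit_point_pos[of i j "\<not> \<sigma>"] exit_point_opposite[of i j \<sigma>] by linarith

text \<open>Off j, m times the exit point has non-integer coordinates, since those of the exit point
  are strictly between 0 and 1. This determines the integer part and thus the index of the child;
  the coordinate sum then determines its orientation.\<close>

lemma exit_point_node:
  assumes "v \<in> N \<sigma>" "x \<in> HH" "nm v x = exit_point \<sigma> j"
  shows "v = (True, ex \<sigma> j) \<and> x = exit_point \<sigma> j"
proof -
  have eq: "of_int (snd v $ i) + (if fst v then x $ i else 1 - x $ i) = of_int (ex \<sigma> j $ i) + exit_point \<sigma> j $ i" for i
    using nm_nth[of v x i] exit_point_nth[of \<sigma> j i] assms(3) by simp
  have x: "0 \<le> x $ i \<and> x $ i \<le> 1" for i using assms(2) HH_bounds by blast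
  have off: "snd v $ i = ex \<sigma> j $ i" if "i \<noteq> j" for i
    using eq[of i] x[of i] exit_point_pos[OF that, of \<sigma>] exit_point_less_1[OF that, of \<sigma>] by (auto split: if_splits)
  have "of_int (snd v $ j) \<le> (0::real)"
    using eq[of j] x[of j] exit_zero[of \<sigma> j] exit_point_zero[of \<sigma> j] by (auto split: if_splits)
  then have "snd v $ j = ex \<sigma> j $ j" using nodes_sum(1)[OF assms(1), of j] exit_zero[of \<sigma> j] by simp
  then have v2: "snd v = ex \<sigma> j" using off by (metis vec_eq_iff)
  moreover have "fst v"
    using nodes_sum(2)[OF assms(1)] exit_idx[of \<sigma> j] v2 by (auto simp: idx_iff split: if_splits)
  ultimately have "v = (True, ex \<sigma> j)" by (metis prod.collapse)
  then show ?thesis using exit_point_fix assms(3) nm_inj by metis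
qed

end

section \<open>Contacts and cuts\<close>

lemma ex_third: "\<exists>l::3. l \<noteq> i \<and> l \<noteq> j"
proof -
  have "card {i, j} < CARD(3)" by (rule le_less_trans[OF card_insert_le_m1[of 2]]) auto
  then have "{i, j} \<noteq> UNIV" by (metis less_irrefl)
  then show ?thesis by blast
qed

lemma sum_distinct_3:
  fixes x :: "'a::ab_semigroup_add^3"
  assumes "i \<noteq> j" "i \<noteq> l" "j \<noteq> l"
  shows "x $ 1 + x $ 2 + x $ 3 = x $ i + x $ j + x $ l"
  using exhaust_3[of i] exhaust_3[of j] exhaust_3[of l] assms by (auto simp: ac_simps)

lemma distinct_3_cases:
  assumes "i \<noteq> j" "i \<noteq> l" "j \<noteq> (l::3)"
  shows "n = i \<or> n = j \<or> n = l"
  using exhaust_3[of i] exhaust_3[of j] exhaust_3[of l] exhaust_3[of n] assms by auto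

context tri_system begin

text \<open>x and y describe one point of a common side j, seen from two adjacent triangles of
  opposite states, hence the mirrored coordinates. A down child reaches side j only in its vertex j,
  so the child on the other side has a vertex at this point too. If that child is up, both carry the
  same pattern, which would have two corners; if it is down, they carry opposite patterns with a
  common corner.\<close>

lemma exit_contact_up:
  assumes "y \<in> fractal (\<not> \<sigma>)" "x $ j = 0" "y $ j = 0" and sum: "\<And>i. i \<noteq> j \<Longrightarrow> x $ i + y $ i = 1"
    and u: "u \<in> N \<sigma>" "x' \<in> fractal (\<sigma> = fst u)" "x = nm u x'"
  shows "fst u"
proof (rule ccontr)
  assume down: "\<not> fst u"
  have x': "x' \<in> HH" "\<And>i. 0 \<le> x' $ i \<and> x' $ i \<le> 1" using u(2) fractal_HH HH_bounds by blast+
  have "of_int (snd u $ j) + (1 - x' $ j) = 0"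
    using nm_nth[of u x' j] u(3) assms(2) down by simp
  then have xj: "x' $ j = 1" using nodes_sum(1)[OF u(1), of j] x'(2)[of j] by linarith
  have x'0: "x' $ i = 0" if "i \<noteq> j" for i
  proof -
    obtain l where "l \<noteq> i" "l \<noteq> j" using ex_third by blast
    then have "x' $ i + x' $ j + x' $ l = 1"
      using sum_distinct_3[of i j l x'] that x'(1) by (auto simp: HH_iff)
    then show ?thesis using xj x'(2)[of i] x'(2)[of l] by linarith
  qed
  obtain v y' where v: "v \<in> N (\<not> \<sigma>)" "y' \<in> fractal ((\<not> \<sigma>) = fst v)" "y = nm v y'"
    using assms(1) unfolding fractal_unfold[of "\<not> \<sigma>"] piece_def by blast
  have y': "y' \<in> HH" "\<And>i. 0 \<le> y' $ i \<and> y' $ i \<le> 1" using v(2) fractal_HH HH_bounds by blast+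
  have yj: "of_int (snd v $ j) + (if fst v then y' $ j else 1 - y' $ j) = 0"
    using nm_nth[of v y' j] v(3) assms(3) by simp
  show False
  proof (cases "fst v")
    case True
    have y'j: "y' $ j = 0" using True yj nodes_sum(1)[OF v(1), of j] y'(2)[of j] by auto
    \<comment> \<open>The coordinates of x' are integers, so those of y' off j are integers as well
      and y' is a vertex different from j.\<close>
    have int: "y' $ i = of_int (int m - snd u $ i - 1 - snd v $ i)" if "i \<noteq> j" for i
    proof -
      have "real m * x $ i + real m * y $ i = real m"
        using sum[OF that] by (simp flip: distrib_left)
      then show ?thesis
        using nm_nth[of u x' i] u(3) nm_nth[of v y' i] v(3) x'0[OF that] down True by simp
    qed
    obtain l where l: "l \<noteq> j" by (metis zero_neq_one)
    obtain i where i: "i \<noteq> l" "i \<noteq> j" using ex_third by blast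
    have "y' $ i + y' $ l = 1"
      using sum_distinct_3[of i l j y'] i l y'(1) y'j by (auto simp: HH_iff)
    moreover obtain z where z: "y' $ i = of_int z" using int[OF i(2)] by blast
    moreover have "z = 0 \<or> z = 1" using y'(2)[of i] z by auto
    ultimately have "y' $ i = 1 \<or> y' $ l = 1" by auto
    then show False
      using no_two_corners[of x' "\<not> \<sigma>" y' j] u(2) v(2) down True xj i l by auto
  next
    case False
    then have "y' $ j = 1" using yj nodes_sum(1)[OF v(1), of j] y'(2)[of j] by simp
    then show False using no_common_corner[of y' \<sigma> x' j] u(2) v(2) down False xj by auto
  qed
qed

text \<open>Both children at the contact are up, so off j the coordinates of x' and y' add up to
  integers. A sum other than 1 would make x' and y' the same corner of opposite patterns. With sum 1
  the children are in mirrored positions, hence are the exits, and x' and y' satisfy the hypotheses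
  again.\<close>

lemma exit_contact_step:
  assumes "x \<in> fractal \<sigma>" "y \<in> fractal (\<not> \<sigma>)" "x $ j = 0" "y $ j = 0"
    and sum: "\<And>i. i \<noteq> j \<Longrightarrow> x $ i + y $ i = 1"
  shows "\<exists>x'\<in>fractal \<sigma>. \<exists>y'\<in>fractal (\<not> \<sigma>). x = nm (True, ex \<sigma> j) x' \<and> x' $ j = 0 \<and> y' $ j = 0 \<and>
    (\<forall>i. i \<noteq> j \<longrightarrow> x' $ i + y' $ i = 1)"
proof -
  obtain u x' where u: "u \<in> N \<sigma>" "x' \<in> fractal (\<sigma> = fst u)" "x = nm u x'"
    using assms(1) unfolding fractal_unfold[of \<sigma>] piece_def by blast
  obtain v y' where v: "v \<in> N (\<not> \<sigma>)" "y' \<in> fractal ((\<not> \<sigma>) = fst v)" "y = nm v y'"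
    using assms(2) unfolding fractal_unfold[of "\<not> \<sigma>"] piece_def by blast
  have up: "fst u" "fst v"
    using exit_contact_up[of y \<sigma> x j u x'] exit_contact_up[of x "\<not> \<sigma>" y j v y'] assms u v
    by (auto simp: add.commute)
  have x': "x' \<in> HH" "\<And>i. 0 \<le> x' $ i \<and> x' $ i \<le> 1" using u(2) fractal_HH HH_bounds by blast+
  have y': "y' \<in> HH" "\<And>i. 0 \<le> y' $ i \<and> y' $ i \<le> 1" using v(2) fractal_HH HH_bounds by blast+
  have j: "x' $ j = 0" "snd u $ j = 0" "y' $ j = 0" "snd v $ j = 0"
    using nm_nth[of u x' j] u(3) nm_nth[of v y' j] v(3) assms(3,4) up x'(2)[of j] y'(2)[of j]
      nodes_sum(1)[OF u(1), of j] nodes_sum(1)[OF v(1), of j] by auto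
  have t: "x' $ i + y' $ i = of_int (int m - snd u $ i - snd v $ i)" if "i \<noteq> j" for i
  proof -
    have "real m * x $ i + real m * y $ i = real m"
      using sum[OF that] by (simp flip: distrib_left)
    then show ?thesis using nm_nth[of u x' i] u(3) nm_nth[of v y' i] v(3) up by simp
  qed
  have no_2: False if "x' $ i = 1" "y' $ i = 1" for i
    using no_common_corner[of x' \<sigma> y' i] that u(2) v(2) up by simp
  have t1: "int m - snd u $ i - snd v $ i = 1" if "i \<noteq> j" for i
  proof (rule ccontr)
    assume ne: "int m - snd u $ i - snd v $ i \<noteq> 1"
    obtain l where l: "l \<noteq> i" "l \<noteq> j" using ex_third by blast
    have s: "x' $ i + x' $ l = 1" "y' $ i + y' $ l = 1"
      using sum_distinct_3[of i l j x'] sum_distinct_3[of i l j y'] l that x'(1) y'(1) j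
      by (auto simp: HH_iff)
    consider "int m - snd u $ i - snd v $ i \<le> 0" | "int m - snd u $ i - snd v $ i \<ge> 2"
      using ne by linarith
    then show False
    proof cases
      case 1
      then have "x' $ i + y' $ i \<le> 0" using t[OF that] by linarith
      then have "x' $ l = 1" "y' $ l = 1" using s x'(2)[of i] y'(2)[of i] by linarith+
      then show False by (rule no_2)
    next
      case 2
      then have "x' $ i + y' $ i \<ge> 2" using t[OF that] by linarith
      then have "x' $ i = 1" "y' $ i = 1" using x'(2)[of i] y'(2)[of i] by linarith+
      then show False by (rule no_2)
    qed
  qed
  have "snd u = ex \<sigma> j"
  proof (rule exit_unique)
    show "(True, snd u) \<in> N \<sigma>" "(True, snd v) \<in> N (\<not> \<sigma>)"
      using u(1) v(1) up by (metis prod.collapse)+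
    show "snd u $ i + snd v $ i = int m - 1" if "i \<noteq> j" for i using t1[OF that] by simp
  qed (use j in auto)
  then have "x = nm (True, ex \<sigma> j) x'" using u(3) up by (metis prod.collapse)
  moreover have "x' \<in> fractal \<sigma>" "y' \<in> fractal (\<not> \<sigma>)" using u(2) v(2) up by auto
  moreover have "\<forall>i. i \<noteq> j \<longrightarrow> x' $ i + y' $ i = 1" using t t1 by simp
  ultimately show ?thesis using j by blast
qed

lemma tendsto_m_power: "(\<lambda>n. 1 / real m ^ n) \<longlonglongrightarrow> 0"
  using LIMSEQ_realpow_zero[of "1 / real m"] m_ge_2 by (simp add: power_one_over)

text \<open>The step applies to its own result, so the exit child is met at every level and x
  differs from the fixed point of this child by at most 1/m^n for all n.\<close>

lemma exit_contact:
  assumes "x \<in> fractal \<sigma>" "y \<in> fractal (\<not> \<sigma>)" "x $ j = 0" "y $ j = 0"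
    and sum: "\<And>i. i \<noteq> j \<Longrightarrow> x $ i + y $ i = 1"
  shows "x = exit_point \<sigma> j"
proof -
  have bound: "\<bar>x $ i - exit_point \<sigma> j $ i\<bar> \<le> 1 / real m ^ n" for i n
    using assms
  proof (induction n arbitrary: x y)
    case 0
    then have "0 \<le> x $ i \<and> x $ i \<le> 1" "0 \<le> exit_point \<sigma> j $ i \<and> exit_point \<sigma> j $ i \<le> 1"
      using fractal_HH HH_bounds exit_point_HH by blast+
    then show ?case by (simp add: abs_le_iff)
  next
    case (Suc n)
    obtain x' y' where x': "x' \<in> fractal \<sigma>" "y' \<in> fractal (\<not> \<sigma>)" "x = nm (True, ex \<sigma> j) x'"
      "x' $ j = 0" "y' $ j = 0" "\<forall>i. i \<noteq> j \<longrightarrow> x' $ i + y' $ i = 1"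
      using exit_contact_step[OF Suc.prems] by blast
    have "\<bar>x' $ i - exit_point \<sigma> j $ i\<bar> \<le> 1 / real m ^ n" by (rule Suc.IH[of x' y']) (use x' in auto)
    moreover have "real m * (x $ i - exit_point \<sigma> j $ i) = x' $ i - exit_point \<sigma> j $ i"
      using nm_nth[of "(True, ex \<sigma> j)" x' i] exit_point_nth[of \<sigma> j i] x'(3) by (simp add: right_diff_distrib)
    ultimately have "real m * \<bar>x $ i - exit_point \<sigma> j $ i\<bar> \<le> 1 / real m ^ n"
      by (metis abs_mult abs_of_nat)
    then show ?case using m_ge_2 by (simp add: field_simps)
  qed
  have "\<bar>x $ i - exit_point \<sigma> j $ i\<bar> \<le> 0" for i
    by (rule tendsto_lowerbound[OF tendsto_m_power]) (use bound in auto)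
  then show ?thesis by (simp add: vec_eq_iff)
qed

text \<open>The entries of d lie between -1 and 1 and sum to 0, so both 1 and -1 occur; at these
  positions x and y, respectively, are vertices.\<close>

lemma integer_diff_corners:
  fixes d :: "int^3"
  assumes "x \<in> HH" "y \<in> HH" and d: "\<And>i. x $ i - y $ i = of_int (d $ i)" and "d \<noteq> 0"
  shows "\<exists>i j. i \<noteq> j \<and> x $ i = 1 \<and> y $ j = 1"
proof -
  have x: "0 \<le> x $ i \<and> x $ i \<le> 1" and y: "0 \<le> y $ i \<and> y $ i \<le> 1" for i
    using assms(1,2) HH_bounds by blast+
  have bd: "-1 \<le> d $ i \<and> d $ i \<le> 1" for i
  proof -
    have "-1 \<le> real_of_int (d $ i)" "real_of_int (d $ i) \<le> 1"
      using d[of i] x[of i] y[of i] by linarith+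
    then show ?thesis by simp
  qed
  have "real_of_int (d $ 1 + d $ 2 + d $ 3) = 0"
    using assms(1,2) d[of 1] d[of 2] d[of 3] by (auto simp: HH_iff)
  then have s: "d $ 1 + d $ 2 + d $ 3 = 0" by linarith
  have nz: "d $ 1 \<noteq> 0 \<or> d $ 2 \<noteq> 0 \<or> d $ 3 \<noteq> 0" using assms(4) by (auto simp: vec_eq_iff forall_3)
  have "d $ 1 = 1 \<or> d $ 2 = 1 \<or> d $ 3 = 1" using s nz bd[of 1] bd[of 2] bd[of 3] by linarith
  then obtain i where i: "d $ i = 1" by blast
  have "d $ 1 = -1 \<or> d $ 2 = -1 \<or> d $ 3 = -1" using s nz bd[of 1] bd[of 2] bd[of 3] by linarith
  then obtain j where j: "d $ j = -1" by blast
  have "x $ i = 1" using d[of i] i x[of i] y[of i] by simp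
  moreover have "y $ j = 1" using d[of j] j x[of j] y[of j] by simp
  moreover have "i \<noteq> j" using i j by auto
  ultimately show ?thesis by blast
qed

text \<open>The integers t_i = x_i + y_i lie between 0 and 2 and have sum 2. The value 2 would be a
  common corner of opposite patterns, so exactly one entry is 0 and the others are 1. This says both
  that the nodes are j-neighbours and that x and y are mirrored on side j.\<close>

lemma contact_opposite:
  assumes "u \<in> N \<sigma>" "v \<in> N \<sigma>" "fst u" "\<not> fst v" "x \<in> fractal \<sigma>" "y \<in> fractal (\<not> \<sigma>)" "nm u x = nm v y"
  shows "\<exists>j. linked j u v \<and> x = exit_point \<sigma> j \<and> y = exit_point (\<not> \<sigma>) j"
proof -
  define t where "t = (\<chi> i. snd v $ i + 1 - snd u $ i)"
  have x: "0 \<le> x $ i \<and> x $ i \<le> 1" and y: "0 \<le> y $ i \<and> y $ i \<le> 1" for i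
    using assms(5,6) fractal_HH HH_bounds by blast+
  have t: "x $ i + y $ i = of_int (t $ i)" for i
    using nm_nth[of u x i] nm_nth[of v y i] assms(3,4,7) by (simp add: t_def)
  have "t $ i \<noteq> 2" for i
  proof
    assume "t $ i = 2"
    then have "x $ i = 1" "y $ i = 1" using t[of i] x[of i] y[of i] by simp_all
    then show False using no_common_corner assms(5,6) by blast
  qed
  moreover have "0 \<le> t $ i" "t $ i \<le> 2" for i using t[of i] x[of i] y[of i] by linarith+
  ultimately have t01: "t $ i = 0 \<or> t $ i = 1" for i
    by (smt (verit, best))
  have "t $ 1 + t $ 2 + t $ 3 = 2"
    using nodes_sum(2)[OF assms(1)] nodes_sum(2)[OF assms(2)] assms(3,4) by (simp add: t_def)
  then have "t $ 1 = 0 \<or> t $ 2 = 0 \<or> t $ 3 = 0" using t01[of 1] t01[of 2] t01[of 3] by linarith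
  then obtain j where j0: "t $ j = 0" by blast
  have j: "t $ i = 1" if "i \<noteq> j" for i
  proof -
    obtain l where "l \<noteq> i" "l \<noteq> j" using ex_third by blast
    then show "t $ i = 1"
      using \<open>t $ 1 + t $ 2 + t $ 3 = 2\<close> sum_distinct_3[of i j l t] that j0 t01[of i] t01[of l] by auto
  qed
  have "linked j u v" using assms(3,4) j j0 by (fastforce simp: linked_def t_def)
  moreover have z: "x $ j = 0" "y $ j = 0" using t[of j] x[of j] y[of j] j0 by simp_all
  moreover have "x = exit_point \<sigma> j"
    by (rule exit_contact[of x \<sigma> y]) (use assms z t j j0 in auto)
  moreover have "y = exit_point (\<not> \<sigma>) j"
    by (rule exit_contact[of y "\<not> \<sigma>" x]) (use assms z t j j0 in \<open>auto simp: add.commute\<close>)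
  ultimately show ?thesis by blast
qed

text \<open>Children of equal orientation carry the same pattern and differ by an integer
  translation, so a common point would be two different corners of this pattern. Only the case of
  opposite orientations remains.\<close>

lemma contact:
  assumes "u \<in> N \<sigma>" "v \<in> N \<sigma>" "u \<noteq> v" "x \<in> fractal (\<sigma> = fst u)" "y \<in> fractal (\<sigma> = fst v)" "nm u x = nm v y"
  shows "\<exists>j. sym_linked j u v \<and> x = exit_point (\<sigma> = fst u) j \<and> y = exit_point (\<sigma> = fst v) j"
proof (cases "fst u = fst v")
  case True
  define d where "d = (if fst u then snd v - snd u else snd u - snd v)"
  have "d \<noteq> 0" using assms(3) True by (auto simp: d_def prod_eq_iff)
  moreover have "x $ i - y $ i = of_int (d $ i)" for i
    using nm_nth[of u x i] nm_nth[of v y i] assms(6) True by (auto simp: d_def)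
  ultimately obtain i j where ij: "i \<noteq> j" "x $ i = 1" "y $ j = 1"
    using integer_diff_corners assms(4,5) fractal_HH by blast
  then show ?thesis using no_two_corners[of x _ y i j] assms(4,5) True by auto
next
  case False
  show ?thesis
  proof (cases "fst u")
    case True
    then show ?thesis
      using contact_opposite[of u \<sigma> v x y] False assms by (auto simp: sym_linked_def)
  next
    case F: False
    then show ?thesis
      using contact_opposite[of v \<sigma> u y x] False assms by (auto simp: sym_linked_def)
  qed
qed

lemma contact_piece:
  assumes "u \<in> N \<sigma>" "v \<in> N \<sigma>" "u \<noteq> v" "z \<in> piece \<sigma> u" "z \<in> piece \<sigma> v"
  obtains j where "sym_linked j u v" "z = nm u (exit_point (\<sigma> = fst u) j)" "z = nm v (exit_point (\<sigma> = fst v) j)"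
  using assms contact[of u \<sigma> v] unfolding piece_def by blast

lemma exit_point_node_piece:
  assumes "v \<in> N \<sigma>" "exit_point \<sigma> j \<in> piece \<sigma> v"
  shows "v = (True, ex \<sigma> j)"
  using exit_point_node[OF assms(1)] assms(2) fractal_HH unfolding piece_def by (metis (no_types, lifting) imageE subsetD)

text \<open>
  The set \<open>B\<^sub>1\<close> (that contains \<open>p\<close>) is attached to the rest \<open>B\<^sub>2\<close> of the fractal in at
  most one point. Hence an arc with both end points in \<open>B\<^sub>2\<close> cannot pass through \<open>p\<close>.
\<close>

definition cut :: "bool \<Rightarrow> 3 set \<Rightarrow> real^3 \<Rightarrow> bool" where
  "cut \<sigma> \<tau> p \<longleftrightarrow> (\<exists>B\<^sub>1 B\<^sub>2. closed B\<^sub>1 \<and> closed B\<^sub>2 \<and> B\<^sub>1 \<union> B\<^sub>2 = fractal \<sigma> \<and>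
     (\<forall>y\<in>B\<^sub>1 \<inter> B\<^sub>2. \<forall>z\<in>B\<^sub>1 \<inter> B\<^sub>2. y = z) \<and> p \<in> B\<^sub>1 \<and> p \<notin> B\<^sub>2 \<and>
     (\<forall>i\<in>\<tau>. exit_point \<sigma> i \<in> B\<^sub>1 \<longrightarrow> exit_point \<sigma> i \<in> B\<^sub>2))"

text \<open>Each component of the nodes outside the connected set H hangs on H by one edge. A point
  outside the pieces of H is cut off by its whole component. A point in the piece of Q is cut off by
  a branch inside Q, together with the components attached to Q at exit points of this branch; the
  condition on the exits outside \<tau>' ensures that what is attached there does not belong to
  H.\<close>

lemma cut_step:
  assumes H: "H \<subseteq> N \<sigma>" and conn: "\<And>u v. u \<in> H \<Longrightarrow> v \<in> H \<Longrightarrow> (restricted node_adj H)\<^sup>*\<^sup>* u v"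
    and exits: "\<And>i. i \<in> \<tau> \<Longrightarrow> (True, ex \<sigma> i) \<in> H" and p: "p \<in> fractal \<sigma>"
    and inner: "\<And>Q x. Q \<in> H \<Longrightarrow> x \<in> fractal (\<sigma> = fst Q) \<Longrightarrow> p = nm Q x \<Longrightarrow>
      \<exists>\<tau>'. cut (\<sigma> = fst Q) \<tau>' x \<and> (\<forall>i\<in>\<tau>. Q = (True, ex \<sigma> i) \<longrightarrow> i \<in> \<tau>') \<and>
        (\<forall>b R. b \<notin> \<tau>' \<longrightarrow> sym_linked b Q R \<longrightarrow> R \<notin> H)"
  shows "cut \<sigma> \<tau> p"
proof -
  define comp where "comp v = {w. (restricted node_adj (N \<sigma> - H))\<^sup>*\<^sup>* v w}" for v
  have comp_sub: "comp v \<subseteq> N \<sigma> - H" if "v \<in> N \<sigma> - H" for v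
  proof
    fix w assume "w \<in> comp v"
    then have "(restricted node_adj (N \<sigma> - H))\<^sup>*\<^sup>* v w" by (simp add: comp_def)
    then show "w \<in> N \<sigma> - H" using that by cases (auto simp: restricted_def)
  qed
  have comp_self: "v \<in> comp v" for v by (simp add: comp_def)
  have comp_step: "w \<in> comp v" if "v \<in> N \<sigma> - H" "u \<in> comp v" "node_adj u w" "w \<in> N \<sigma> - H" for u v w
    using that comp_sub[OF that(1)] unfolding comp_def restricted_def
    by (auto intro: rtranclp.rtrancl_into_rtrancl)
  have one_edge: "c\<^sub>1 = c\<^sub>2 \<and> s\<^sub>1 = s\<^sub>2"
    if "v \<in> N \<sigma> - H" "c\<^sub>1 \<in> comp v" "c\<^sub>2 \<in> comp v" "s\<^sub>1 \<in> H" "s\<^sub>2 \<in> H" "node_adj c\<^sub>1 s\<^sub>1" "node_adj c\<^sub>2 s\<^sub>2"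
    for v c\<^sub>1 c\<^sub>2 s\<^sub>1 s\<^sub>2
  proof (rule acyclic_edge_between_unique[OF symp_node_adj acyclic[of \<sigma>], of "N \<sigma> - H" H])
    show "(restricted node_adj (N \<sigma> - H))\<^sup>*\<^sup>* c\<^sub>1 c\<^sub>2"
      using that(2,3) restricted_rtranclp_sym[OF symp_node_adj] unfolding comp_def
      by (metis mem_Collect_eq rtranclp_trans)
    show "c\<^sub>1 \<in> N \<sigma> - H" using that comp_sub by blast
  qed (use that H conn in auto)
  show ?thesis
  proof (cases "\<exists>Q\<in>H. p \<in> piece \<sigma> Q")
    case False
    obtain v where v: "v \<in> N \<sigma>" "p \<in> piece \<sigma> v" using p fractal_unfold by auto
    then have vH: "v \<in> N \<sigma> - H" using False by blast
    define C where "C = comp v"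
    have C: "C \<subseteq> N \<sigma> - H" "v \<in> C" using comp_sub[OF vH] comp_self by (auto simp: C_def)
    have edge: "w \<in> H" if "u \<in> C" "w \<in> N \<sigma> - C" "node_adj u w" for u w
      using comp_step[OF vH, of u w] that C unfolding C_def by blast
    define B\<^sub>1 where "B\<^sub>1 = (\<Union>u\<in>C. piece \<sigma> u)"
    define B\<^sub>2 where "B\<^sub>2 = (\<Union>u\<in>N \<sigma> - C. piece \<sigma> u)"
    have common: "\<exists>u w j. u \<in> C \<and> w \<in> H \<and> sym_linked j u w \<and> y = nm u (exit_point (\<sigma> = fst u) j) \<and> y \<in> piece \<sigma> w"
      if "y \<in> B\<^sub>1" "y \<in> B\<^sub>2" for y
    proof -
      obtain u w where uw: "u \<in> C" "w \<in> N \<sigma> - C" "y \<in> piece \<sigma> u" "y \<in> piece \<sigma> w"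
        using \<open>y \<in> B\<^sub>1\<close> \<open>y \<in> B\<^sub>2\<close> unfolding B\<^sub>1_def B\<^sub>2_def by blast
      then obtain j where "sym_linked j u w" "y = nm u (exit_point (\<sigma> = fst u) j)"
        using contact_piece[of u \<sigma> w y] C by blast
      then show ?thesis using edge[of u w] uw unfolding node_adj_def by blast
    qed
    show ?thesis
      unfolding cut_def
    proof (rule exI[of _ B\<^sub>1], rule exI[of _ B\<^sub>2], intro conjI)
      show "closed B\<^sub>1" "closed B\<^sub>2" unfolding B\<^sub>1_def B\<^sub>2_def using C by (auto intro!: closed_UN_piece)
      show "B\<^sub>1 \<union> B\<^sub>2 = fractal \<sigma>" unfolding B\<^sub>1_def B\<^sub>2_def fractal_unfold[of \<sigma>] using C by auto
      show "p \<in> B\<^sub>1" using v C unfolding B\<^sub>1_def by blast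
      show "p \<notin> B\<^sub>2" using common[OF \<open>p \<in> B\<^sub>1\<close>] False by blast
      show "\<forall>i\<in>\<tau>. exit_point \<sigma> i \<in> B\<^sub>1 \<longrightarrow> exit_point \<sigma> i \<in> B\<^sub>2"
        using exit_point_node_piece exits C unfolding B\<^sub>1_def by blast
      show "\<forall>y\<in>B\<^sub>1 \<inter> B\<^sub>2. \<forall>z\<in>B\<^sub>1 \<inter> B\<^sub>2. y = z"
      proof (intro ballI)
        fix y z assume "y \<in> B\<^sub>1 \<inter> B\<^sub>2" "z \<in> B\<^sub>1 \<inter> B\<^sub>2"
        then obtain u w j u' w' j' where
          y: "u \<in> C" "w \<in> H" "sym_linked j u w" "y = nm u (exit_point (\<sigma> = fst u) j)" and
          z: "u' \<in> C" "w' \<in> H" "sym_linked j' u' w'" "z = nm u' (exit_point (\<sigma> = fst u') j')"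
          using common by (metis IntE)
        have "u = u' \<and> w = w'"
          using one_edge[OF vH, of u u' w w'] y z unfolding C_def node_adj_def by blast
        then show "y = z" using y z sym_linked_unique by metis
      qed
    qed
  next
    case True
    then obtain Q x where Q: "Q \<in> H" "x \<in> fractal (\<sigma> = fst Q)" "p = nm Q x" unfolding piece_def by blast
    define s where "s = (\<sigma> = fst Q)"
    obtain \<tau>' where "cut s \<tau>' x" and \<tau>': "\<And>i. i \<in> \<tau> \<Longrightarrow> Q = (True, ex \<sigma> i) \<Longrightarrow> i \<in> \<tau>'"
      "\<And>b R. b \<notin> \<tau>' \<Longrightarrow> sym_linked b Q R \<Longrightarrow> R \<notin> H"
      using inner[OF Q] unfolding s_def by blast
    from \<open>cut s \<tau>' x\<close> obtain A\<^sub>1 A\<^sub>2 where A0: "closed A\<^sub>1 \<and> closed A\<^sub>2 \<and> A\<^sub>1 \<union> A\<^sub>2 = fractal s \<and>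
        (\<forall>y\<in>A\<^sub>1 \<inter> A\<^sub>2. \<forall>z\<in>A\<^sub>1 \<inter> A\<^sub>2. y = z) \<and> x \<in> A\<^sub>1 \<and> x \<notin> A\<^sub>2 \<and>
        (\<forall>i\<in>\<tau>'. exit_point s i \<in> A\<^sub>1 \<longrightarrow> exit_point s i \<in> A\<^sub>2)"
      unfolding cut_def by (elim exE)
    then have A: "closed A\<^sub>1" "closed A\<^sub>2" "A\<^sub>1 \<union> A\<^sub>2 = fractal s" "x \<in> A\<^sub>1" "x \<notin> A\<^sub>2" by simp_all
    have A4: "y = z" if "y \<in> A\<^sub>1 \<inter> A\<^sub>2" "z \<in> A\<^sub>1 \<inter> A\<^sub>2" for y z using A0 that by simp
    have A7: "exit_point s i \<in> A\<^sub>2" if "i \<in> \<tau>'" "exit_point s i \<in> A\<^sub>1" for i using A0 that by simp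
    \<comment> \<open>An exit point of \<open>A\<^sub>1\<close> outside \<tau>' may be missing from
      \<open>A\<^sub>2\<close>, so the component attached there has to go along with the
      branch.\<close>
    define C where "C = \<Union>{comp R |R. R \<in> N \<sigma> \<and> (\<exists>b. b \<notin> \<tau>' \<and> exit_point s b \<in> A\<^sub>1 \<and> sym_linked b Q R)}"
    have C_E: "\<exists>R b. R \<in> N \<sigma> - H \<and> v \<in> comp R \<and> b \<notin> \<tau>' \<and> exit_point s b \<in> A\<^sub>1 \<and> sym_linked b Q R" if "v \<in> C" for v
      using that \<tau>'(2) unfolding C_def by blast
    have C_I: "R \<in> C" if "R \<in> N \<sigma>" "b \<notin> \<tau>'" "exit_point s b \<in> A\<^sub>1" "sym_linked b Q R" for R b
      using that comp_self[of R] unfolding C_def by blast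
    have C: "C \<subseteq> N \<sigma> - H" using C_E comp_sub by blast
    have QN: "Q \<in> N \<sigma>" "Q \<notin> C" using Q(1) H C by blast+
    have KQ: "piece \<sigma> Q = nm Q ` A\<^sub>1 \<union> nm Q ` A\<^sub>2" unfolding piece_def s_def[symmetric] A(3)[symmetric] by blast
    define B\<^sub>1 where "B\<^sub>1 = nm Q ` A\<^sub>1 \<union> (\<Union>u\<in>C. piece \<sigma> u)"
    define B\<^sub>2 where "B\<^sub>2 = nm Q ` A\<^sub>2 \<union> (\<Union>u\<in>N \<sigma> - C - {Q}. piece \<sigma> u)"
    \<comment> \<open>A contact at an exit point outside \<tau>' would have put w into C; at an exit
      point in \<tau>' the inner cut leaves the point in \<open>A\<^sub>2\<close>.\<close>
    have rest: "y \<in> A\<^sub>2" if yw: "y \<in> A\<^sub>1" "nm Q y \<in> piece \<sigma> w" "w \<in> N \<sigma> - C - {Q}" for y w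
    proof -
      have "nm Q y \<in> piece \<sigma> Q" using yw(1) KQ by blast
      then obtain j where j: "sym_linked j Q w" "nm Q y = nm Q (exit_point s j)"
        using contact_piece[of Q \<sigma> w "nm Q y"] yw QN unfolding s_def by blast
      then have y: "y = exit_point s j" using nm_inj by blast
      then have "j \<in> \<tau>'" using C_I[of w j] yw(1,3) j(1) by blast
      then show ?thesis using A7 yw(1) y by blast
    qed
    have common: "\<exists>y\<in>A\<^sub>1 \<inter> A\<^sub>2. z = nm Q y" if z12: "z \<in> B\<^sub>1" "z \<in> B\<^sub>2" for z
    proof (cases "z \<in> nm Q ` A\<^sub>1")
      case True
      then obtain y where y: "y \<in> A\<^sub>1" "z = nm Q y" by blast
      have "y \<in> A\<^sub>2"
      proof (cases "z \<in> nm Q ` A\<^sub>2")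
        case True
        then show ?thesis using y(2) nm_inj by blast
      next
        case False
        then show ?thesis using z12(2) rest[OF y(1)] y(2) unfolding B\<^sub>2_def by blast
      qed
      then show ?thesis using y by blast
    next
      case nA: False
      then obtain v where v: "v \<in> C" "z \<in> piece \<sigma> v" using z12(1) unfolding B\<^sub>1_def by blast
      obtain R b where R: "R \<in> N \<sigma> - H" "v \<in> comp R" "b \<notin> \<tau>'" "exit_point s b \<in> A\<^sub>1" "sym_linked b Q R"
        using C_E[OF v(1)] by blast
      have RQ: "node_adj R Q" using R(5) sym_linked_sym unfolding node_adj_def by blast
      have vN: "v \<in> N \<sigma>" using v(1) C by blast
      show ?thesis
      proof (cases "z \<in> nm Q ` A\<^sub>2")
        case True
        then obtain y where y: "y \<in> A\<^sub>2" "z = nm Q y" by blast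
        have "z \<in> piece \<sigma> Q" using True KQ by blast
        moreover have "Q \<noteq> v" using QN v by blast
        ultimately obtain j where j: "sym_linked j Q v" "z = nm Q (exit_point s j)"
          using contact_piece[of Q \<sigma> v z] QN(1) vN v(2) unfolding s_def by blast
        have "node_adj v Q" using j(1) sym_linked_sym unfolding node_adj_def by blast
        \<comment> \<open>R is the only node of its component with an edge to H, so the contact of v
          with Q is the one at the exit point b.\<close>
        then have "R = v" using one_edge[OF R(1) comp_self R(2) Q(1) Q(1) RQ] by blast
        then have "j = b" using j(1) R(5) sym_linked_unique by blast
        then have "y = exit_point s b" using j(2) y(2) nm_inj by metis
        then show ?thesis using y R(4) by blast
      next
        case False
        then obtain w where w: "w \<in> N \<sigma> - C - {Q}" "z \<in> piece \<sigma> w" using z12(2) unfolding B\<^sub>2_def by blast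
        then obtain j where j: "sym_linked j v w"
          using contact_piece[of v \<sigma> w z] v vN by blast
        have adj: "node_adj v w" using j unfolding node_adj_def by blast
        show ?thesis
        proof (cases "w \<in> H")
          case True
          then show ?thesis using one_edge[OF R(1) comp_self R(2) Q(1) True RQ adj] w(1) by blast
        next
          case False
          then have "w \<in> comp R" using comp_step[OF R(1,2) adj] w(1) by blast
          then have "w \<in> C" using R unfolding C_def by blast
          then show ?thesis using w(1) by blast
        qed
      qed
    qed
    have cl: "closed (nm Q ` A)" if "closed A" "A \<subseteq> fractal s" for A
    proof -
      have "compact A" using that compact_fractal by (metis compact_Int_closed inf.absorb2)
      then show ?thesis by (intro compact_imp_closed compact_continuous_image continuous_on_nm)
    qed
    show ?thesis
      unfolding cut_def
    proof (rule exI[of _ B\<^sub>1], rule exI[of _ B\<^sub>2], intro conjI)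
      show "closed B\<^sub>1" "closed B\<^sub>2" unfolding B\<^sub>1_def B\<^sub>2_def using C A(1-3)
        by (auto intro!: closed_UN_piece closed_Un cl)
      have "N \<sigma> = insert Q (C \<union> (N \<sigma> - C - {Q}))" using C QN by blast
      then have "fractal \<sigma> = piece \<sigma> Q \<union> (\<Union>u\<in>C. piece \<sigma> u) \<union> (\<Union>u\<in>N \<sigma> - C - {Q}. piece \<sigma> u)"
        unfolding fractal_unfold[of \<sigma>] by (metis UN_Un UN_insert sup_assoc)
      then show "B\<^sub>1 \<union> B\<^sub>2 = fractal \<sigma>" unfolding B\<^sub>1_def B\<^sub>2_def KQ by blast
      show "p \<in> B\<^sub>1" using Q(3) A(4) unfolding B\<^sub>1_def by blast
      show "p \<notin> B\<^sub>2" using common[OF \<open>p \<in> B\<^sub>1\<close>] Q(3) A(5) nm_inj by blast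
      show "\<forall>y\<in>B\<^sub>1 \<inter> B\<^sub>2. \<forall>z\<in>B\<^sub>1 \<inter> B\<^sub>2. y = z"
        using common A4 by (metis IntE)
      show "\<forall>i\<in>\<tau>. exit_point \<sigma> i \<in> B\<^sub>1 \<longrightarrow> exit_point \<sigma> i \<in> B\<^sub>2"
      proof (intro ballI impI)
        fix i assume i: "i \<in> \<tau>" "exit_point \<sigma> i \<in> B\<^sub>1"
        have "exit_point \<sigma> i \<notin> piece \<sigma> v" if "v \<in> C" for v
          using exit_point_node_piece[of v \<sigma> i] exits[OF i(1)] that C by blast
        then obtain y where y: "y \<in> A\<^sub>1" "exit_point \<sigma> i = nm Q y" using i(2) unfolding B\<^sub>1_def by blast
        have "y \<in> HH" using y(1) A(3) fractal_HH by blast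
        then have "Q = (True, ex \<sigma> i) \<and> y = exit_point \<sigma> i" using exit_point_node[OF QN(1)] y(2) by metis
        moreover from this have "s = \<sigma>" by (simp add: s_def)
        ultimately have "y \<in> A\<^sub>2" using A7[of i] \<tau>'(1)[OF i(1)] y(1) by simp
        then show "exit_point \<sigma> i \<in> B\<^sub>2" using y(2) unfolding B\<^sub>2_def by blast
      qed
    qed
  qed
qed

end

section \<open>Arcs in the fractal\<close>

text \<open>If g is in \<open>B\<^sub>1\<close> at time t, connectedness gives times s \<le> t \<le>
  s' at which g is in both sets. These have at most one point in common, so injectivity forces s =
  s' = t.\<close>

lemma arc_avoids_branch:
  fixes g :: "real \<Rightarrow> 'a::topological_space"
  assumes g: "arc g" "path_image g \<subseteq> B\<^sub>1 \<union> B\<^sub>2" and B: "closed B\<^sub>1" "closed B\<^sub>2"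
    and one: "\<And>y z. y \<in> B\<^sub>1 \<inter> B\<^sub>2 \<Longrightarrow> z \<in> B\<^sub>1 \<inter> B\<^sub>2 \<Longrightarrow> y = z"
    and ends: "pathstart g \<in> B\<^sub>2" "pathfinish g \<in> B\<^sub>2"
  shows "path_image g \<inter> B\<^sub>1 \<subseteq> B\<^sub>2"
proof
  fix p assume "p \<in> path_image g \<inter> B\<^sub>1"
  then obtain t where t: "0 \<le> t" "t \<le> 1" "p = g t" "g t \<in> B\<^sub>1" by (auto simp: path_image_def)
  have cont: "continuous_on {0..1} g" using g(1) by (simp add: arc_def path_def)
  have meet: "\<exists>s\<in>{a..b}. g s \<in> B\<^sub>1 \<inter> B\<^sub>2"
    if ab: "0 \<le> a" "b \<le> 1" "a \<le> b" "t \<in> {a..b}" "c \<in> {a..b}" "g c \<in> B\<^sub>2" for a b c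
  proof (rule ccontr)
    assume no: "\<not> ?thesis"
    have "connected (g ` {a..b})"
      using cont ab by (intro connected_continuous_image continuous_on_subset[OF cont]) auto
    moreover have "g ` {a..b} \<subseteq> B\<^sub>1 \<union> B\<^sub>2"
    proof -
      have "g ` {a..b} \<subseteq> g ` {0..1}" by (rule image_mono) (use ab in auto)
      then show ?thesis using g(2) unfolding path_image_def by blast
    qed
    moreover have "B\<^sub>1 \<inter> B\<^sub>2 \<inter> g ` {a..b} = {}" using no by blast
    moreover have "B\<^sub>1 \<inter> g ` {a..b} \<noteq> {}" "B\<^sub>2 \<inter> g ` {a..b} \<noteq> {}" using ab t(4) by blast+
    ultimately show False using B unfolding connected_closed by blast
  qed
  obtain s where s: "s \<in> {0..t}" "g s \<in> B\<^sub>1 \<inter> B\<^sub>2"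
    using meet[of 0 t 0] t ends(1) by (auto simp: pathstart_def)
  obtain s' where s': "s' \<in> {t..1}" "g s' \<in> B\<^sub>1 \<inter> B\<^sub>2"
    using meet[of t 1 1] t ends(2) by (auto simp: pathfinish_def)
  have "inj_on g {0..1}" using g(1) by (simp add: arc_def)
  then have "s = s'" using one[OF s(2) s'(2)] s(1) s'(1) t(1,2) by (auto dest: inj_onD)
  then have "s = t" using s(1) s'(1) by simp
  then show "p \<in> B\<^sub>2" using s(2) t(3) by simp
qed

section \<open>Cells of a fixed level and their contacts\<close>

lemma cells_SucI:
  "(F, s) \<in> cells m N \<sigma> n \<Longrightarrow> v \<in> N s \<Longrightarrow> (F \<circ> node_map m v, s = fst v) \<in> cells m N \<sigma> (Suc n)"
  unfolding cells.simps by blast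

lemma cells_SucE:
  assumes "(F, s) \<in> cells m N \<sigma> (Suc n)"
  obtains G t v where "(G, t) \<in> cells m N \<sigma> n" "v \<in> N t" "F = G \<circ> node_map m v" "s = (t = fst v)"
  using assms unfolding cells.simps by blast

context tri_system begin

lemma finite_cells: "finite (cel \<sigma> n)"
proof (induction n)
  case (Suc n)
  have "cel \<sigma> (Suc n) \<subseteq> (\<Union>(F, s)\<in>cel \<sigma> n. (\<lambda>v. (F \<circ> nm v, s = fst v)) ` N s)"
    unfolding cells.simps by blast
  moreover have "finite \<dots>" using Suc finite_nodes by (auto intro!: finite_UN_I)
  ultimately show ?case by (rule finite_subset)
qed simp

lemma nm_form: "\<exists>z r. \<bar>r\<bar> = 1 / real m \<and> nm v = (\<lambda>\<alpha>. z + r *\<^sub>R \<alpha>)"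
proof (intro exI conjI)
  show "\<bar>if fst v then 1 / real m else - 1 / real m\<bar> = 1 / real m" by simp
  show "nm v = (\<lambda>\<alpha>. (\<chi> i. (of_int (snd v $ i) + (if fst v then 0 else 1)) / real m) +
      (if fst v then 1 / real m else - 1 / real m) *\<^sub>R \<alpha>)"
    using m_ge_2 by (auto simp: fun_eq_iff vec_eq_iff node_map_def field_simps)
qed

lemma cells_form:
  "(F, s) \<in> cel \<sigma> n \<Longrightarrow> \<exists>z r. \<bar>r\<bar> = 1 / real m ^ n \<and> F = (\<lambda>\<alpha>. z + r *\<^sub>R \<alpha>)"
proof (induction n arbitrary: F s)
  case 0
  then show ?case by (intro exI[of _ 0] exI[of _ 1]) auto
next
  case (Suc n)
  then obtain G t v where G: "(G, t) \<in> cel \<sigma> n" "F = G \<circ> nm v" by auto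
  then obtain z r where zr: "\<bar>r\<bar> = 1 / real m ^ n" "G = (\<lambda>\<alpha>. z + r *\<^sub>R \<alpha>)" using Suc.IH by blast
  obtain z' r' where zr': "\<bar>r'\<bar> = 1 / real m" "nm v = (\<lambda>\<alpha>. z' + r' *\<^sub>R \<alpha>)" using nm_form by blast
  have "F = (\<lambda>\<alpha>. (z + r *\<^sub>R z') + (r * r') *\<^sub>R \<alpha>)"
    unfolding G(2) zr(2) zr'(2) by (auto simp: scaleR_add_right)
  moreover have "\<bar>r * r'\<bar> = 1 / real m ^ Suc n" by (simp add: abs_mult zr(1) zr'(1))
  ultimately show ?case by blast
qed

lemma cells_inj: "(F, s) \<in> cel \<sigma> n \<Longrightarrow> F x = F y \<Longrightarrow> x = y"
  using cells_form[of F s \<sigma> n] m_ge_2 by fastforce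

lemma continuous_on_cell: "(F, s) \<in> cel \<sigma> n \<Longrightarrow> continuous_on A F"
  using cells_form[of F s \<sigma> n] by (auto intro!: continuous_intros)

lemma fractal_cells: "fractal \<sigma> = (\<Union>(F, s)\<in>cel \<sigma> n. F ` fractal s)"
proof (induction n)
  case (Suc n)
  have eq: "fractal s = (\<Union>v\<in>N s. nm v ` fractal (s = fst v))" for s
    using fractal_unfold unfolding piece_def .
  show ?case
  proof
    show "fractal \<sigma> \<subseteq> (\<Union>(F, s)\<in>cel \<sigma> (Suc n). F ` fractal s)"
    proof
      fix p assume "p \<in> fractal \<sigma>"
      then obtain F s x where F: "(F, s) \<in> cel \<sigma> n" "x \<in> fractal s" "p = F x" using Suc by auto
      then obtain v y where v: "v \<in> N s" "y \<in> fractal (s = fst v)" "x = nm v y" using eq by blast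
      have "(F \<circ> nm v, s = fst v) \<in> cel \<sigma> (Suc n)" using F v by (intro cells_SucI)
      moreover have "p \<in> (F \<circ> nm v) ` fractal (s = fst v)" using F v by auto
      ultimately show "p \<in> (\<Union>(F, s)\<in>cel \<sigma> (Suc n). F ` fractal s)" by blast
    qed
    show "(\<Union>(F, s)\<in>cel \<sigma> (Suc n). F ` fractal s) \<subseteq> fractal \<sigma>"
    proof
      fix p assume "p \<in> (\<Union>(F, s)\<in>cel \<sigma> (Suc n). F ` fractal s)"
      then obtain F s v y where F: "(F, s) \<in> cel \<sigma> n" "v \<in> N s" "y \<in> fractal (s = fst v)" "p = F (nm v y)"
        by auto
      then have "nm v y \<in> fractal s" using eq by blast
      then show "p \<in> fractal \<sigma>" using Suc F by blast
    qed
  qed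
qed simp

lemma compact_cell: "(F, s) \<in> cel \<sigma> n \<Longrightarrow> compact (F ` fractal s)"
  by (intro compact_continuous_image continuous_on_cell compact_fractal)

text \<open>Cells with the same parent are covered by \<open>contact\<close>. If the parents differ,
  p is by induction an exit point of the parent; it lies in the exit child only and is the exit
  point of that child too, being its fixed point.\<close>

lemma cells_contact:
  assumes "(F, s) \<in> cel \<sigma> n" "(G, t) \<in> cel \<sigma> n" "(F, s) \<noteq> (G, t)" "p \<in> F ` fractal s" "p \<in> G ` fractal t"
  shows "\<exists>j. p = F (exit_point s j)"
  using assms
proof (induction n arbitrary: F s G t)
  case (Suc n)
  obtain F' s' v where F: "(F', s') \<in> cel \<sigma> n" "v \<in> N s'" "F = F' \<circ> nm v" "s = (s' = fst v)"
    using Suc.prems(1) by (rule cells_SucE)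
  obtain G' t' w where G: "(G', t') \<in> cel \<sigma> n" "w \<in> N t'" "G = G' \<circ> nm w" "t = (t' = fst w)"
    using Suc.prems(2) by (rule cells_SucE)
  obtain x y where x: "x \<in> fractal s" "p = F' (nm v x)" and y: "y \<in> fractal t" "p = G' (nm w y)"
    using Suc.prems(4,5) F(3) G(3) by auto
  show ?case
  proof (cases "(F', s') = (G', t')")
    case True
    then have "v \<noteq> w" using Suc.prems(3) F G by auto
    moreover have "nm v x = nm w y" using x(2) y(2) True cells_inj[OF F(1)] by auto
    ultimately obtain j where "x = exit_point s j"
      using contact[of v s' w x y] F G x y True by auto
    then show ?thesis using x F(3) by auto
  next
    case False
    have "nm v x \<in> fractal s'" "nm w y \<in> fractal t'"
      using x(1) y(1) F(2,4) G(2,4) fractal_unfold unfolding piece_def by blast+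
    then obtain j where "p = F' (exit_point s' j)"
      using Suc.IH[OF F(1) G(1) False] x y by blast
    then have "nm v x = exit_point s' j" using x(2) cells_inj[OF F(1)] by auto
    then have "v = (True, ex s' j) \<and> x = exit_point s' j" using exit_point_node[OF F(2)] x(1) fractal_HH by blast
    then show ?thesis using x(2) F(3,4) by auto
  qed
qed simp

end

section \<open>Two unblocked types: cuts off the lines through the exit at c\<close>

text \<open>
  \<open>Sp y \<sigma>\<close> is the path between the exits other than \<open>y\<close>; it lies in one strip of type \<open>y\<close>.
\<close>

locale hub_system = tri_system +
  fixes a b c :: 3 and Sp :: "3 \<Rightarrow> bool \<Rightarrow> node set"
  assumes abc: "a \<noteq> b" "a \<noteq> c" "b \<noteq> c"
    and Sp_sub: "y \<in> {a, b} \<Longrightarrow> Sp y \<sigma> \<subseteq> N \<sigma>"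
    and Sp_connected: "y \<in> {a, b} \<Longrightarrow> u \<in> Sp y \<sigma> \<Longrightarrow> v \<in> Sp y \<sigma> \<Longrightarrow> (restricted node_adj (Sp y \<sigma>))\<^sup>*\<^sup>* u v"
    and Sp_coord: "y \<in> {a, b} \<Longrightarrow> v \<in> Sp y \<sigma> \<Longrightarrow> snd v $ y = ex \<sigma> c $ y"
    and Sp_exit: "y \<in> {a, b} \<Longrightarrow> i \<noteq> y \<Longrightarrow> (True, ex \<sigma> i) \<in> Sp y \<sigma>"
begin

text \<open>A child in the strip carries its own line at coordinate y into the line of its parent
  and shrinks distances to it by m. In a down child the coordinate is reversed and the state flips,
  and \<open>exit_point_opposite\<close> makes the two effects cancel.\<close>

lemma hub_scale:
  assumes "snd v $ y = ex \<sigma> c $ y" "y \<noteq> c"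
  shows "real m * \<bar>nm v x $ y - exit_point \<sigma> c $ y\<bar> = \<bar>x $ y - exit_point (\<sigma> = fst v) c $ y\<bar>"
proof -
  have "real m * (nm v x $ y - exit_point \<sigma> c $ y) = (if fst v then x $ y else 1 - x $ y) - exit_point \<sigma> c $ y"
    using nm_nth[of v x y] exit_point_nth[of \<sigma> c y] assms(1) by (simp add: right_diff_distrib)
  also have "\<bar>\<dots>\<bar> = \<bar>x $ y - exit_point (\<sigma> = fst v) c $ y\<bar>"
    using exit_point_opposite[OF assms(2), of \<sigma>] by (cases "fst v") auto
  finally show ?thesis by (simp add: abs_mult)
qed

lemma hub_scale_less:
  assumes "snd v $ y = ex \<sigma> c $ y" "y \<noteq> c" "1 / real m ^ Suc n < \<bar>nm v x $ y - exit_point \<sigma> c $ y\<bar>"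
  shows "1 / real m ^ n < \<bar>x $ y - exit_point (\<sigma> = fst v) c $ y\<bar>"
  using assms(3) m_ge_2 unfolding hub_scale[OF assms(1,2), symmetric] by (simp add: field_simps)

text \<open>Makes the case n = 0 of the following inductions vacuous, as coordinates in [0, 1]
  differ by at most 1.\<close>

lemma fractal_hub_dist: "p \<in> fractal \<sigma> \<Longrightarrow> \<not> 1 / real m ^ 0 < \<bar>p $ y - exit_point \<sigma> c $ y\<bar>"
  using fractal_HH[of \<sigma>] HH_bounds[of p y] HH_bounds[OF exit_point_HH, of \<sigma> c y] by (auto simp: abs_le_iff not_less)

lemma sym_linked_coord: "sym_linked y u v \<Longrightarrow> snd u $ i = snd v $ i \<longleftrightarrow> i \<noteq> y"
  by (auto simp: sym_linked_def linked_def split: if_splits)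

text \<open>A neighbour across side y changes the coordinate y and thus leaves the strip. So no
  triangle of the path is attached at the exit point of side y, and it does not matter on which side
  of the cut that point ends up; hence \<tau> omits y at every level.\<close>

lemma straight_cut:
  assumes y: "y \<in> {a, b}" and "p \<in> fractal \<sigma>" "1 / real m ^ n < \<bar>p $ y - exit_point \<sigma> c $ y\<bar>"
  shows "cut \<sigma> (- {y}) p"
  using assms(2,3)
proof (induction n arbitrary: \<sigma> p)
  case 0
  then show ?case using fractal_hub_dist by blast
next
  case (Suc n)
  have yc: "y \<noteq> c" using y abc by auto
  show ?case
  proof (rule cut_step[OF Sp_sub[OF y] Sp_connected[OF y] Sp_exit[OF y]])
    fix Q x assume Q: "Q \<in> Sp y \<sigma>" "x \<in> fractal (\<sigma> = fst Q)" "p = nm Q x"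
    note Qy = Sp_coord[OF y Q(1)]
    have "cut (\<sigma> = fst Q) (- {y}) x"
      using Suc.IH[OF Q(2)] hub_scale_less[OF Qy yc] Suc.prems(2) Q(3) by blast
    moreover have "R \<notin> Sp y \<sigma>" if "sym_linked y Q R" for R
      using sym_linked_coord[OF that, of y] Sp_coord[OF y, of R] Qy by auto
    ultimately show "\<exists>\<tau>'. cut (\<sigma> = fst Q) \<tau>' x \<and> (\<forall>i\<in>- {y}. Q = (True, ex \<sigma> i) \<longrightarrow> i \<in> \<tau>') \<and>
        (\<forall>b R. b \<notin> \<tau>' \<longrightarrow> sym_linked b Q R \<longrightarrow> R \<notin> Sp y \<sigma>)"
      by (intro exI[of _ "- {y}"]) auto
  qed (use Suc.prems in auto)
qed

text \<open>The two paths together contain all exits. Both lines continue in the exit triangle at c,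
  where the induction hypothesis applies. In any other triangle Q of the path of type y the weaker
  \<open>straight_cut\<close> is enough, because the neighbour of Q across side y is on neither
  path.\<close>

lemma full_cut:
  assumes "p \<in> fractal \<sigma>" "1 / real m ^ n < \<bar>p $ a - exit_point \<sigma> c $ a\<bar>" "1 / real m ^ n < \<bar>p $ b - exit_point \<sigma> c $ b\<bar>"
  shows "cut \<sigma> UNIV p"
  using assms
proof (induction n arbitrary: \<sigma> p)
  case 0
  then show ?case using fractal_hub_dist by blast
next
  case (Suc n)
  define H where "H = Sp a \<sigma> \<union> Sp b \<sigma>"
  have ab: "a \<in> {a, b}" "b \<in> {a, b}" by auto
  have hub_in: "(True, ex \<sigma> c) \<in> Sp y \<sigma>" if "y \<in> {a, b}" for y
    using Sp_exit[OF that, of c \<sigma>] that abc by auto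
  have to_hub: "(restricted node_adj H)\<^sup>*\<^sup>* u (True, ex \<sigma> c)" if "u \<in> H" for u
  proof -
    have "(restricted node_adj (Sp a \<sigma>))\<^sup>*\<^sup>* u (True, ex \<sigma> c) \<or> (restricted node_adj (Sp b \<sigma>))\<^sup>*\<^sup>* u (True, ex \<sigma> c)"
      using that Sp_connected hub_in ab unfolding H_def by blast
    then show ?thesis using restricted_rtranclp_mono unfolding H_def by (metis sup_ge1 sup_ge2)
  qed
  show ?case
  proof (rule cut_step[of H])
    show "H \<subseteq> N \<sigma>" using Sp_sub ab unfolding H_def by blast
    show "(restricted node_adj H)\<^sup>*\<^sup>* u v" if "u \<in> H" "v \<in> H" for u v
      using to_hub[OF that(1)] restricted_rtranclp_sym[OF symp_node_adj to_hub[OF that(2)]] by (rule rtranclp_trans)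
    show "(True, ex \<sigma> i) \<in> H" for i
      using Sp_exit[OF ab(1), of i \<sigma>] Sp_exit[OF ab(2), of i \<sigma>] abc unfolding H_def by blast
    show "p \<in> fractal \<sigma>" by (rule Suc.prems)
    fix Q x assume Q: "Q \<in> H" "x \<in> fractal (\<sigma> = fst Q)" "p = nm Q x"
    show "\<exists>\<tau>'. cut (\<sigma> = fst Q) \<tau>' x \<and> (\<forall>i\<in>UNIV. Q = (True, ex \<sigma> i) \<longrightarrow> i \<in> \<tau>') \<and>
        (\<forall>b R. b \<notin> \<tau>' \<longrightarrow> sym_linked b Q R \<longrightarrow> R \<notin> H)"
    proof (cases "Q = (True, ex \<sigma> c)")
      case True
      then have "snd Q $ y = ex \<sigma> c $ y" for y by simp
      then have "cut (\<sigma> = fst Q) UNIV x"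
        using Suc.IH[OF Q(2)] hub_scale_less abc Suc.prems(2,3) Q(3) by blast
      then show ?thesis by blast
    next
      case False
      obtain y z where yz: "y \<in> {a, b}" "z \<in> {a, b}" "y \<noteq> z" "H = Sp y \<sigma> \<union> Sp z \<sigma>" "Q \<in> Sp y \<sigma>"
        using Q(1) abc unfolding H_def by blast
      have c: "y \<noteq> c" "z \<noteq> c" using yz abc by auto
      have QN: "Q \<in> N \<sigma>" using Sp_sub yz by blast
      note Qy = Sp_coord[OF yz(1,5)]
      have "1 / real m ^ Suc n < \<bar>p $ y - exit_point \<sigma> c $ y\<bar>" using yz(1) Suc.prems by auto
      then have cut: "cut (\<sigma> = fst Q) (- {y}) x"
        using straight_cut[OF yz(1) Q(2)] hub_scale_less[OF Qy c(1)] Q(3) by blast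
      \<comment> \<open>The exit at y has coordinate y equal to 0, whereas every triangle of this
        path shares the positive coordinate y of the exit at c.\<close>
      have "i \<noteq> y" if "Q = (True, ex \<sigma> i)" for i
        using Qy that exit_zero[of \<sigma> y] exit_pos[OF c(1), of \<sigma>] by auto
      \<comment> \<open>A y-neighbour has the same coordinate z. If R were on the other path, Q
        would lie in both strips and, by its coordinate sum, would be the exit triangle at
        c.\<close>
      moreover have "R \<notin> H" if R: "sym_linked y Q R" for R
      proof
        assume "R \<in> H"
        moreover have "R \<notin> Sp y \<sigma>" using sym_linked_coord[OF R, of y] Sp_coord[OF yz(1), of R] Qy by auto
        ultimately have "snd R $ z = ex \<sigma> c $ z" using yz Sp_coord[OF yz(2), of R] by auto
        then have Qz: "snd Q $ z = ex \<sigma> c $ z" using sym_linked_coord[OF R, of z] yz(3) by auto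
        have sums: "snd Q $ y + snd Q $ z + snd Q $ c = (if fst Q then int m - 1 else int m - 2)"
          "ex \<sigma> c $ y + ex \<sigma> c $ z + ex \<sigma> c $ c = int m - 1"
          using nodes_sum(2)[OF QN] exit_idx[of \<sigma> c] sum_distinct_3[OF yz(3) c, of "snd Q"]
            sum_distinct_3[OF yz(3) c, of "ex \<sigma> c"] by (auto simp: idx_iff)
        then have "fst Q" "snd Q $ c = ex \<sigma> c $ c"
          using Qy Qz exit_zero[of \<sigma> c] nodes_sum(1)[OF QN, of c] by (auto split: if_splits)
        then have "snd Q $ i = ex \<sigma> c $ i" for i
          using Qy Qz distinct_3_cases[OF yz(3) c, of i] by auto
        then have "snd Q = ex \<sigma> c" by (simp add: vec_eq_iff)
        then have "Q = (True, ex \<sigma> c)" using \<open>fst Q\<close> by (simp add: prod_eq_iff)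
        then show False using False by blast
      qed
      ultimately show ?thesis using cut by (intro exI[of _ "- {y}"]) auto
    qed
  qed
qed

lemma cut_off_hub_lines:
  assumes "p \<in> fractal \<sigma>" "p $ a \<noteq> exit_point \<sigma> c $ a" "p $ b \<noteq> exit_point \<sigma> c $ b"
  shows "cut \<sigma> UNIV p"
proof -
  have ev: "\<forall>\<^sub>F n in sequentially. 1 / real m ^ n < d" if "0 < d" for d
    using order_tendstoD(2)[OF tendsto_m_power that] .
  have "\<forall>\<^sub>F n in sequentially. 1 / real m ^ n < \<bar>p $ a - exit_point \<sigma> c $ a\<bar> \<and> 1 / real m ^ n < \<bar>p $ b - exit_point \<sigma> c $ b\<bar>"
    using assms by (intro eventually_conj ev) auto
  then obtain n where "1 / real m ^ n < \<bar>p $ a - exit_point \<sigma> c $ a\<bar>" "1 / real m ^ n < \<bar>p $ b - exit_point \<sigma> c $ b\<bar>"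
    by (metis (no_types, lifting) eventually_sequentially order_refl)
  then show ?thesis using full_cut assms(1) by blast
qed

text \<open>All other cells are joined to the side \<open>A\<^sub>2\<close> of the cut. They meet
  the cell F only in its exit points, and the cut for \<open>UNIV\<close> keeps these on that side,
  so the branch still hangs on the rest in at most one point.\<close>

lemma arc_in_cell:
  assumes g: "arc g" "path_image g \<subseteq> fractal \<sigma>"
    and F: "(F, s) \<in> cel \<sigma> n"
    and ends: "C\<^sub>1 \<in> cel \<sigma> n" "C\<^sub>1 \<noteq> (F, s)" "pathstart g \<in> fst C\<^sub>1 ` fractal (snd C\<^sub>1)"
      "C\<^sub>2 \<in> cel \<sigma> n" "C\<^sub>2 \<noteq> (F, s)" "pathfinish g \<in> fst C\<^sub>2 ` fractal (snd C\<^sub>2)"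
    and x: "x \<in> fractal s" "F x \<in> path_image g"
  shows "x $ a = exit_point s c $ a \<or> x $ b = exit_point s c $ b"
proof (rule ccontr)
  assume "\<not> ?thesis"
  then have "cut s UNIV x" using cut_off_hub_lines x(1) by blast
  then obtain A\<^sub>1 A\<^sub>2 where A0: "closed A\<^sub>1 \<and> closed A\<^sub>2 \<and> A\<^sub>1 \<union> A\<^sub>2 = fractal s \<and>
      (\<forall>y\<in>A\<^sub>1 \<inter> A\<^sub>2. \<forall>z\<in>A\<^sub>1 \<inter> A\<^sub>2. y = z) \<and> x \<in> A\<^sub>1 \<and> x \<notin> A\<^sub>2 \<and>
      (\<forall>i\<in>UNIV. exit_point s i \<in> A\<^sub>1 \<longrightarrow> exit_point s i \<in> A\<^sub>2)"
    unfolding cut_def by (elim exE)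
  define B\<^sub>1 where "B\<^sub>1 = F ` A\<^sub>1"
  define B\<^sub>2 where "B\<^sub>2 = F ` A\<^sub>2 \<union> (\<Union>(G, t)\<in>cel \<sigma> n - {(F, s)}. G ` fractal t)"
  have cl: "closed (F ` A)" if "closed A" "A \<subseteq> fractal s" for A
  proof -
    have "compact A" using that compact_fractal by (metis compact_Int_closed inf.absorb2)
    then show ?thesis using F by (intro compact_imp_closed compact_continuous_image continuous_on_cell)
  qed
  have common: "\<exists>y\<in>A\<^sub>1 \<inter> A\<^sub>2. z = F y" if z: "z \<in> B\<^sub>1" "z \<in> B\<^sub>2" for z
  proof -
    obtain y where y: "y \<in> A\<^sub>1" "z = F y" using z(1) unfolding B\<^sub>1_def by blast
    have "y \<in> A\<^sub>2"
    proof (cases "z \<in> F ` A\<^sub>2")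
      case True
      then show ?thesis using y(2) cells_inj[OF F] by blast
    next
      case False
      then obtain G t where G: "(G, t) \<in> cel \<sigma> n" "(F, s) \<noteq> (G, t)" "z \<in> G ` fractal t"
        using z(2) unfolding B\<^sub>2_def by blast
      moreover have "z \<in> F ` fractal s" using y A0 by blast
      ultimately obtain j where "z = F (exit_point s j)" using cells_contact[OF F] by blast
      then have "y = exit_point s j" using y(2) cells_inj[OF F] by blast
      then show ?thesis using A0 y(1) by simp
    qed
    then show ?thesis using y by blast
  qed
  have "path_image g \<inter> B\<^sub>1 \<subseteq> B\<^sub>2"
  proof (rule arc_avoids_branch[OF g(1)])
    show "path_image g \<subseteq> B\<^sub>1 \<union> B\<^sub>2"
    proof
      fix z assume "z \<in> path_image g"
      then obtain G t where G: "(G, t) \<in> cel \<sigma> n" "z \<in> G ` fractal t"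
        using g(2) fractal_cells[of \<sigma> n] by blast
      have "F ` fractal s = F ` A\<^sub>1 \<union> F ` A\<^sub>2" using A0 by blast
      then show "z \<in> B\<^sub>1 \<union> B\<^sub>2"
        using G unfolding B\<^sub>1_def B\<^sub>2_def by (cases "(G, t) = (F, s)") blast+
    qed
    show "closed B\<^sub>1" unfolding B\<^sub>1_def using A0 by (intro cl) auto
    show "closed B\<^sub>2" unfolding B\<^sub>2_def using A0 finite_cells compact_cell
      by (intro closed_Un cl closed_UN) (auto intro: compact_imp_closed)
    show "y = z" if yz: "y \<in> B\<^sub>1 \<inter> B\<^sub>2" "z \<in> B\<^sub>1 \<inter> B\<^sub>2" for y z
      using common[of y] common[of z] yz A0 by (metis IntE)
    show "pathstart g \<in> B\<^sub>2" "pathfinish g \<in> B\<^sub>2"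
      using ends unfolding B\<^sub>2_def case_prod_unfold by blast+
  qed
  then have "F x \<in> B\<^sub>2" using x(2) A0 unfolding B\<^sub>1_def by blast
  moreover have "F x \<in> B\<^sub>1" using A0 unfolding B\<^sub>1_def by blast
  ultimately obtain y where "y \<in> A\<^sub>2" "F x = F y" using common by blast
  then show False using cells_inj[OF F] A0 by blast
qed

end

section \<open>Length and tangents of arcs\<close>

definition from_bary :: "real^3 \<Rightarrow> point" where
  "from_bary \<alpha> = (\<Sum>i\<in>UNIV. \<alpha> $ i *\<^sub>R PP $ i)"

text \<open>The affine inverse of \<open>from_bary\<close> on the plane of coordinate sum 1. Unlike
  \<open>bary\<close> it is given by a formula on all of \<open>point\<close>, so an arc can be
  moved to barycentric coordinates without leaving the continuous maps.\<close>

definition to_bary :: "point \<Rightarrow> real^3" where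
  "to_bary x = (let \<gamma> = 2 / sqrt 3 * x $ 2; \<beta> = x $ 1 - \<gamma> / 2 in vector [1 - \<beta> - \<gamma>, \<beta>, \<gamma>])"

lemma PP_nth: "PP $ 1 = vector [0, 0]" "PP $ 2 = vector [1, 0]" "PP $ 3 = vector [1/2, sqrt 3 / 2]"
  by (simp_all add: PP_def)

lemma from_bary_nth: "from_bary \<alpha> $ 1 = \<alpha> $ 2 + \<alpha> $ 3 / 2" "from_bary \<alpha> $ 2 = \<alpha> $ 3 * (sqrt 3 / 2)"
  by (simp_all add: from_bary_def sum_3 PP_nth)

lemma from_to_bary: "from_bary (to_bary x) = x"
  by (simp add: vec_eq_iff forall_2 from_bary_nth to_bary_def Let_def)

lemma to_from_bary: "\<alpha> $ 1 + \<alpha> $ 2 + \<alpha> $ 3 = 1 \<Longrightarrow> to_bary (from_bary \<alpha>) = \<alpha>"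
  by (simp add: vec_eq_iff forall_3 from_bary_nth to_bary_def Let_def)

lemma linear_from_bary: "linear from_bary"
  unfolding from_bary_def
  by (rule linearI) (simp_all add: scaleR_left_distrib sum.distrib scaleR_right.sum)

lemma continuous_on_to_bary: "continuous_on A to_bary"
proof -
  have "continuous_on A (\<lambda>x. to_bary x $ i)" for i
    using exhaust_3[of i]
    by (elim disjE; simp add: to_bary_def Let_def; intro continuous_intros; simp)
  then show ?thesis by (rule continuous_on_vec_lambda[of A "\<lambda>i x. to_bary x $ i", simplified])
qed

lemma norm_PP_diff: "i \<noteq> j \<Longrightarrow> norm (PP $ i - PP $ j) = 1"
  using exhaust_3[of i] exhaust_3[of j]
  by (auto simp: norm_eq_sqrt_inner inner_vec_def sum_2 PP_nth field_simps)

text \<open>The vertices have norm at most 1 and there are three coordinates; this is the origin of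
  the factor 3 in the diameter bounds of cells.\<close>

lemma norm_from_bary_le:
  assumes "\<And>i. \<bar>\<alpha> $ i\<bar> \<le> d"
  shows "norm (from_bary \<alpha>) \<le> 3 * d"
proof -
  have "norm (PP $ i) \<le> 1" for i
    using exhaust_3[of i]
    by (auto simp: norm_eq_sqrt_inner inner_vec_def sum_2 PP_nth field_simps)
  then have "\<bar>\<alpha> $ i\<bar> * norm (PP $ i) \<le> d * 1" for i
    using assms[of i] by (intro mult_mono) auto
  then have "norm (\<alpha> $ i *\<^sub>R PP $ i) \<le> d" for i by simp
  then have "norm (from_bary \<alpha>) \<le> (\<Sum>i\<in>(UNIV :: 3 set). d)"
    unfolding from_bary_def by (intro sum_norm_le) auto
  then show ?thesis by simp
qed

lemma line_angle_parallel:
  assumes "v \<noteq> 0" "t \<noteq> 0"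
  shows "line_angle v (t *\<^sub>R v) = 0"
proof -
  have "v \<bullet> v = norm v * norm v" by (simp add: dot_square_norm power2_eq_square)
  then show ?thesis using assms by (simp add: line_angle_def abs_mult)
qed

context tri_system begin

abbreviation cell_set :: "(real^3 \<Rightarrow> real^3) \<times> bool \<Rightarrow> (real^3) set" where
  "cell_set C \<equiv> fst C ` fractal (snd C)"

definition children :: "(real^3 \<Rightarrow> real^3) \<times> bool \<Rightarrow> ((real^3 \<Rightarrow> real^3) \<times> bool) set" where
  "children C = (\<lambda>v. (fst C \<circ> nm v, snd C = fst v)) ` N (snd C)"

lemma children_cells: "C \<in> cel \<sigma> n \<Longrightarrow> D \<in> children C \<Longrightarrow> D \<in> cel \<sigma> (Suc n)"
  unfolding children_def by (cases C) (auto simp del: cells.simps intro: cells_SucI)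

lemma finite_children: "finite (children C)"
  by (simp add: children_def finite_nodes)

definition max_children :: nat where
  "max_children = card (N True) + card (N False)"

lemma card_children: "card (children C) \<le> max_children"
proof -
  have "card (children C) \<le> card (N (snd C))"
    unfolding children_def by (rule card_image_le[OF finite_nodes])
  then show ?thesis by (cases "snd C") (auto simp: max_children_def)
qed

lemma cell_set_children:
  assumes "p \<in> cell_set C"
  shows "\<exists>D\<in>children C. p \<in> cell_set D"
proof -
  obtain x where x: "x \<in> fractal (snd C)" "p = fst C x" using assms by blast
  then obtain v y where "v \<in> N (snd C)" "y \<in> fractal (snd C = fst v)" "x = nm v y"
    using fractal_unfold unfolding piece_def by blast
  then show ?thesis using x(2) unfolding children_def by force
qed

lemma cell_chain:
  assumes "p \<in> fractal \<sigma>"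
  obtains f where "\<And>n. f n \<in> cel \<sigma> n" "\<And>n. p \<in> cell_set (f n)" "\<And>n. f (Suc n) \<in> children (f n)"
proof -
  have "\<exists>f. \<forall>n. (f n \<in> cel \<sigma> n \<and> p \<in> cell_set (f n)) \<and> f (Suc n) \<in> children (f n)"
  proof (rule dependent_nat_choice)
    show "\<exists>C. C \<in> cel \<sigma> 0 \<and> p \<in> cell_set C" using assms by simp
  next
    fix C n assume C: "C \<in> cel \<sigma> n \<and> p \<in> cell_set C"
    then obtain D where "D \<in> children C" "p \<in> cell_set D" using cell_set_children by blast
    then show "\<exists>D. (D \<in> cel \<sigma> (Suc n) \<and> p \<in> cell_set D) \<and> D \<in> children C"
      using C children_cells by blast
  qed
  then show ?thesis using that by blast
qed

lemma cell_diff: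
  assumes "(F, s) \<in> cel \<sigma> n"
  obtains r where "\<bar>r\<bar> = 1 / real m ^ n" "\<And>x y. F x - F y = r *\<^sub>R (x - y)"
proof -
  obtain z r where "\<bar>r\<bar> = 1 / real m ^ n" "F = (\<lambda>\<alpha>. z + r *\<^sub>R \<alpha>)" using cells_form[OF assms] by blast
  then show ?thesis using that[of r] by (simp add: scaleR_diff_right)
qed

lemma cell_coord_diff:
  assumes "(F, s) \<in> cel \<sigma> n" "x \<in> HH" "y \<in> HH"
  shows "\<bar>(F x - F y) $ i\<bar> \<le> 1 / real m ^ n"
proof -
  obtain r where r: "\<bar>r\<bar> = 1 / real m ^ n" "\<And>x y. F x - F y = r *\<^sub>R (x - y)" using cell_diff[OF assms(1)] by blast
  have "\<bar>x $ i - y $ i\<bar> \<le> 1" using HH_bounds[OF assms(2), of i] HH_bounds[OF assms(3), of i] by (simp add: abs_le_iff)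
  then have "\<bar>r\<bar> * \<bar>x $ i - y $ i\<bar> \<le> \<bar>r\<bar> * 1" by (intro mult_left_mono) auto
  then show ?thesis using r by (simp add: abs_mult)
qed

lemma dist_from_bary_cell:
  assumes "(F, s) \<in> cel \<sigma> n" "x \<in> HH" "y \<in> HH"
  shows "dist (from_bary (F x)) (from_bary (F y)) \<le> 3 * (1 / real m ^ n)"
  unfolding dist_norm linear_diff[OF linear_from_bary, symmetric]
  by (rule norm_from_bary_le) (rule cell_coord_diff[OF assms])

lemma premeasure_cell:
  assumes "(F, s) \<in> cel \<sigma> n" "3 * (1 / real m ^ n) \<le> \<delta>" "0 < \<delta>"
  shows "hausdorff_premeasure 1 \<delta> (from_bary ` F ` fractal s) \<le> ennreal (3 * (1 / real m ^ n))"
proof -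
  let ?A = "from_bary ` F ` fractal s"
  have le: "dist x y \<le> 3 * (1 / real m ^ n)" if "x \<in> ?A" "y \<in> ?A" for x y
    using that dist_from_bary_cell[OF assms(1)] fractal_HH by blast
  have d: "diameter ?A \<le> 3 * (1 / real m ^ n)"
    by (rule diameter_le) (use le in \<open>auto simp: dist_norm\<close>)
  have "bounded ?A" using le unfolding bounded_two_points by blast
  then have "hausdorff_premeasure 1 \<delta> ?A \<le> ennreal (diameter ?A)"
    by (rule hausdorff_premeasure_le_diameter) (use d assms in auto)
  also have "\<dots> \<le> ennreal (3 * (1 / real m ^ n))" using d by (rule ennreal_leI)
  finally show ?thesis .
qed

text \<open>With coordinate y fixed the other two coordinates change by opposite amounts, so the
  point moves parallel to the side between \<open>PP $ w\<close> and \<open>PP $ c\<close>. This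
  direction is the same for all cells.\<close>

lemma from_bary_line_diff:
  assumes F: "(F, s) \<in> cel \<sigma> n" and ywc: "y \<noteq> w" "y \<noteq> c" "w \<noteq> c"
    and x: "x \<in> HH" "x' \<in> HH" "x $ y = x' $ y"
  obtains r where "\<bar>r\<bar> = 1 / real m ^ n"
    "from_bary (F x') - from_bary (F x) = (r * (x' $ w - x $ w)) *\<^sub>R (PP $ w - PP $ c)"
proof -
  obtain r where r: "\<bar>r\<bar> = 1 / real m ^ n" "\<And>x y. F x - F y = r *\<^sub>R (x - y)" using cell_diff[OF F] by blast
  have s: "x $ y + x $ w + x $ c = 1" "x' $ y + x' $ w + x' $ c = 1"
    using x(1,2) sum_distinct_3[OF ywc, of x] sum_distinct_3[OF ywc, of x'] by (auto simp: HH_iff)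
  have U: "UNIV = {y, w, c}" using distinct_3_cases[OF ywc] by blast
  have "from_bary (x' - x) = (x' $ w - x $ w) *\<^sub>R PP $ w + (x' $ c - x $ c) *\<^sub>R PP $ c"
    unfolding from_bary_def U using ywc x(3) by simp
  also have "x' $ c - x $ c = - (x' $ w - x $ w)" using s x(3) by linarith
  finally have "from_bary (x' - x) = (x' $ w - x $ w) *\<^sub>R (PP $ w - PP $ c)"
    by (simp only: scaleR_minus_left scaleR_diff_right) simp
  then have "from_bary (F x') - from_bary (F x) = (r * (x' $ w - x $ w)) *\<^sub>R (PP $ w - PP $ c)"
    unfolding linear_diff[OF linear_from_bary, symmetric] r(2) linear_scale[OF linear_from_bary] by simp
  then show ?thesis using that r(1) by blast
qed

lemma premeasure_line:
  assumes F: "(F, s) \<in> cel \<sigma> n" and ywc: "y \<noteq> w" "y \<noteq> c" "w \<noteq> c" and "0 < \<delta>"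
  shows "hausdorff_premeasure 1 \<delta> (from_bary ` F ` {x \<in> fractal s. x $ y = \<kappa>}) \<le> ennreal (4 * (1 / real m ^ n))"
proof (cases "{x \<in> fractal s. x $ y = \<kappa>} = {}")
  case True
  then show ?thesis unfolding True using assms(5) by simp
next
  case False
  then obtain x where x: "x \<in> fractal s" "x $ y = \<kappa>" by blast
  define u where "u = (1 / real m ^ n) *\<^sub>R (PP $ w - PP $ c)"
  have "from_bary ` F ` {x \<in> fractal s. x $ y = \<kappa>} \<subseteq> (\<lambda>t. from_bary (F x) + t *\<^sub>R u) ` {-1..1}"
  proof clarify
    fix x' assume x': "x' \<in> fractal s" "\<kappa> = x' $ y"
    have H: "x \<in> HH" "x' \<in> HH" using x x' fractal_HH by blast+
    obtain r where r: "\<bar>r\<bar> = 1 / real m ^ n"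
      "from_bary (F x') - from_bary (F x) = (r * (x' $ w - x $ w)) *\<^sub>R (PP $ w - PP $ c)"
      using from_bary_line_diff[OF F ywc H] x x' by metis
    \<comment> \<open>The factor \<open>real m ^ n * r\<close> is only a sign, so t is bounded by 1
      like the difference of two coordinates in the simplex.\<close>
    define t where "t = real m ^ n * r * (x' $ w - x $ w)"
    have "\<bar>real m ^ n * r\<bar> = 1" using r(1) m_ge_2 by (simp add: abs_mult)
    then have "\<bar>t\<bar> = \<bar>x' $ w - x $ w\<bar>" by (simp add: t_def abs_mult)
    also have "\<dots> \<le> 1" using HH_bounds[OF H(1), of w] HH_bounds[OF H(2), of w] by (simp add: abs_le_iff)
    finally have "t \<in> {-1..1}" by auto
    moreover have "from_bary (F x') = from_bary (F x) + t *\<^sub>R u"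
      using r(2) m_ge_2 by (simp add: t_def u_def algebra_simps)
    ultimately show "from_bary (F x') \<in> (\<lambda>t. from_bary (F x) + t *\<^sub>R u) ` {-1..1}" by blast
  qed
  then have "hausdorff_premeasure 1 \<delta> (from_bary ` F ` {x \<in> fractal s. x $ y = \<kappa>}) \<le>
      hausdorff_premeasure 1 \<delta> ((\<lambda>t. from_bary (F x) + t *\<^sub>R u) ` {-1..1})"
    by (rule hausdorff_premeasure_mono)
  also have "\<dots> \<le> ennreal (4 * norm u)" by (rule hausdorff_premeasure_segment[OF assms(5)])
  also have "4 * norm u = 4 * (1 / real m ^ n)" using norm_PP_diff[OF ywc(3)] by (simp add: u_def)
  finally show ?thesis .
qed

end

section \<open>Finite length and tangents of a single arc\<close>

context hub_system begin

definition hub_lines :: "(real^3 \<Rightarrow> real^3) \<times> bool \<Rightarrow> (real^3) set" where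
  "hub_lines C = fst C ` {x \<in> fractal (snd C). x $ a = exit_point (snd C) c $ a \<or> x $ b = exit_point (snd C) c $ b}"

lemma premeasure_hub_lines:
  assumes "C \<in> cel \<sigma> n" "0 < \<delta>"
  shows "hausdorff_premeasure 1 \<delta> (from_bary ` hub_lines C) \<le> ennreal (8 * (1 / real m ^ n))"
proof -
  obtain F s where C: "C = (F, s)" by (cases C)
  let ?L = "\<lambda>y. from_bary ` F ` {x \<in> fractal s. x $ y = exit_point s c $ y}"
  have eq: "from_bary ` hub_lines C = ?L a \<union> ?L b" by (auto simp: hub_lines_def C)
  have "hausdorff_premeasure 1 \<delta> (from_bary ` hub_lines C) \<le>
      hausdorff_premeasure 1 \<delta> (?L a) + hausdorff_premeasure 1 \<delta> (?L b)"
    unfolding eq by (rule hausdorff_premeasure_Un)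
  also have "\<dots> \<le> ennreal (4 * (1 / real m ^ n)) + ennreal (4 * (1 / real m ^ n))"
    using premeasure_line[of F s \<sigma> n a b c \<delta>] premeasure_line[of F s \<sigma> n b a c \<delta>] abc assms C
    by (intro add_mono) auto
  also have "\<dots> = ennreal (8 * (1 / real m ^ n))" by (subst ennreal_plus[symmetric]) auto
  finally show ?thesis .
qed

context
  fixes h :: "real \<Rightarrow> point" and \<sigma> :: bool
  assumes h: "arc h" "path_image h \<subseteq> from_bary ` fractal \<sigma>"
begin

definition bary_arc :: "real \<Rightarrow> real^3" where
  "bary_arc = to_bary \<circ> h"

lemma from_bary_arc: "from_bary ` path_image bary_arc = path_image h"
  by (force simp: bary_arc_def path_image_compose from_to_bary)

lemma arc_bary_arc: "arc bary_arc" "path_image bary_arc \<subseteq> fractal \<sigma>"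
proof -
  have "inj to_bary" using from_to_bary by (metis injI)
  then show "arc bary_arc"
    using h(1) unfolding arc_def bary_arc_def
    by (auto intro!: path_continuous_image continuous_on_to_bary comp_inj_on intro: inj_on_subset)
  show "path_image bary_arc \<subseteq> fractal \<sigma>"
  proof
    fix q assume "q \<in> path_image bary_arc"
    then obtain p where p: "p \<in> path_image h" "q = to_bary p" by (auto simp: bary_arc_def path_image_compose)
    then obtain x where x: "x \<in> fractal \<sigma>" "p = from_bary x" using h(2) by blast
    then have "q = x" using p(2) to_from_bary fractal_HH HH_iff by (metis subsetD)
    then show "q \<in> fractal \<sigma>" using x by simp
  qed
qed

lemma bary_arc_hub_lines:
  assumes "C \<in> cel \<sigma> n" "C\<^sub>1 \<in> cel \<sigma> n" "C\<^sub>1 \<noteq> C" "pathstart bary_arc \<in> cell_set C\<^sub>1"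
    "C\<^sub>2 \<in> cel \<sigma> n" "C\<^sub>2 \<noteq> C" "pathfinish bary_arc \<in> cell_set C\<^sub>2"
    and "p \<in> path_image bary_arc" "p \<in> cell_set C"
  shows "p \<in> hub_lines C"
proof -
  obtain x where x: "x \<in> fractal (snd C)" "p = fst C x" using assms(9) by blast
  have "x $ a = exit_point (snd C) c $ a \<or> x $ b = exit_point (snd C) c $ b"
    by (rule arc_in_cell[OF arc_bary_arc, of "fst C" "snd C" n C\<^sub>1 C\<^sub>2]) (use assms x in auto)
  then show ?thesis using x unfolding hub_lines_def by blast
qed

text \<open>A cell contributes two lines of premeasure at most 4/m^(n+1) each, and there are at most
  \<open>2 * max_children\<close> such cells per step, hence the coefficient 16; the powers sum to
  at most 1 since m \<ge> 2. The remaining two cells around the end points account for 3 + 3. The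
  bound does not depend on \<delta>.\<close>

lemma arc_finite_measure: "hausdorff_measure 1 (path_image h) \<le> ennreal (16 * real max_children + 6)"
  unfolding hausdorff_measure_def
proof (rule SUP_least)
  fix \<delta> :: real assume "\<delta> \<in> {0<..}"
  then have \<delta>: "0 < \<delta>" by simp
  let ?X = "pathstart bary_arc" and ?Y = "pathfinish bary_arc"
  have XY: "?X \<in> fractal \<sigma>" "?Y \<in> fractal \<sigma>" using arc_bary_arc(2) by auto
  obtain f where f: "\<And>n. f n \<in> cel \<sigma> n" "\<And>n. ?X \<in> cell_set (f n)" "\<And>n. f (Suc n) \<in> children (f n)"
    using cell_chain[OF XY(1)] by blast
  obtain f' where f': "\<And>n. f' n \<in> cel \<sigma> n" "\<And>n. ?Y \<in> cell_set (f' n)" "\<And>n. f' (Suc n) \<in> children (f' n)"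
    using cell_chain[OF XY(2)] by blast
  define I where "I n = children (f n) \<union> children (f' n)" for n
  have I: "C \<in> cel \<sigma> (Suc n)" if "C \<in> I n" for C n
    using that f(1) f'(1) children_cells unfolding I_def by blast
  have fin: "finite (I n)" for n by (simp add: I_def finite_children)
  have card: "card (I n) \<le> 2 * max_children" for n
    using card_Un_le[of "children (f n)" "children (f' n)"] card_children[of "f n"] card_children[of "f' n"]
    unfolding I_def by linarith
  \<comment> \<open>In each step the two cells around the end points are split. For a child other
    than the two that continue the chains, both end points lie in cells different from it, so only
    its lines are kept.\<close>
  have cover: "path_image bary_arc \<subseteq> (\<Union>n<k. \<Union>C\<in>I n. hub_lines C) \<union> (cell_set (f k) \<union> cell_set (f' k))" for k
  proof (induction k)
    case 0
    have "f 0 = (id, \<sigma>)" using f(1)[of 0] by simp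
    then have "cell_set (f 0) = fractal \<sigma>" by simp
    then show ?case using arc_bary_arc(2) by blast
  next
    case (Suc k)
    have "p \<in> (\<Union>C\<in>I k. hub_lines C) \<union> (cell_set (f (Suc k)) \<union> cell_set (f' (Suc k)))"
      if p: "p \<in> path_image bary_arc" "p \<in> cell_set (f k) \<union> cell_set (f' k)" for p
    proof -
      obtain C where C: "C \<in> I k" "p \<in> cell_set C" using p(2) cell_set_children unfolding I_def by blast
      show ?thesis
      proof (cases "C = f (Suc k) \<or> C = f' (Suc k)")
        case True
        then show ?thesis using C by blast
      next
        case False
        then have "f (Suc k) \<noteq> C" "f' (Suc k) \<noteq> C" by auto
        then have "p \<in> hub_lines C"
          by (intro bary_arc_hub_lines[OF I[OF C(1)] f(1) _ f(2) f'(1) _ f'(2) p(1) C(2)])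
        then show ?thesis using C by blast
      qed
    qed
    note step = this
    show ?case
    proof
      fix p assume p: "p \<in> path_image bary_arc"
      then consider n where "n < k" "p \<in> (\<Union>C\<in>I n. hub_lines C)" | "p \<in> cell_set (f k) \<union> cell_set (f' k)"
        using Suc by blast
      then show "p \<in> (\<Union>n<Suc k. \<Union>C\<in>I n. hub_lines C) \<union> (cell_set (f (Suc k)) \<union> cell_set (f' (Suc k)))"
      proof cases
        case 1
        then have "n \<in> {..<Suc k}" by simp
        then show ?thesis using 1(2) by blast
      next
        case 2
        have "k \<in> {..<Suc k}" by simp
        then show ?thesis using step[OF p 2] by blast
      qed
    qed
  qed
  \<comment> \<open>The splitting stops at a level that depends on \<delta>, where the two remaining
    cells are small enough to serve as covering sets themselves.\<close>
  obtain k where k: "3 * (1 / real m ^ k) \<le> \<delta>"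
  proof -
    have "\<forall>\<^sub>F n in sequentially. 1 / real m ^ n < \<delta> / 3"
      using \<delta> by (intro order_tendstoD(2)[OF tendsto_m_power]) auto
    then obtain n where "1 / real m ^ n < \<delta> / 3" by (metis (no_types, lifting) eventually_sequentially order_refl)
    then show ?thesis using that[of n] by simp
  qed
  let ?pm = "hausdorff_premeasure 1 \<delta> :: point set \<Rightarrow> ennreal"
  have cell: "?pm (from_bary ` cell_set C) \<le> ennreal 3" if "C \<in> cel \<sigma> k" for C
  proof -
    have "?pm (from_bary ` cell_set C) \<le> ennreal (3 * (1 / real m ^ k))"
      using premeasure_cell[of "fst C" "snd C" \<sigma> k \<delta>] that k \<delta> by simp
    also have "\<dots> \<le> ennreal 3" using m_ge_2 by (intro ennreal_leI) (simp add: field_simps)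
    finally show ?thesis .
  qed
  have lines: "?pm (from_bary ` (\<Union>C\<in>I n. hub_lines C)) \<le> ennreal (16 * real max_children * (1 / real m ^ Suc n))" for n
  proof -
    have "?pm (from_bary ` (\<Union>C\<in>I n. hub_lines C)) \<le> (\<Sum>C\<in>I n. ?pm (from_bary ` hub_lines C))"
      unfolding image_UN using \<delta> by (intro hausdorff_premeasure_UN fin) auto
    also have "\<dots> \<le> (\<Sum>C\<in>I n. ennreal (8 * (1 / real m ^ Suc n)))"
      using \<delta> I by (intro sum_mono premeasure_hub_lines) auto
    also have "\<dots> = ennreal (\<Sum>C\<in>I n. 8 * (1 / real m ^ Suc n))" by (rule sum_ennreal) simp
    also have "\<dots> \<le> ennreal (16 * real max_children * (1 / real m ^ Suc n))"
    proof (rule ennreal_leI)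
      have "real (card (I n)) * (8 * (1 / real m ^ Suc n)) \<le> real (2 * max_children) * (8 * (1 / real m ^ Suc n))"
        using card[of n] by (intro mult_right_mono) auto
      then show "(\<Sum>C\<in>I n. 8 * (1 / real m ^ Suc n)) \<le> 16 * real max_children * (1 / real m ^ Suc n)" by simp
    qed
    finally show ?thesis .
  qed
  have geo: "(\<Sum>n<k. 1 / real m ^ Suc n) \<le> 1 - 1 / real m ^ k"
  proof (induction k)
    case (Suc k)
    have "2 / real m ^ Suc k \<le> 1 / real m ^ k" using m_ge_2 by (simp add: field_simps)
    then show ?case using Suc by simp
  qed simp
  have "path_image h \<subseteq> (\<Union>n<k. from_bary ` (\<Union>C\<in>I n. hub_lines C)) \<union>
      (from_bary ` cell_set (f k) \<union> from_bary ` cell_set (f' k))"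
    using image_mono[OF cover[of k], of from_bary] unfolding from_bary_arc image_Un image_UN .
  then have "?pm (path_image h) \<le> ?pm ((\<Union>n<k. from_bary ` (\<Union>C\<in>I n. hub_lines C)) \<union>
      (from_bary ` cell_set (f k) \<union> from_bary ` cell_set (f' k)))"
    by (rule hausdorff_premeasure_mono)
  also have "\<dots> \<le> ?pm (\<Union>n<k. from_bary ` (\<Union>C\<in>I n. hub_lines C)) +
      (?pm (from_bary ` cell_set (f k)) + ?pm (from_bary ` cell_set (f' k)))"
    by (rule order_trans[OF hausdorff_premeasure_Un add_left_mono[OF hausdorff_premeasure_Un]])
  also have "\<dots> \<le> (\<Sum>n<k. ?pm (from_bary ` (\<Union>C\<in>I n. hub_lines C))) + (ennreal 3 + ennreal 3)"
    using \<delta> by (intro add_mono hausdorff_premeasure_UN cell f f') auto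
  also have "\<dots> \<le> (\<Sum>n<k. ennreal (16 * real max_children * (1 / real m ^ Suc n))) + (ennreal 3 + ennreal 3)"
    by (intro add_mono sum_mono lines order_refl)
  also have "(\<Sum>n<k. ennreal (16 * real max_children * (1 / real m ^ Suc n))) =
      ennreal (16 * real max_children * (\<Sum>n<k. 1 / real m ^ Suc n))"
    by (subst sum_ennreal) (auto simp: sum_distrib_left)
  also have "ennreal (16 * real max_children * (\<Sum>n<k. 1 / real m ^ Suc n)) + (ennreal 3 + ennreal 3) =
      ennreal (16 * real max_children * (\<Sum>n<k. 1 / real m ^ Suc n) + 6)"
  proof -
    have "ennreal 3 + ennreal 3 = ennreal 6" by (subst ennreal_plus[symmetric]) auto
    moreover have "0 \<le> 16 * real max_children * (\<Sum>n<k. 1 / real m ^ Suc n)"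
      by (intro mult_nonneg_nonneg sum_nonneg) auto
    ultimately show ?thesis by (simp add: ennreal_plus)
  qed
  also have "\<dots> \<le> ennreal (16 * real max_children + 6)"
  proof (rule ennreal_leI)
    have "(\<Sum>n<k. 1 / real m ^ Suc n) \<le> 1" using geo by (rule order_trans) simp
    then have "16 * real max_children * (\<Sum>n<k. 1 / real m ^ Suc n) \<le> 16 * real max_children * 1"
      by (intro mult_left_mono) auto
    then show "16 * real max_children * (\<Sum>n<k. 1 / real m ^ Suc n) + 6 \<le> 16 * real max_children + 6" by simp
  qed
  finally show "?pm (path_image h) \<le> ennreal (16 * real max_children + 6)" .
qed

text \<open>At a fine enough level the cell of p contains neither end point. The point p lies in no
  other cell and on exactly one of the two lines, which meet in an exit point. The closed set Z
  consists of the other line in the cell and of all other cells; near p the arc avoids Z, so all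
  angles to the line are 0 there.\<close>

lemma arc_tangent:
  assumes p: "p \<in> path_image bary_arc" "p \<noteq> pathstart bary_arc" "p \<noteq> pathfinish bary_arc"
    and no_exit: "\<And>n F s j. (F, s) \<in> cel \<sigma> n \<Longrightarrow> p \<noteq> F (exit_point s j)"
  shows "\<exists>\<tau>. is_tangent (path_image h) (from_bary p) \<tau>"
proof -
  let ?X = "pathstart bary_arc" and ?Y = "pathfinish bary_arc"
  have "\<exists>i. p $ i \<noteq> ?X $ i" "\<exists>i. p $ i \<noteq> ?Y $ i" using p by (auto simp: vec_eq_iff)
  then obtain i i' where i: "p $ i \<noteq> ?X $ i" "p $ i' \<noteq> ?Y $ i'" by blast
  have "\<forall>\<^sub>F n in sequentially. 1 / real m ^ n < \<bar>p $ i - ?X $ i\<bar> \<and> 1 / real m ^ n < \<bar>p $ i' - ?Y $ i'\<bar>"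
    using i by (intro eventually_conj order_tendstoD(2)[OF tendsto_m_power]) auto
  then obtain n where n: "1 / real m ^ n < \<bar>p $ i - ?X $ i\<bar>" "1 / real m ^ n < \<bar>p $ i' - ?Y $ i'\<bar>"
    by (metis (no_types, lifting) eventually_sequentially order_refl)
  have pf: "p \<in> fractal \<sigma>" "?X \<in> fractal \<sigma>" "?Y \<in> fractal \<sigma>" using arc_bary_arc(2) p(1) by auto
  obtain F s x where F: "(F, s) \<in> cel \<sigma> n" "x \<in> fractal s" "p = F x"
    using pf(1) fractal_cells[of \<sigma> n] by auto
  have far: "z \<notin> F ` fractal s" if "1 / real m ^ n < \<bar>p $ k - z $ k\<bar>" for z k
    using that cell_coord_diff[OF F(1), of x _ k] F(2,3) fractal_HH by fastforce
  obtain C\<^sub>1 where C1: "C\<^sub>1 \<in> cel \<sigma> n" "?X \<in> cell_set C\<^sub>1" using pf(2) fractal_cells[of \<sigma> n] by force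
  obtain C\<^sub>2 where C2: "C\<^sub>2 \<in> cel \<sigma> n" "?Y \<in> cell_set C\<^sub>2" using pf(3) fractal_cells[of \<sigma> n] by force
  have ne: "C\<^sub>1 \<noteq> (F, s)" "C\<^sub>2 \<noteq> (F, s)" using C1(2) C2(2) far[OF n(1)] far[OF n(2)] by auto
  have on_line: "x' $ a = exit_point s c $ a \<or> x' $ b = exit_point s c $ b" if "x' \<in> fractal s" "F x' \<in> path_image bary_arc" for x'
    by (rule arc_in_cell[OF arc_bary_arc F(1) C1(1) ne(1) C1(2) C2(1) ne(2) C2(2) that])
  have "x \<noteq> exit_point s c" using no_exit[OF F(1), of c] F(3) by blast
  have not_both: "\<not> (x $ a = exit_point s c $ a \<and> x $ b = exit_point s c $ b)"
  proof
    assume eq: "x $ a = exit_point s c $ a \<and> x $ b = exit_point s c $ b"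
    have "x \<in> HH" using F(2) fractal_HH by blast
    then have "x $ a + x $ b + x $ c = 1" "exit_point s c $ a + exit_point s c $ b + exit_point s c $ c = 1"
      using exit_point_HH[of s c] sum_distinct_3[OF abc, of x] sum_distinct_3[OF abc, of "exit_point s c"] by (auto simp: HH_iff)
    then have "x $ c = exit_point s c $ c" using eq by linarith
    then have "x $ k = exit_point s c $ k" for k using eq distinct_3_cases[OF abc, of k] by auto
    then show False using \<open>x \<noteq> exit_point s c\<close> by (simp add: vec_eq_iff)
  qed
  have "x $ a = exit_point s c $ a \<or> x $ b = exit_point s c $ b" using on_line[of x] F p(1) by blast
  then obtain y w where yw: "(y = a \<and> w = b) \<or> (y = b \<and> w = a)"
    "x $ y = exit_point s c $ y" "x $ w \<noteq> exit_point s c $ w"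
    using not_both by blast
  have ywc: "y \<noteq> w" "y \<noteq> c" "w \<noteq> c" using yw(1) abc by auto
  define Z where "Z = F ` (fractal s \<inter> {x'. x' $ w = exit_point s c $ w}) \<union> (\<Union>(G, t)\<in>cel \<sigma> n - {(F, s)}. G ` fractal t)"
  have clZ: "closed Z"
  proof -
    have "compact (fractal s \<inter> {x'. x' $ w = exit_point s c $ w})"
      by (intro compact_Int_closed compact_fractal closed_Collect_eq continuous_intros)
    then have "closed (F ` (fractal s \<inter> {x'. x' $ w = exit_point s c $ w}))"
      by (intro compact_imp_closed compact_continuous_image continuous_on_cell[OF F(1)])
    then show ?thesis unfolding Z_def using finite_cells compact_cell
      by (intro closed_Un closed_UN) (auto intro: compact_imp_closed)
  qed
  have pZ: "p \<notin> Z"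
  proof
    assume "p \<in> Z"
    then consider "p \<in> F ` (fractal s \<inter> {x'. x' $ w = exit_point s c $ w})" |
      G t where "(G, t) \<in> cel \<sigma> n" "(F, s) \<noteq> (G, t)" "p \<in> G ` fractal t"
      unfolding Z_def by blast
    then show False
    proof cases
      case 1
      then show ?thesis using F(3) cells_inj[OF F(1)] yw(3) by blast
    next
      case 2
      then obtain j where "p = F (exit_point s j)" using cells_contact[OF F(1) 2(1,2) _ 2(3)] F(2,3) by blast
      then show ?thesis using no_exit[OF F(1)] by blast
    qed
  qed
  have "open (to_bary -` (- Z))"
    using continuous_on_to_bary[of UNIV] clZ by (intro open_vimage) auto
  moreover have "from_bary p \<in> to_bary -` (- Z)"
  proof -
    have "to_bary (from_bary p) = p" using pf(1) fractal_HH to_from_bary HH_iff by blast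
    then show ?thesis using pZ by simp
  qed
  ultimately obtain \<epsilon> where "\<epsilon> > 0" and ball: "ball (from_bary p) \<epsilon> \<subseteq> to_bary -` (- Z)"
    by (rule openE)
  have \<epsilon>: "to_bary q \<notin> Z" if "dist (from_bary p) q < \<epsilon>" for q
    using that ball by (auto simp: subset_iff)
  define v where "v = PP $ w - PP $ c"
  have v: "v \<noteq> 0" using norm_PP_diff[OF ywc(3)] unfolding v_def by auto
  have angle: "line_angle v (q - from_bary p) = 0"
    if q: "q \<in> path_image h" "q \<noteq> from_bary p" "dist (from_bary p) q < \<epsilon>" for q
  proof -
    obtain q' where q': "q' \<in> path_image bary_arc" "q = from_bary q'" using q(1) from_bary_arc by blast
    have "q' \<in> fractal \<sigma>" using q'(1) arc_bary_arc(2) by blast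
    have "to_bary q = q'" using \<open>q' \<in> fractal \<sigma>\<close> q'(2) fractal_HH to_from_bary HH_iff by blast
    then have "q' \<notin> Z" using \<epsilon>[OF q(3)] by simp
    obtain G t where G: "(G, t) \<in> cel \<sigma> n" "q' \<in> G ` fractal t"
      using \<open>q' \<in> fractal \<sigma>\<close> fractal_cells[of \<sigma> n] by blast
    have "(G, t) = (F, s)"
    proof (rule ccontr)
      assume "(G, t) \<noteq> (F, s)"
      then have "(G, t) \<in> cel \<sigma> n - {(F, s)}" using G(1) by blast
      then show False using G(2) \<open>q' \<notin> Z\<close> unfolding Z_def by blast
    qed
    then obtain x' where x': "x' \<in> fractal s" "q' = F x'" using G(2) by blast
    have "x' $ w \<noteq> exit_point s c $ w" using \<open>q' \<notin> Z\<close> x' unfolding Z_def by blast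
    moreover have "x' $ a = exit_point s c $ a \<or> x' $ b = exit_point s c $ b" using on_line x' q'(1) by blast
    ultimately have "x' $ y = exit_point s c $ y" using yw(1) by auto
    then have xy: "x $ y = x' $ y" using yw(2) by simp
    have H: "x \<in> HH" "x' \<in> HH" using F(2) x'(1) fractal_HH by blast+
    obtain r where r: "from_bary (F x') - from_bary (F x) = (r * (x' $ w - x $ w)) *\<^sub>R (PP $ w - PP $ c)"
      using from_bary_line_diff[OF F(1) ywc H xy] by blast
    then have eq: "q - from_bary p = (r * (x' $ w - x $ w)) *\<^sub>R v"
      using q'(2) x'(2) F(3) v_def by simp
    then have "r * (x' $ w - x $ w) \<noteq> 0" using q(2) by (metis eq_iff_diff_eq_0 scaleR_zero_left)
    then show ?thesis using line_angle_parallel[OF v] eq by simp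
  qed
  have "is_tangent (path_image h) (from_bary p) (straight_line (from_bary p) v)"
    unfolding is_tangent_def using v \<open>\<epsilon> > 0\<close> angle
    by (intro exI[of _ v] conjI refl allI impI exI[of _ \<epsilon>]) (auto simp: less_imp_le)
  then show ?thesis by blast
qed

lemma arc_tangent_ae:
  "hausdorff_measure 1 {x \<in> path_image h. \<not> (\<exists>\<tau>. is_tangent (path_image h) x \<tau>)} = 0"
proof (rule hausdorff_measure_countable)
  define X where "X = {pathstart bary_arc, pathfinish bary_arc} \<union> (\<Union>n. \<Union>(F, s)\<in>cel \<sigma> n. F ` range (exit_point s))"
  have X: "countable X"
    unfolding X_def
    by (intro countable_Un countable_UN) (auto intro!: countable_finite finite_cells countable_UN)
  have "{x \<in> path_image h. \<not> (\<exists>\<tau>. is_tangent (path_image h) x \<tau>)} \<subseteq> from_bary ` X"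
  proof clarify
    fix q assume q: "q \<in> path_image h" "\<nexists>\<tau>. is_tangent (path_image h) q \<tau>"
    then obtain p where p: "p \<in> path_image bary_arc" "q = from_bary p" using from_bary_arc by blast
    have "p \<in> X"
    proof (rule ccontr)
      assume "p \<notin> X"
      then have "p \<noteq> pathstart bary_arc" "p \<noteq> pathfinish bary_arc"
        "\<And>n F s j. (F, s) \<in> cel \<sigma> n \<Longrightarrow> p \<noteq> F (exit_point s j)"
        unfolding X_def by blast+
      then show False using arc_tangent[OF p(1)] q(2) p(2) by blast
    qed
    then show "q \<in> from_bary ` X" using p(2) by blast
  qed
  then show "countable {x \<in> path_image h. \<not> (\<exists>\<tau>. is_tangent (path_image h) x \<tau>)}"
    using countable_image[OF X] by (rule countable_subset)
qed simp

end

theorem fractal_arcs: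
  assumes "A \<in> nontrivial_arcs (from_bary ` fractal \<sigma>)"
  shows "arc_length A < \<infinity>" "hausdorff_dim A = 1"
    "arc_length {x \<in> A. \<not> (\<exists>\<tau>. is_tangent A x \<tau>)} = 0"
proof -
  obtain h where h: "arc h" "path_image h \<subseteq> from_bary ` fractal \<sigma>" and A: "A = path_image h"
    using assms unfolding nontrivial_arcs_def by blast
  show fin: "arc_length A < \<infinity>"
    unfolding arc_length_def A using arc_finite_measure[OF h] by (rule le_less_trans) simp
  show "hausdorff_dim A = 1"
  proof (rule hausdorff_dim_eq_1)
    show "connected A" using h(1) A by (simp add: arc_imp_path connected_path_image)
    show "pathstart h \<in> A" "pathfinish h \<in> A" using A by auto
    show "pathstart h \<noteq> pathfinish h" using arc_distinct_ends[OF h(1)] by simp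
    show "hausdorff_measure 1 A < \<infinity>" using fin unfolding arc_length_def .
  qed
  show "arc_length {x \<in> A. \<not> (\<exists>\<tau>. is_tangent A x \<tau>)} = 0"
    unfolding arc_length_def A by (rule arc_tangent_ae[OF h])
qed

end

section \<open>From triangles to nodes\<close>

definition node_triangle :: "nat \<Rightarrow> node \<Rightarrow> triangle" where
  "node_triangle m v = (if fst v then T m (snd v) else T' m (snd v))"

definition map_triangle :: "(real^3 \<Rightarrow> real^3) \<Rightarrow> triangle" where
  "map_triangle F = (\<chi> i. from_bary (F (axis i 1)))"

lemma axis_HH: "axis i 1 \<in> HH"
  using exhaust_3[of i] by (auto simp: HH_iff axis_def)

lemma sum_axis_scaleR: "(\<Sum>i\<in>UNIV. \<alpha> $ i *\<^sub>R axis i (1::real)) = (\<alpha> :: real^3)"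
  by (simp add: vec_eq_iff forall_3 sum_3 axis_def)

lemma from_bary_axis: "from_bary (axis i 1) = PP $ i"
  using exhaust_3[of i] by (auto simp: from_bary_def sum_3 axis_def)

lemma node_triangle_eq: "node_triangle m v = map_triangle (node_map m v)"
proof -
  have "node_map m v \<alpha> = (1 / real m) *\<^sub>R ((\<chi> i. of_int (snd v $ i)) + (if fst v then \<alpha> else (\<chi> i. 1) - \<alpha>))" for \<alpha>
    by (simp add: node_map_def vec_eq_iff)
  moreover have "from_bary (\<chi> i. of_int (snd v $ i)) = (\<Sum>j\<in>UNIV. of_int (snd v $ j) *\<^sub>R PP $ j)"
    "from_bary (\<chi> i. 1) = (\<Sum>j\<in>UNIV. PP $ j)"
    by (simp_all add: from_bary_def)
  ultimately have "from_bary (node_map m v (axis i 1)) = node_triangle m v $ i" for i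
    by (simp add: linear_scale[OF linear_from_bary] linear_add[OF linear_from_bary]
        linear_diff[OF linear_from_bary] from_bary_axis node_triangle_def T_def T'_def add_diff_eq)
  then show ?thesis by (simp add: map_triangle_def vec_eq_iff)
qed

lemma bary_from_bary:
  assumes "\<alpha> \<in> HH"
  shows "bary (from_bary \<alpha>) = \<alpha>"
  unfolding bary_def
proof (rule the_equality)
  show "\<alpha> \<in> HH \<and> (\<Sum>i\<in>UNIV. \<alpha> $ i *\<^sub>R PP $ i) = from_bary \<alpha>" using assms by (simp add: from_bary_def)
  fix \<beta> assume "\<beta> \<in> HH \<and> (\<Sum>i\<in>UNIV. \<beta> $ i *\<^sub>R PP $ i) = from_bary \<alpha>"
  then have "\<beta> \<in> HH" "from_bary \<beta> = from_bary \<alpha>" by (simp_all add: from_bary_def)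
  then show "\<beta> = \<alpha>" using to_from_bary[of \<alpha>] to_from_bary[of \<beta>] assms by (simp add: HH_iff)
qed

lemma inj_on_from_bary: "inj_on from_bary HH"
  by (rule inj_on_inverseI[of _ to_bary]) (simp add: HH_iff to_from_bary)

lemma HH_eq_hull: "HH = convex hull (range (\<lambda>i. axis i (1::real)))"
proof
  show "HH \<subseteq> convex hull (range (\<lambda>i. axis i (1::real)))"
  proof
    fix \<alpha> assume \<alpha>: "\<alpha> \<in> HH"
    have "(\<Sum>i\<in>UNIV. \<alpha> $ i *\<^sub>R axis i (1::real)) \<in> convex hull (range (\<lambda>i. axis i (1::real)))"
      by (rule convex_sum) (use \<alpha> in \<open>auto simp: HH_def hull_inc convex_convex_hull\<close>)
    then show "\<alpha> \<in> convex hull (range (\<lambda>i. axis i (1::real)))" by (simp only: sum_axis_scaleR)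
  qed
  have "convex HH"
  proof (rule convexI)
    fix x y :: "real^3" and u v :: real
    assume H: "x \<in> HH" "y \<in> HH" "0 \<le> u" "0 \<le> v" "u + v = 1"
    have "(u * x $ 1 + v * y $ 1) + (u * x $ 2 + v * y $ 2) + (u * x $ 3 + v * y $ 3) =
        u * (x $ 1 + x $ 2 + x $ 3) + v * (y $ 1 + y $ 2 + y $ 3)" by (simp add: algebra_simps)
    also have "\<dots> = 1" using H by (simp add: HH_iff)
    finally show "u *\<^sub>R x + v *\<^sub>R y \<in> HH" using H by (simp add: HH_iff)
  qed
  then show "convex hull (range (\<lambda>i. axis i (1::real))) \<subseteq> HH"
    by (intro hull_minimal) (auto simp: axis_HH)
qed

text \<open>\<open>HH\<close> is the convex hull of the unit vectors, and hulls commute with linear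
  maps and translations.\<close>

lemma full_map_triangle:
  assumes "F = (\<lambda>\<alpha>. z + r *\<^sub>R \<alpha>)"
  shows "full (map_triangle F) = from_bary ` F ` HH"
proof -
  define g where "g \<alpha> = from_bary (r *\<^sub>R \<alpha>)" for \<alpha>
  have lin: "linear g" unfolding g_def
    using linear_compose[OF linear_scale_self linear_from_bary, of r] by (simp add: o_def)
  have g: "from_bary (F \<alpha>) = from_bary z + g \<alpha>" for \<alpha>
    unfolding assms g_def by (rule linear_add[OF linear_from_bary])
  have "range (\<lambda>i. map_triangle F $ i) = (\<lambda>x. from_bary z + x) ` g ` range (\<lambda>i. axis i 1)"
    by (simp add: map_triangle_def g image_image)
  then have "full (map_triangle F) = (\<lambda>x. from_bary z + x) ` g ` HH"
    unfolding full_def HH_eq_hull by (simp only: convex_hull_translation convex_hull_linear_image[OF lin])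
  also have "\<dots> = from_bary ` F ` HH" by (simp add: image_image g)
  finally show ?thesis .
qed

definition pattern :: "patterns \<Rightarrow> bool \<Rightarrow> bool \<Rightarrow> triangle set" where
  "pattern S s d = (if s then (if d then white_up S else white_down S)
                    else (if d then yellow_up S else yellow_down S))"

text \<open>
  In the yellow fractal the up triangles carry the yellow pattern, so the state \<open>True\<close> belongs
  to \<open>YY'\<close> there.
\<close>

definition level :: "patterns \<Rightarrow> bool \<Rightarrow> nat \<Rightarrow> bool \<Rightarrow> triangle set" where
  "level S \<sigma> n s = (if \<sigma> then (if s then WW S n else WW' S n) else (if s then YY' S n else YY S n))"

text \<open>A child of state s' in a triangle of state s comes from the up part of the pattern
  exactly if s = s'. This unifies the four recursions.\<close>

lemma level_Suc: "level S \<sigma> (Suc (Suc n)) s' = (\<Union>s. images (level S \<sigma> (Suc n) s) (pattern S s (s = s')))"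
  by (cases \<sigma>; cases s') (simp_all add: level_def pattern_def UNIV_bool Un_commute)

lemma level_1: "level S \<sigma> (Suc 0) s = pattern S \<sigma> (\<sigma> = s)"
  by (cases \<sigma>; cases s) (simp_all add: level_def pattern_def)

context tri_system begin

lemma tri_map_map_triangle:
  assumes F: "(F, s) \<in> cel \<sigma> n" and \<alpha>: "\<alpha> \<in> HH"
  shows "tri_map (map_triangle F) (from_bary \<alpha>) = from_bary (F \<alpha>)"
proof -
  obtain z r where zr: "F = (\<lambda>\<alpha>. z + r *\<^sub>R \<alpha>)" using cells_form[OF F] by blast
  have "tri_map (map_triangle F) (from_bary \<alpha>) = (\<Sum>i\<in>UNIV. \<alpha> $ i *\<^sub>R (from_bary z + r *\<^sub>R PP $ i))"
    by (simp add: tri_map_def bary_from_bary[OF \<alpha>] map_triangle_def zr from_bary_axis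
        linear_scale[OF linear_from_bary] linear_add[OF linear_from_bary])
  also have "\<dots> = (\<Sum>i\<in>UNIV. \<alpha> $ i) *\<^sub>R from_bary z + r *\<^sub>R from_bary \<alpha>"
    by (simp add: from_bary_def sum_3 algebra_simps)
  also have "(\<Sum>i\<in>UNIV. \<alpha> $ i) = 1" using \<alpha> by (simp add: HH_def)
  finally show ?thesis
    by (simp add: zr linear_scale[OF linear_from_bary] linear_add[OF linear_from_bary])
qed

lemma tri_image_map_triangle:
  assumes F: "(F, s) \<in> cel \<sigma> n" and v: "v \<in> N s"
  shows "tri_image (map_triangle F) (node_triangle m v) = map_triangle (F \<circ> nm v)"
proof -
  have "tri_map (map_triangle F) (from_bary (nm v (axis i 1))) = from_bary (F (nm v (axis i 1)))" for i
    by (rule tri_map_map_triangle[OF F nm_HH[OF v axis_HH]])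
  then show ?thesis
    unfolding tri_image_def node_triangle_eq by (simp add: map_triangle_def)
qed

text \<open>The spare k levels inside the cells let the induction move one level at a time from the
  approximants to the cells. For k = 0 the result is the union of the triangles of level n.\<close>

lemma app_cells: "app \<sigma> (n + k) = (\<Union>(F, s)\<in>cel \<sigma> n. F ` app s k)"
proof (induction n arbitrary: k)
  case (Suc n)
  have "app \<sigma> (Suc n + k) = (\<Union>(F, s)\<in>cel \<sigma> n. F ` app s (Suc k))" using Suc[of "Suc k"] by simp
  also have "\<dots> = (\<Union>(F, s)\<in>cel \<sigma> (Suc n). F ` app s k)"
  proof
    show "(\<Union>(F, s)\<in>cel \<sigma> n. F ` app s (Suc k)) \<subseteq> (\<Union>(F, s)\<in>cel \<sigma> (Suc n). F ` app s k)"
    proof clarify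
      fix F s x assume F: "(F, s) \<in> cel \<sigma> n" "x \<in> app s (Suc k)"
      then obtain v y where v: "v \<in> N s" "y \<in> app (s = fst v) k" "x = nm v y" by auto
      have "(F \<circ> nm v, s = fst v) \<in> cel \<sigma> (Suc n)" using F(1) v(1) by (rule cells_SucI)
      moreover have "F x \<in> (F \<circ> nm v) ` app (s = fst v) k" using v by auto
      ultimately show "F x \<in> (\<Union>(F, s)\<in>cel \<sigma> (Suc n). F ` app s k)" by blast
    qed
    show "(\<Union>(F, s)\<in>cel \<sigma> (Suc n). F ` app s k) \<subseteq> (\<Union>(F, s)\<in>cel \<sigma> n. F ` app s (Suc k))"
    proof clarify
      fix F s x assume F: "(F, s) \<in> cel \<sigma> (Suc n)" and x: "x \<in> app s k"
      obtain G t v where G: "(G, t) \<in> cel \<sigma> n" "v \<in> N t" "F = G \<circ> nm v" "s = (t = fst v)"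
        using F by (rule cells_SucE)
      then have "nm v x \<in> app t (Suc k)" using x by auto
      then have "F x \<in> G ` app t (Suc k)" using G(3) by auto
      then show "F x \<in> (\<Union>(F, s)\<in>cel \<sigma> n. F ` app s (Suc k))" using G(1) by blast
    qed
  qed
  finally show ?case .
qed simp

lemma level_cells:
  assumes pat: "\<And>s d. pattern S s d = node_triangle m ` {v \<in> N s. fst v = d}"
  shows "level S \<sigma> (Suc n) s = {map_triangle F |F. (F, s) \<in> cel \<sigma> (Suc n)}"
proof (induction n arbitrary: s)
  case 0
  have "level S \<sigma> (Suc 0) s = {map_triangle (nm v) |v. v \<in> N \<sigma> \<and> (\<sigma> = fst v) = s}"
  proof -
    have "{v \<in> N \<sigma>. fst v = (\<sigma> = s)} = {v \<in> N \<sigma>. (\<sigma> = fst v) = s}" by (cases \<sigma>; cases s) auto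
    then show ?thesis unfolding level_1 pat node_triangle_eq by blast
  qed
  also have "\<dots> = {map_triangle F |F. (F, s) \<in> cel \<sigma> (Suc 0)}" by fastforce
  finally show ?case .
next
  case (Suc n)
  show ?case
  proof
    show "level S \<sigma> (Suc (Suc n)) s \<subseteq> {map_triangle F |F. (F, s) \<in> cel \<sigma> (Suc (Suc n))}"
    proof
      fix W assume "W \<in> level S \<sigma> (Suc (Suc n)) s"
      then obtain t F v where F: "(F, t) \<in> cel \<sigma> (Suc n)" "v \<in> N t" "fst v = (t = s)"
        "W = tri_image (map_triangle F) (node_triangle m v)"
        unfolding level_Suc images_def Suc pat by blast
      then have "W = map_triangle (F \<circ> nm v)" using tri_image_map_triangle by blast
      moreover have "(F \<circ> nm v, s) \<in> cel \<sigma> (Suc (Suc n))"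
        using cells_SucI[OF F(1,2)] F(3) by (cases s; cases t; cases "fst v") auto
      ultimately show "W \<in> {map_triangle F |F. (F, s) \<in> cel \<sigma> (Suc (Suc n))}" by blast
    qed
    show "{map_triangle F |F. (F, s) \<in> cel \<sigma> (Suc (Suc n))} \<subseteq> level S \<sigma> (Suc (Suc n)) s"
    proof clarify
      fix G assume "(G, s) \<in> cel \<sigma> (Suc (Suc n))"
      then obtain F t v where F: "(F, t) \<in> cel \<sigma> (Suc n)" "v \<in> N t" "G = F \<circ> nm v" "s = (t = fst v)"
        by (rule cells_SucE)
      have "map_triangle G = tri_image (map_triangle F) (node_triangle m v)"
        using tri_image_map_triangle[OF F(1,2)] F(3) by simp
      moreover have "node_triangle m v \<in> pattern S t (t = s)" unfolding pat using F(2,4) by auto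
      moreover have "map_triangle F \<in> level S \<sigma> (Suc n) t" unfolding Suc using F(1) by blast
      ultimately show "map_triangle G \<in> level S \<sigma> (Suc (Suc n)) s"
        unfolding level_Suc images_def by blast
    qed
  qed
qed

lemma fractal_eq:
  assumes pat: "\<And>s d. pattern S s d = node_triangle m ` {v \<in> N s. fst v = d}"
  shows "(\<Inter>n\<in>{1..}. \<Union>U\<in>level S \<sigma> n True \<union> level S \<sigma> n False. full U) = from_bary ` fractal \<sigma>"
proof -
  have "(\<Union>U\<in>level S \<sigma> n True \<union> level S \<sigma> n False. full U) = from_bary ` app \<sigma> n" if n1: "n \<in> {1..}" for n
  proof -
    obtain k where n: "n = Suc k" using n1 by (cases n) auto
    have full: "full (map_triangle F) = from_bary ` F ` HH" if "(F, s) \<in> cel \<sigma> n" for F s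
      using cells_form[OF that] full_map_triangle by blast
    have "level S \<sigma> n True \<union> level S \<sigma> n False = (\<lambda>(F, s). map_triangle F) ` cel \<sigma> n" (is "?L = ?R")
    proof
      show "?L \<subseteq> ?R" unfolding n level_cells[OF pat] by force
      show "?R \<subseteq> ?L"
      proof clarify
        fix F s assume "(F, s) \<in> cel \<sigma> n" and nF: "map_triangle F \<notin> level S \<sigma> n False"
        then have F: "map_triangle F \<in> level S \<sigma> n s" unfolding n level_cells[OF pat] by blast
        then have "s = True" using nF by (cases s) simp_all
        then show "map_triangle F \<in> level S \<sigma> n True" using F by simp
      qed
    qed
    then have "(\<Union>U\<in>level S \<sigma> n True \<union> level S \<sigma> n False. full U) = (\<Union>(F, s)\<in>cel \<sigma> n. full (map_triangle F))"
      by (simp add: case_prod_unfold)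
    also have "\<dots> = (\<Union>(F, s)\<in>cel \<sigma> n. from_bary ` F ` HH)"
    proof (rule SUP_cong[OF refl])
      fix C assume "C \<in> cel \<sigma> n"
      then show "(case C of (F, s) \<Rightarrow> full (map_triangle F)) = (case C of (F, s) \<Rightarrow> from_bary ` F ` HH)"
        using full[of "fst C" "snd C"] by (simp add: case_prod_unfold)
    qed
    also have "\<dots> = from_bary ` (\<Union>(F, s)\<in>cel \<sigma> n. F ` HH)" by (simp add: image_UN case_prod_unfold)
    also have "(\<Union>(F, s)\<in>cel \<sigma> n. F ` HH) = app \<sigma> n" using app_cells[of \<sigma> n 0] by simp
    finally show ?thesis .
  qed
  then have "(\<Inter>n\<in>{1..}. \<Union>U\<in>level S \<sigma> n True \<union> level S \<sigma> n False. full U) = (\<Inter>n\<in>{1..}. from_bary ` app \<sigma> n)"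
    by (intro INF_cong) auto
  also have "\<dots> = from_bary ` (\<Inter>n\<in>{1..}. app \<sigma> n)"
    by (rule image_INT[OF inj_on_from_bary, symmetric, of _ _ 1])
      (use app_antimono'[of 0] in auto)
  \<comment> \<open>The given fractals start at level 1. The additional level 0 of
    \<open>fractal\<close> is the whole simplex, which contains all later levels.\<close>
  also have "(\<Inter>n\<in>{1..}. app \<sigma> n) = fractal \<sigma>"
  proof
    show "(\<Inter>n\<in>{1..}. app \<sigma> n) \<subseteq> fractal \<sigma>"
    proof
      fix x assume x: "x \<in> (\<Inter>n\<in>{1..}. app \<sigma> n)"
      have "x \<in> app \<sigma> (Suc n)" for n using x by (rule INT_D) simp
      then have "x \<in> app \<sigma> n" for n using app_antimono by blast
      then show "x \<in> fractal \<sigma>" by (simp add: fractal_def)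
    qed
  qed (auto simp: fractal_def)
  finally show ?thesis .
qed

lemma white_fractal_eq:
  assumes "\<And>s d. pattern S s d = node_triangle m ` {v \<in> N s. fst v = d}"
  shows "white_fractal S = from_bary ` fractal True"
  using fractal_eq[OF assms, of True] by (simp add: white_fractal_def level_def)

lemma yellow_fractal_eq:
  assumes "\<And>s d. pattern S s d = node_triangle m ` {v \<in> N s. fst v = d}"
  shows "yellow_fractal S = from_bary ` fractal False"
  using fractal_eq[OF assms, of False] by (simp add: yellow_fractal_def level_def Un_commute)

end

section \<open>The labyrinth hypotheses in terms of nodes\<close>

lemma successively_rtranclp_from_hd:
  assumes "successively E p" "v \<in> set p"
  shows "(restricted E (set p))\<^sup>*\<^sup>* (hd p) v"
proof -
  obtain xs ys where p: "p = (xs @ [v]) @ ys" using split_list[OF assms(2)] by auto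
  have "successively E (xs @ [v])" using assms(1) unfolding p by (simp only: successively_append_iff)
  then have "(restricted E (set p))\<^sup>*\<^sup>* (hd (xs @ [v])) (last (xs @ [v]))"
    by (rule successively_imp_rtranclp) (auto simp: p)
  moreover have "hd (xs @ [v]) = hd p" by (cases xs) (auto simp: p)
  ultimately show ?thesis by simp
qed

lemma symp_adj: "symp (adj m)"
  by (auto simp: symp_def adj_def)

definition admissible :: "nat \<Rightarrow> node set" where
  "admissible m = {v. snd v \<in> idx (if fst v then int m - 1 else int m - 2)}"

lemma node_map_axis_HH:
  assumes "m \<ge> 2" "v \<in> admissible m"
  shows "node_map m v (axis i 1) \<in> HH"
proof -
  have k: "0 \<le> snd v $ j" for j using assms(2) by (auto simp: admissible_def idx_iff)
  have s: "snd v $ 1 + snd v $ 2 + snd v $ 3 = (if fst v then int m - 1 else int m - 2)"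
    using assms(2) by (auto simp: admissible_def idx_iff)
  have rs: "real_of_int (snd v $ 1) + real_of_int (snd v $ 2) + real_of_int (snd v $ 3) = (if fst v then real m - 1 else real m - 2)"
    using arg_cong[OF s, of real_of_int] by (auto split: if_splits)
  have "0 \<le> node_map m v (axis i 1) $ j" for j
    using k[of j] by (auto simp: node_map_def axis_def)
  moreover have "node_map m v (axis i 1) $ 1 + node_map m v (axis i 1) $ 2 + node_map m v (axis i 1) $ 3 = 1"
    using exhaust_3[of i] rs assms(1)
    by (elim disjE; simp add: node_map_def axis_def split: if_splits flip: add_divide_distrib)
  ultimately show ?thesis by (simp add: HH_iff)
qed

text \<open>The vertices determine their barycentric coordinates, as these lie in \<open>HH\<close>.
  From vertex 1 to vertex 2 the coordinate 1 decreases in an up triangle and increases in a down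
  triangle, which reveals the orientation and then the index.\<close>

lemma inj_on_node_triangle:
  assumes "m \<ge> 2"
  shows "inj_on (node_triangle m) (admissible m)"
proof (rule inj_onI)
  fix u v assume u: "u \<in> admissible m" and v: "v \<in> admissible m" and eq: "node_triangle m u = node_triangle m v"
  have "from_bary (node_map m u (axis i 1)) = from_bary (node_map m v (axis i 1))" for i
    using arg_cong[OF eq, of "\<lambda>A. A $ i"] by (simp add: node_triangle_eq map_triangle_def)
  then have "node_map m u (axis i 1) = node_map m v (axis i 1)" for i
    using inj_onD[OF inj_on_from_bary] node_map_axis_HH[OF assms] u v by blast
  then have "real m * node_map m u (axis i 1) $ j = real m * node_map m v (axis i 1) $ j" for i j by simp
  then have coord: "real_of_int (snd u $ j) + (if fst u then axis i 1 $ j else 1 - axis i 1 $ j) =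
      real_of_int (snd v $ j) + (if fst v then axis i 1 $ j else 1 - axis i 1 $ j)" for i j
    using assms by (simp add: node_map_def)
  have "fst u = fst v"
    using coord[of 1 1] coord[of 1 2] coord[of 2 1] by (auto simp: axis_def split: if_splits)
  moreover from this have "snd u $ j = snd v $ j" for j using coord[of j j] by (auto split: if_splits)
  ultimately show "u = v" by (simp add: prod_eq_iff vec_eq_iff)
qed

lemma adj_node_triangle:
  assumes "m \<ge> 2" "u \<in> admissible m" "v \<in> admissible m"
  shows "adj m (node_triangle m u) (node_triangle m v) \<longleftrightarrow> node_adj u v"
proof -
  have nb: "neighbours m j (node_triangle m u) (node_triangle m v) \<longleftrightarrow> linked j u v"
    if u: "u \<in> admissible m" and v: "v \<in> admissible m" for j u v
  proof
    assume "neighbours m j (node_triangle m u) (node_triangle m v)"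
    then obtain k k' where k: "k \<in> idx (int m - 1)" "k' \<in> idx (int m - 2)"
      "node_triangle m u = T m k" "node_triangle m v = T' m k'" "k $ j = k' $ j + 1" "\<forall>i. i \<noteq> j \<longrightarrow> k $ i = k' $ i"
      unfolding neighbours_def by blast
    have "u = (True, k)"
      using inj_onD[OF inj_on_node_triangle[OF assms(1)], of u "(True, k)"] u k
      by (simp add: admissible_def node_triangle_def)
    moreover have "v = (False, k')"
      using inj_onD[OF inj_on_node_triangle[OF assms(1)], of v "(False, k')"] v k
      by (simp add: admissible_def node_triangle_def)
    ultimately show "linked j u v" using k by (auto simp: linked_def)
  next
    assume l: "linked j u v"
    then have "snd u \<in> idx (int m - 1)" "snd v \<in> idx (int m - 2)"
      using u v by (auto simp: linked_def admissible_def)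
    moreover have "snd u $ j = snd v $ j + 1" "\<forall>i. i \<noteq> j \<longrightarrow> snd u $ i = snd v $ i"
      using l by (auto simp: linked_def)
    moreover have "node_triangle m u = T m (snd u)" "node_triangle m v = T' m (snd v)"
      using l by (auto simp: linked_def node_triangle_def)
    ultimately show "neighbours m j (node_triangle m u) (node_triangle m v)"
      unfolding neighbours_def by blast
  qed
  show ?thesis unfolding adj_def node_adj_def sym_linked_def
    using nb[OF assms(2,3)] nb[OF assms(3,2)] by simp
qed

lemma same_strip_coord:
  assumes "m \<ge> 2" "u \<in> admissible m" "v \<in> admissible m" "Z \<in> strips m y"
    "node_triangle m u \<in> Z" "node_triangle m v \<in> Z"
  shows "snd u $ y = snd v $ y"
proof -
  obtain K where Z: "Z = strip m y K" using assms(4) unfolding strips_def by blast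
  have "snd w $ y = K" if w: "w \<in> admissible m" "node_triangle m w \<in> strip m y K" for w
  proof -
    obtain w' where w': "w' \<in> admissible m" "node_triangle m w = node_triangle m w'" "snd w' $ y = K"
    proof -
      consider k where "node_triangle m w = T m k" "k \<in> idx (int m - 1)" "k $ y = K"
        | k where "node_triangle m w = T' m k" "k \<in> idx (int m - 2)" "k $ y = K"
        using w(2) unfolding strip_def by blast
      then show ?thesis
      proof cases
        case (1 k)
        then show ?thesis using that[of "(True, k)"] by (simp add: admissible_def node_triangle_def)
      next
        case (2 k)
        then show ?thesis using that[of "(False, k)"] by (simp add: admissible_def node_triangle_def)
      qed
    qed
    then show ?thesis using inj_onD[OF inj_on_node_triangle[OF assms(1)]] w(1) by metis
  qed
  then show ?thesis using assms Z by metis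
qed

definition exit_index :: "nat \<Rightarrow> int^3 \<Rightarrow> bool \<Rightarrow> 3 \<Rightarrow> int^3" where
  "exit_index m k \<sigma> i =
     (if \<sigma> then (if i = 1 then vector [0, k $ 1, int m - 1 - k $ 1]
                 else if i = 2 then vector [k $ 2, 0, int m - 1 - k $ 2]
                 else vector [k $ 3, int m - 1 - k $ 3, 0])
      else (if i = 1 then vector [0, int m - 1 - k $ 1, k $ 1]
            else if i = 2 then vector [int m - 1 - k $ 2, 0, k $ 2]
            else vector [int m - 1 - k $ 3, k $ 3, 0]))"

lemma exit_at_eq:
  "white_exit_at m k i = T m (exit_index m k True i)"
  "yellow_exit_at m k i = T m (exit_index m k False i)"
  by (simp_all add: white_exit_at_def yellow_exit_at_def exit_index_def)

lemma exit_index_zero: "exit_index m k \<sigma> i $ i = 0"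
  using exhaust_3[of i] by (auto simp: exit_index_def)

lemma exit_index_opposite:
  "i \<noteq> j \<Longrightarrow> exit_index m k \<sigma> j $ i + exit_index m k (\<not> \<sigma>) j $ i = int m - 1"
  using exhaust_3[of i] exhaust_3[of j] by (auto simp: exit_index_def)

lemma exit_index_idx: "exit_triple m S k \<Longrightarrow> exit_index m k \<sigma> i \<in> idx (int m - 1)"
  using exhaust_3[of i] by (auto simp: exit_index_def idx_iff forall_3 exit_triple_def)

lemma exit_index_cong: "k $ i = k' $ i \<Longrightarrow> exit_index m k \<sigma> i = exit_index m k' \<sigma> i"
  using exhaust_3[of i] by (auto simp: exit_index_def)

text \<open>An exchange argument: putting the position of w into the j-th entry of the exit triple
  yields an exit triple again. Thus uniqueness of the triple becomes uniqueness at each side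
  separately.\<close>

lemma exit_triple_unique_index:
  assumes ex: "\<exists>!k. exit_triple m S k" and k: "exit_triple m S k"
    and w: "w \<in> idx (int m - 1)" "T m w \<in> white_up S" and y: "T m y \<in> yellow_up S"
    and j: "w $ j = 0" "y $ j = 0" "\<And>i. i \<noteq> j \<Longrightarrow> w $ i + y $ i = int m - 1"
  shows "w = exit_index m k True j"
proof -
  \<comment> \<open>The entry for side 1 is the second coordinate of the white exit, the entries for
    sides 2 and 3 are first coordinates.\<close>
  define l where "l = (\<chi> i. if i = j then w $ (if j = 1 then 2 else 1) else k $ i)"
  have sum: "w $ 1 + w $ 2 + w $ 3 = int m - 1" "\<And>i. 0 \<le> w $ i" using w(1) by (auto simp: idx_iff)
  have wl: "w = exit_index m l True j"
    using exhaust_3[of j] j(1) sum(1) by (auto simp: exit_index_def l_def vec_eq_iff forall_3)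
  have yl: "y = exit_index m l False j"
    using exhaust_3[of j] j(1,2) j(3)[of 1] j(3)[of 2] j(3)[of 3] sum(1)
    by (auto simp: exit_index_def l_def vec_eq_iff forall_3)
  have "exit_triple m S l"
    unfolding exit_triple_def exit_at_eq
  proof (intro conjI allI)
    fix i
    have b: "0 \<le> w $ i' \<and> w $ i' \<le> int m - 1" for i'
      using sum(1) sum(2)[of 1] sum(2)[of 2] sum(2)[of 3] exhaust_3[of i'] by auto
    show "0 \<le> l $ i" "l $ i \<le> int m - 1"
      using b k unfolding l_def exit_triple_def by auto
    show "T m (exit_index m l True i) \<in> white_up S"
      using k w(2) wl exit_index_cong[of l i k m True] unfolding exit_triple_def exit_at_eq
      by (cases "i = j") (auto simp: l_def)
    show "T m (exit_index m l False i) \<in> yellow_up S"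
      using k y yl exit_index_cong[of l i k m False] unfolding exit_triple_def exit_at_eq
      by (cases "i = j") (auto simp: l_def)
  qed
  then have "l = k" using ex k by blast
  then show ?thesis using wl by simp
qed

lemma corner_triangle:
  assumes "m \<ge> 2"
  shows "PP $ i \<in> full (T m (axis i (int m - 1)))"
proof -
  have "T m (axis i (int m - 1)) $ i = (1 / real m) *\<^sub>R (of_int (int m - 1) *\<^sub>R PP $ i + PP $ i)"
    using exhaust_3[of i] by (auto simp: T_def sum_3 axis_def)
  also have "\<dots> = (1 / real m) *\<^sub>R (real m *\<^sub>R PP $ i)" by (simp add: scaleR_left_diff_distrib)
  also have "\<dots> = PP $ i" using assms by simp
  finally show ?thesis unfolding full_def by (metis hull_inc rangeI)
qed

lemma axis_index_inj: "m \<ge> 2 \<Longrightarrow> axis i (int m - 1) = axis j (int m - 1) \<Longrightarrow> i = j"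
  by (auto simp: axis_eq_axis)

definition pattern_path :: "nat \<Rightarrow> patterns \<Rightarrow> bool \<Rightarrow> 3 \<Rightarrow> 3 \<Rightarrow> triangle list" where
  "pattern_path m S \<sigma> i j = (if \<sigma> then white_path m S i j else yellow_path m S i j)"

definition pattern_triangles :: "patterns \<Rightarrow> bool \<Rightarrow> triangle set" where
  "pattern_triangles S \<sigma> = (if \<sigma> then white_up S \<union> white_down S else yellow_up S \<union> yellow_down S)"

text \<open>Resolves two nested definite descriptions: the exit triple is unique by the exits
  property, the path by acyclicity.\<close>

lemma pattern_path:
  assumes "labyrinth_patterns_system m S" "exit_triple m S k"
  shows "graph_path (adj m) (pattern_triangles S \<sigma>) (T m (exit_index m k \<sigma> i)) (T m (exit_index m k \<sigma> j))
    (pattern_path m S \<sigma> i j)"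
proof -
  have "\<exists>!k. exit_triple m S k" using assms(1) by (simp add: labyrinth_patterns_system_def exits_property_def)
  then have the: "(THE k. exit_triple m S k) = k" using assms(2) by (rule the1_equality)
  have tree: "graph_tree (adj m) (pattern_triangles S \<sigma>)"
    using assms(1) by (simp add: labyrinth_patterns_system_def tree_property_def pattern_triangles_def)
  have "T m (exit_index m k \<sigma> l) \<in> pattern_triangles S \<sigma>" for l
    using assms(2) unfolding exit_triple_def exit_at_eq pattern_triangles_def by (cases \<sigma>) auto
  then obtain p where p: "graph_path (adj m) (pattern_triangles S \<sigma>) (T m (exit_index m k \<sigma> i)) (T m (exit_index m k \<sigma> j)) p"
    using tree unfolding graph_tree_def by blast
  have "pattern_path m S \<sigma> i j = (THE p. graph_path (adj m) (pattern_triangles S \<sigma>) (T m (exit_index m k \<sigma> i)) (T m (exit_index m k \<sigma> j)) p)"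
    by (simp add: pattern_path_def white_path_def yellow_path_def white_exit_def yellow_exit_def the exit_at_eq pattern_triangles_def)
  also have "\<dots> = p"
    using p graph_path_unique[OF symp_adj] tree unfolding graph_tree_def by (intro the_equality) blast+
  finally show ?thesis using p by simp
qed

definition pattern_nodes :: "nat \<Rightarrow> patterns \<Rightarrow> bool \<Rightarrow> node set" where
  "pattern_nodes m S \<sigma> = {v \<in> admissible m. node_triangle m v \<in> pattern S \<sigma> (fst v)}"

lemma pattern_nodes_image:
  assumes "patterns_system m S"
  shows "pattern S \<sigma> d = node_triangle m ` {v \<in> pattern_nodes m S \<sigma>. fst v = d}"
proof
  show "pattern S \<sigma> d \<subseteq> node_triangle m ` {v \<in> pattern_nodes m S \<sigma>. fst v = d}"
  proof
    fix U assume U: "U \<in> pattern S \<sigma> d"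
    then have "U \<in> (if d then TT m else TT' m)"
      using assms by (auto simp: patterns_system_def pattern_def split: if_splits)
    then obtain k where k: "U = node_triangle m (d, k)" "(d, k) \<in> admissible m"
      by (auto simp: TT_def TT'_def node_triangle_def admissible_def split: if_splits)
    then show "U \<in> node_triangle m ` {v \<in> pattern_nodes m S \<sigma>. fst v = d}"
      using U by (intro image_eqI[of _ _ "(d, k)"]) (auto simp: pattern_nodes_def)
  qed
qed (auto simp: pattern_nodes_def)

lemma pattern_triangles_image:
  assumes "patterns_system m S"
  shows "pattern_triangles S \<sigma> = node_triangle m ` pattern_nodes m S \<sigma>"
proof -
  have "pattern_triangles S \<sigma> = pattern S \<sigma> True \<union> pattern S \<sigma> False"
    by (simp add: pattern_triangles_def pattern_def)
  also have "\<dots> = node_triangle m ` pattern_nodes m S \<sigma>"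
    unfolding pattern_nodes_image[OF assms, of \<sigma> True] pattern_nodes_image[OF assms, of \<sigma> False] by blast
  finally show ?thesis .
qed

lemma successively_node_adj:
  assumes "m \<ge> 2" "set q \<subseteq> admissible m"
  shows "successively (adj m) (map (node_triangle m) q) \<longleftrightarrow> successively node_adj q"
  unfolding successively_map
  by (intro successively_cong refl adj_node_triangle[OF assms(1)] subsetD[OF assms(2)])

lemma pattern_nodes_acyclic:
  assumes "labyrinth_patterns_system m S"
  shows "\<nexists>q. graph_cycle node_adj (pattern_nodes m S \<sigma>) q"
proof clarify
  fix q assume q: "graph_cycle node_adj (pattern_nodes m S \<sigma>) q"
  have m: "m \<ge> 2" and ps: "patterns_system m S"
    using assms by (auto simp: labyrinth_patterns_system_def patterns_system_def)
  have sub: "set q \<subseteq> admissible m" using q by (auto simp: graph_cycle_def pattern_nodes_def)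
  have "q \<noteq> []" using q by (auto simp: graph_cycle_def)
  have "length q \<ge> 3" "set q \<subseteq> pattern_nodes m S \<sigma>" "distinct q" "successively node_adj q" "node_adj (last q) (hd q)"
    using q by (auto simp: graph_cycle_def)
  moreover have "inj_on (node_triangle m) (set q)" using inj_on_node_triangle[OF m] sub by (rule inj_on_subset)
  moreover have "adj m (node_triangle m (last q)) (node_triangle m (hd q))"
    using adj_node_triangle[OF m] sub \<open>q \<noteq> []\<close> \<open>node_adj (last q) (hd q)\<close> by (meson hd_in_set last_in_set subsetD)
  ultimately have "graph_cycle (adj m) (pattern_triangles S \<sigma>) (map (node_triangle m) q)"
    unfolding graph_cycle_def pattern_triangles_image[OF ps] using \<open>q \<noteq> []\<close>
    by (auto simp: distinct_map successively_node_adj[OF m sub] hd_map last_map)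
  moreover have "graph_tree (adj m) (pattern_triangles S \<sigma>)"
    using assms by (simp add: labyrinth_patterns_system_def tree_property_def pattern_triangles_def)
  ultimately show False unfolding graph_tree_def by blast
qed

definition spine :: "nat \<Rightarrow> patterns \<Rightarrow> bool \<Rightarrow> 3 \<Rightarrow> 3 \<Rightarrow> node set" where
  "spine m S \<sigma> i j = {v \<in> pattern_nodes m S \<sigma>. node_triangle m v \<in> set (pattern_path m S \<sigma> i j)}"

lemma spine_connected:
  assumes lab: "labyrinth_patterns_system m S" and k: "exit_triple m S k"
    and uv: "u \<in> spine m S \<sigma> i j" "v \<in> spine m S \<sigma> i j"
  shows "(restricted node_adj (spine m S \<sigma> i j))\<^sup>*\<^sup>* u v"
proof -
  have m: "m \<ge> 2" and ps: "patterns_system m S"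
    using lab by (auto simp: labyrinth_patterns_system_def patterns_system_def)
  have sub: "pattern_nodes m S \<sigma> \<subseteq> admissible m" by (auto simp: pattern_nodes_def)
  have path: "set (pattern_path m S \<sigma> i j) \<subseteq> node_triangle m ` pattern_nodes m S \<sigma>"
    "successively (adj m) (pattern_path m S \<sigma> i j)"
    using pattern_path[OF lab k, of \<sigma> i j] pattern_triangles_image[OF ps, of \<sigma>] unfolding graph_path_def by auto
  obtain q where q: "pattern_path m S \<sigma> i j = map (node_triangle m) q" "set q \<subseteq> pattern_nodes m S \<sigma>"
  proof -
    have "pattern_path m S \<sigma> i j \<in> lists (node_triangle m ` pattern_nodes m S \<sigma>)"
      using path(1) by (simp add: in_lists_conv_set subset_iff)
    then obtain q where "q \<in> lists (pattern_nodes m S \<sigma>)" "pattern_path m S \<sigma> i j = map (node_triangle m) q"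
      unfolding lists_image by blast
    then show ?thesis using that by (auto simp: in_lists_conv_set)
  qed
  have "successively node_adj q"
    using path(2) successively_node_adj[OF m order_trans[OF q(2) sub]] q(1) by simp
  have eq: "spine m S \<sigma> i j = set q"
  proof
    show "spine m S \<sigma> i j \<subseteq> set q"
    proof
      fix x assume "x \<in> spine m S \<sigma> i j"
      then have "x \<in> admissible m" "node_triangle m x \<in> node_triangle m ` set q"
        unfolding spine_def q(1) using sub by auto
      then show "x \<in> set q"
        using inj_on_image_mem_iff[OF inj_on_node_triangle[OF m], of x "set q"] q(2) sub by blast
    qed
    show "set q \<subseteq> spine m S \<sigma> i j" unfolding spine_def q(1) using q(2) by auto
  qed
  note from_hd = successively_rtranclp_from_hd[OF \<open>successively node_adj q\<close>]
  show ?thesis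
    using rtranclp_trans[OF restricted_rtranclp_sym[OF symp_node_adj from_hd] from_hd] uv
    unfolding eq by blast
qed

lemma exit_in_spine:
  assumes lab: "labyrinth_patterns_system m S" and k: "exit_triple m S k" and "l = i \<or> l = j"
  shows "(True, exit_index m k \<sigma> l) \<in> spine m S \<sigma> i j"
proof -
  have "T m (exit_index m k \<sigma> l) \<in> set (pattern_path m S \<sigma> i j)"
    using pattern_path[OF lab k, of \<sigma> i j] assms(3) unfolding graph_path_def by (metis hd_in_set last_in_set)
  moreover have "T m (exit_index m k \<sigma> l) \<in> pattern S \<sigma> True"
    using k unfolding exit_triple_def exit_at_eq pattern_def by (cases \<sigma>) auto
  ultimately show ?thesis
    using exit_index_idx[OF k, of \<sigma> l]
    by (auto simp: spine_def pattern_nodes_def admissible_def node_triangle_def)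
qed

lemma spine_coord:
  assumes "m \<ge> 2" "\<not> pi_blocked m S {i, j}" "i \<noteq> j" "y \<noteq> i" "y \<noteq> j" "u \<in> spine m S \<sigma> i j" "v \<in> spine m S \<sigma> i j"
  shows "snd u $ y = snd v $ y"
proof -
  have "{y} = {1, 2, 3} - {i, j}"
    using assms(3-5) exhaust_3[of i] exhaust_3[of j] exhaust_3[of y] by auto
  then have "\<not> blocked_path m y (pattern_path m S \<sigma> i j)"
    using assms(2) unfolding pi_blocked_def pattern_path_def by (cases \<sigma>) auto
  then obtain Z where "Z \<in> strips m y" "node_triangle m u \<in> Z" "node_triangle m v \<in> Z"
    using assms(6,7) unfolding blocked_path_def spine_def by blast
  then show ?thesis using same_strip_coord[OF assms(1)] assms(6,7) unfolding spine_def pattern_nodes_def by blast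
qed

section \<open>Choice of the indices and verification of the hub system\<close>

lemma PI_hub:
  assumes "\<exists>!\<pi>. \<pi> \<in> PI \<and> B \<pi>"
  obtains a b c :: 3 where "a \<noteq> b" "a \<noteq> c" "b \<noteq> c" "\<not> B {a, c}" "\<not> B {b, c}"
proof -
  obtain \<pi> where \<pi>: "\<pi> \<in> PI" "\<And>\<rho>. \<rho> \<in> PI \<Longrightarrow> \<rho> \<noteq> \<pi> \<Longrightarrow> \<not> B \<rho>" using assms by blast
  have PI: "{1, 2} \<in> PI" "{1, 3} \<in> PI" "{2, 3} \<in> PI" by (auto simp: PI_def)
  have ne: "{1, 2} \<noteq> {1, 3 :: 3}" "{1, 2} \<noteq> {2, 3 :: 3}" "{1, 3} \<noteq> {2, 3 :: 3}"
    by (auto simp: doubleton_eq_iff)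
  consider "\<pi> = {1, 2}" | "\<pi> = {1, 3}" | "\<pi> = {2, 3}" using \<pi>(1) by (auto simp: PI_def)
  then show ?thesis
  proof cases
    case 1
    then show ?thesis using that[of 1 2 3] \<pi>(2) PI ne by auto
  next
    case 2
    then show ?thesis using that[of 1 3 2] \<pi>(2) PI ne by (auto simp: insert_commute)
  next
    case 3
    then show ?thesis using that[of 2 3 1] \<pi>(2) PI ne by (auto simp: insert_commute)
  qed
qed

theorem theorem10p4:
  fixes m :: nat and S :: patterns and L :: "point set"
  assumes "labyrinth_patterns_system m S"
    and "\<exists>!\<pi>. \<pi> \<in> PI \<and> pi_blocked m S \<pi>"
    and "L \<in> {white_fractal S, yellow_fractal S}"
  shows "(\<forall>a \<in> nontrivial_arcs L. arc_length a < \<infinity>) \<and>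
         (\<forall>a \<in> nontrivial_arcs L. hausdorff_dim a = 1) \<and>
         (\<forall>a \<in> nontrivial_arcs L. arc_length {x \<in> a. \<not> (\<exists>\<tau>. is_tangent a x \<tau>)} = 0)"
proof -
  note lab = assms(1)
  have m: "m \<ge> 2" and ps: "patterns_system m S" and corners: "corners_property S"
    using lab by (auto simp: labyrinth_patterns_system_def patterns_system_def)
  have ex1: "\<exists>!k. exit_triple m S k" using lab by (simp add: labyrinth_patterns_system_def exits_property_def)
  then obtain k where k: "exit_triple m S k" by blast
  obtain a b c :: 3 where abc: "a \<noteq> b" "a \<noteq> c" "b \<noteq> c"
    and unblocked: "\<not> pi_blocked m S {a, c}" "\<not> pi_blocked m S {b, c}"
    using PI_hub[OF assms(2)] by blast
  define N where "N = pattern_nodes m S"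
  define ex where "ex = exit_index m k"
  \<comment> \<open>For y in \<open>{a, b}\<close> the strip of type y belongs to the path between
    the two exits different from y, which are those at c and at \<open>other y\<close>.\<close>
  define other where "other y = (if y = a then b else a)" for y
  define Sp where "Sp y \<sigma> = spine m S \<sigma> (other y) c" for y \<sigma>
  have other: "other y \<in> {a, b}" "other y \<noteq> y" "other y \<noteq> c" "y \<noteq> c" "\<not> pi_blocked m S {other y, c}"
    if "y \<in> {a, b}" for y
    using that abc unblocked by (auto simp: other_def)
  have other_cases: "i = y \<or> i = c \<or> i = other y" if "y \<in> {a, b}" for i y
    using distinct_3_cases[of y c "other y" i] other[OF that] by auto
  have exit_Sp: "(True, ex \<sigma> i) \<in> Sp y \<sigma>" if "y \<in> {a, b}" "i \<noteq> y" for y \<sigma> i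
    using exit_in_spine[OF lab k] other_cases[OF that(1), of i] that(2) unfolding ex_def Sp_def by blast
  have coord_Sp: "snd v $ y = ex \<sigma> c $ y" if "y \<in> {a, b}" "v \<in> Sp y \<sigma>" for y \<sigma> v
    using spine_coord[OF m other(5)[OF that(1)], of y v \<sigma> "(True, ex \<sigma> c)"] other[OF that(1)] that
      exit_Sp[OF that(1), of c \<sigma>] unfolding Sp_def by simp
  have exit_N: "(True, ex \<sigma> i) \<in> N \<sigma>" for \<sigma> i
    using exit_in_spine[OF lab k, of i i i \<sigma>] unfolding ex_def N_def spine_def by blast
  have corner_mem: "T m (axis i (int m - 1)) \<in> corners (if \<sigma> then white_up S else yellow_up S)"
    and corner_adm: "(True, axis i (int m - 1)) \<in> admissible m"
    if "(True, axis i (int m - 1)) \<in> N \<sigma>" for i \<sigma>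
    using that corner_triangle[OF m, of i]
    by (auto simp: N_def pattern_nodes_def pattern_def node_triangle_def corners_def split: if_splits)
  have corner_inj: "i = j" if "(True, axis i (int m - 1)) \<in> N \<sigma>" "(True, axis j (int m - 1)) \<in> N \<sigma>" for i j \<sigma>
  proof -
    have "T m (axis i (int m - 1)) = T m (axis j (int m - 1))"
      using corner_mem[OF that(1)] corner_mem[OF that(2)] corners
      unfolding corners_property_def by (cases \<sigma>) auto
    then have "node_triangle m (True, axis i (int m - 1)) = node_triangle m (True, axis j (int m - 1))"
      by (simp add: node_triangle_def)
    then have "(True, axis i (int m - 1)) = (True, axis j (int m - 1))"
      using inj_on_node_triangle[OF m] corner_adm[OF that(1)] corner_adm[OF that(2)] by (auto dest: inj_onD)
    then show ?thesis using axis_index_inj[OF m] by simp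
  qed
  have ex_idx: "ex \<sigma> i \<in> idx (int m - 1)" for \<sigma> i using exit_index_idx[OF k] unfolding ex_def .
  have ex_zero: "ex \<sigma> i $ i = 0" for \<sigma> i using exit_index_zero unfolding ex_def .
  have ex_sum: "ex \<sigma> i $ y + ex \<sigma> i $ other y + ex \<sigma> i $ c = int m - 1" if "y \<in> {a, b}" for \<sigma> i y
    using ex_idx[of \<sigma> i] sum_distinct_3[of y "other y" c "ex \<sigma> i"] other[OF that] by (auto simp: idx_iff)
  \<comment> \<open>If the coordinate y of the exit at c were 0, this exit would be the corner
    triangle at \<open>other y\<close>. The path would run in the strip along side y, so the exit at
    \<open>other y\<close> would be the corner triangle at c, and one pattern would have two
    corners.\<close>
  have hub_pos: "0 < ex \<sigma> c $ y" if y: "y \<in> {a, b}" for \<sigma> y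
  proof (rule ccontr)
    assume "\<not> ?thesis"
    then have 0: "ex \<sigma> c $ y = 0" using ex_idx[of \<sigma> c] by (auto simp: idx_iff intro: antisym)
    then have 1: "ex \<sigma> (other y) $ y = 0"
      using coord_Sp[OF y exit_Sp[OF y other(2)[OF y]]] by simp
    have "ex \<sigma> c = axis (other y) (int m - 1)"
      unfolding vec_eq_iff
    proof
      fix i show "ex \<sigma> c $ i = axis (other y) (int m - 1) $ i"
        using other_cases[OF y, of i] ex_sum[OF y, of \<sigma> c] ex_zero[of \<sigma> c] 0 other[OF y] by (auto simp: axis_def)
    qed
    moreover have "ex \<sigma> (other y) = axis c (int m - 1)"
      unfolding vec_eq_iff
    proof
      fix i show "ex \<sigma> (other y) $ i = axis c (int m - 1) $ i"
        using other_cases[OF y, of i] ex_sum[OF y, of \<sigma> "other y"] ex_zero[of \<sigma> "other y"] 1 other[OF y] by (auto simp: axis_def)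
    qed
    ultimately show False
      using corner_inj exit_N[of \<sigma> c] exit_N[of \<sigma> "other y"] other(3)[OF y] by metis
  qed
  interpret hub_system m N ex a b c Sp
  proof
    show "m \<ge> 2" by (rule m)
    show "snd v \<in> idx (if fst v then int m - 1 else int m - 2)" if "v \<in> N \<sigma>" for v \<sigma>
      using that by (simp add: N_def pattern_nodes_def admissible_def)
    show "i = j" if "(True, axis i (int m - 1)) \<in> N \<sigma>" "(True, axis j (int m - 1)) \<in> N \<sigma>" for i j \<sigma>
      using corner_inj that by blast
    show False if "(True, axis i (int m - 1)) \<in> N True" "(True, axis i (int m - 1)) \<in> N False" for i
      using corner_mem[OF that(1)] corner_mem[OF that(2)] corners unfolding corners_property_def by auto
    show "ex \<sigma> j \<in> idx (int m - 1)" "ex \<sigma> j $ j = 0" for \<sigma> j by (rule ex_idx ex_zero)+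
    show opp: "ex \<sigma> j $ i + ex (\<not> \<sigma>) j $ i = int m - 1" if "i \<noteq> j" for \<sigma> i j
      using exit_index_opposite[OF that] unfolding ex_def .
    show "u = ex \<sigma> j" if ul: "(True, u) \<in> N \<sigma>" "(True, l) \<in> N (\<not> \<sigma>)" "u $ j = 0" "l $ j = 0"
      "\<And>i. i \<noteq> j \<Longrightarrow> u $ i + l $ i = int m - 1" for u l j \<sigma>
    proof (cases \<sigma>)
      case True
      then show ?thesis
        using exit_triple_unique_index[OF ex1 k, of u l j] ul
        by (auto simp: ex_def N_def pattern_nodes_def admissible_def pattern_def node_triangle_def)
    next
      case False
      \<comment> \<open>Uniqueness at a side is available for the white triangle, so it is applied
        to l; u is then obtained as its mirror image.\<close>
      then have "l = ex True j"
        using exit_triple_unique_index[OF ex1 k, of l u j] ul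
        by (auto simp: ex_def N_def pattern_nodes_def admissible_def pattern_def node_triangle_def add.commute)
      then have "u $ i = ex False j $ i" for i
        using ul(3) ul(5)[of i] opp[of i j True] ex_zero[of False j] by (cases "i = j") auto
      then show ?thesis using False by (simp add: vec_eq_iff)
    qed
    show "0 < ex \<sigma> j $ i" if "i \<noteq> j" for \<sigma> i j
    proof (cases "j = c")
      case True
      then have "i \<in> {a, b}" using that distinct_3_cases[OF abc, of i] by auto
      then show ?thesis using hub_pos True by simp
    next
      case False
      then have j: "j \<in> {a, b}" using distinct_3_cases[OF abc, of j] by auto
      let ?y = "other j"
      have y: "?y \<in> {a, b}" "other ?y = j" using j abc by (auto simp: other_def)
      \<comment> \<open>The exit at j also lies on the path of type \<open>other j\<close>, which
        fixes its coordinate there. Positivity is thus inherited from the exit at c, for i = c by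
        comparing the coordinate sums.\<close>
      have jy: "ex \<sigma> j $ ?y = ex \<sigma> c $ ?y"
        using coord_Sp[OF y(1) exit_Sp[OF y(1)], of j \<sigma>] other(2)[OF j] by simp
      consider "i = ?y" | "i = c" using other_cases[OF j, of i] \<open>i \<noteq> j\<close> by blast
      then show ?thesis
      proof cases
        case 1
        then show ?thesis using jy hub_pos[OF y(1), of \<sigma>] by simp
      next
        case 2
        then show ?thesis
          using jy ex_sum[OF j, of \<sigma> j] ex_sum[OF j, of \<sigma> c] ex_zero[of \<sigma> j] ex_zero[of \<sigma> c] hub_pos[OF j, of \<sigma>] by simp
      qed
    qed
    show "\<nexists>p. graph_cycle node_adj (N \<sigma>) p" for \<sigma>
      unfolding N_def by (rule pattern_nodes_acyclic[OF lab])
    show "a \<noteq> b" "a \<noteq> c" "b \<noteq> c" by (rule abc)+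
    show "Sp y \<sigma> \<subseteq> N \<sigma>" for y \<sigma> by (auto simp: Sp_def spine_def N_def)
    show "(restricted node_adj (Sp y \<sigma>))\<^sup>*\<^sup>* u v" if "u \<in> Sp y \<sigma>" "v \<in> Sp y \<sigma>" for u v y \<sigma>
      using spine_connected[OF lab k] that unfolding Sp_def .
    show "snd v $ y = ex \<sigma> c $ y" if "y \<in> {a, b}" "v \<in> Sp y \<sigma>" for v y \<sigma> using coord_Sp that .
    show "(True, ex \<sigma> i) \<in> Sp y \<sigma>" if "y \<in> {a, b}" "i \<noteq> y" for \<sigma> i y using exit_Sp that .
  qed
  have "pattern S s d = node_triangle m ` {v \<in> N s. fst v = d}" for s d
    unfolding N_def by (rule pattern_nodes_image[OF ps])
  then have "L = from_bary ` fractal True \<or> L = from_bary ` fractal False"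
    using assms(3) white_fractal_eq yellow_fractal_eq by auto
  then obtain \<sigma> where "L = from_bary ` fractal \<sigma>" by blast
  then show ?thesis using fractal_arcs by blast
qed

end
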